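(* Let $K$ be a field, let $n\geqslant 3$ be an odd integer, and let $R=K[x_1,\ldots,x_n]$. Let $P_n$ be the path graph on $n$ vertices with cover ideal $J(P_n)\subseteq R$. (i) If $n=4k+3$ with $k\geqslant 0$ an integer, then for every integer $t\geqslant 1$, $$\operatorname{depth} R/J(P_{4k+3})^t = \begin{cases} (2k+1)+ \left\lfloor\dfrac{2k+1}{2t+1}\right\rfloor& \text{ for all } 1\leqslant t\leqslant k,\\ 2k+1 & \text{ for all } t\geqslant k+1. \end{cases}$$ (ii) If $n=4k+1$ with $k\geqslant 1$ an integer, then for every integer $t\geqslant 1$, $$\operatorname{depth} R/J(P_{4k+1})^t= \begin{cases} 2k+ \left\lfloor \dfrac{2k}{2t+1}\right\rfloor &\text{ for all } 1\leqslant t\leqslant k-1,\\ 2k &\text{ for all } t\geqslant k. \end{cases}$$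
   Context: For $n\geqslant 2$, $P_n$ denotes the path graph with $n$ vertices, with vertex set $\{1,\ldots,n\}$ (vertex $i$ corresponding to the variable $x_i$) and edges $\{i,i+1\}$ for $i=1,\ldots,n-1$. For a simple graph $G$ on $\{1,\ldots,n\}$ and $R=K[x_1,\ldots,x_n]$ a polynomial ring over a field $K$, the cover ideal of $G$ is the ideal $J(G)$ of $R$ generated by the squarefree monomials $\prod_{i\in\tau}x_i$, where $\tau$ ranges over the minimal vertex covers of $G$ (a vertex cover is a set of vertices meeting every edge; it is minimal if no proper subset is a vertex cover). Equivalently, $J(G)=\bigcap_{\{u,v\}\in E(G)}(x_u,x_v)$; in particular $J(P_n)=\bigcap_{i=1}^{n-1}(x_i,x_{i+1})$. $J(P_n)^t$ is the ordinary $t$-th power of the ideal. For a nonzero finitely generated graded $R$-module $L$, $\operatorname{depth} L=\min\{i\mid H^i_{\mathfrak m}(L)\neq 0\}$, where $\mathfrak m=(x_1,\ldots,x_n)$ and $H^i_{\mathfrak m}$ is local cohomology with support in $\mathfrak m$. $\lfloor x\rfloor$ is the largest integer at most $x$. *)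

theory Defs
  imports "HOL-Algebra.Algebra" "HOL-Library.Poly_Mapping" "HOL-Library.Extended_Nat"
begin

section \<open>The polynomial ring \<open>K[x\<^sub>1,\<dots>,x\<^sub>n]\<close>\<close>

text \<open>
  The field \<open>K\<close> is an arbitrary type of class \<^class>\<open>field\<close>. Polynomials in variables indexed by
  all natural numbers are finitely supported functions on exponent vectors; the ring in \<open>n\<close>
  variables is cut out by its carrier.
\<close>

type_synonym 'k mpoly = "(nat \<Rightarrow>\<^sub>0 nat) \<Rightarrow>\<^sub>0 'k"

definition var :: "nat \<Rightarrow> 'k::field mpoly" where
  "var i = Poly_Mapping.single (Poly_Mapping.single i 1) 1"

definition polynomial_ring :: "nat \<Rightarrow> 'k::field mpoly ring" where
  "polynomial_ring n =
    \<lparr>carrier = {p. \<forall>m \<in> Poly_Mapping.keys p. Poly_Mapping.keys m \<subseteq> {1..n}},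
     monoid.mult = (*), one = 1, ring.zero = 0, ring.add = (+)\<rparr>"


section \<open>Graphs and cover ideals\<close>

text \<open>A simple graph is given by its vertex set and its set of edges, which are two-element sets.\<close>

definition vertex_cover :: "'v set \<Rightarrow> 'v set set \<Rightarrow> 'v set \<Rightarrow> bool" where
  "vertex_cover V E C \<longleftrightarrow> C \<subseteq> V \<and> (\<forall>e\<in>E. C \<inter> e \<noteq> {})"

definition minimal_vertex_cover :: "'v set \<Rightarrow> 'v set set \<Rightarrow> 'v set \<Rightarrow> bool" where
  "minimal_vertex_cover V E C \<longleftrightarrow>
    vertex_cover V E C \<and> (\<forall>D. D \<subset> C \<longrightarrow> \<not> vertex_cover V E D)"

definition path_edges :: "nat \<Rightarrow> nat set set" where
  "path_edges n = {{i, i + 1} | i. 1 \<le> i \<and> i + 1 \<le> n}"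

definition cover_ideal :: "nat \<Rightarrow> nat set set \<Rightarrow> 'k::field mpoly set" where
  "cover_ideal n E =
    Idl\<^bsub>polynomial_ring n\<^esub> {\<Prod>i\<in>C. var i | C. minimal_vertex_cover {1..n} E C}"


section \<open>The module \<open>R/I\<close>\<close>

definition quotient_module :: "('a, 'b) ring_scheme \<Rightarrow> 'a set \<Rightarrow> ('a, 'a set) module" where
  "quotient_module R I =
    \<lparr>carrier = carrier (R Quot I), monoid.mult = monoid.mult (R Quot I), one = monoid.one (R Quot I),
     ring.zero = ring.zero (R Quot I), ring.add = ring.add (R Quot I),
     smult = (\<lambda>a c. (I +>\<^bsub>R\<^esub> a) \<otimes>\<^bsub>R Quot I\<^esub> c)\<rparr>"


section \<open>Localization of a module at an element\<close>

text \<open>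
  \<open>module_frac R M f m k\<close> is the fraction \<open>m / f\<^sup>k\<close> of \<open>M\<^sub>f\<close>, as a set of pairs: \<open>m / f\<^sup>k = m' / f\<^sup>k\<^sup>'\<close> iff
  \<open>f\<^sup>l (f\<^sup>k\<^sup>' m) = f\<^sup>l (f\<^sup>k m')\<close> for some \<open>l\<close>.
\<close>

definition module_frac ::
    "('a, 'b) ring_scheme \<Rightarrow> ('a, 'm, 'c) module_scheme \<Rightarrow> 'a \<Rightarrow> 'm \<Rightarrow> nat \<Rightarrow> ('m \<times> nat) set" where
  "module_frac R M f m k =
    {(m', k'). m' \<in> carrier M \<and>
       (\<exists>l. (f [^]\<^bsub>R\<^esub> (l + k')) \<odot>\<^bsub>M\<^esub> m = (f [^]\<^bsub>R\<^esub> (l + k)) \<odot>\<^bsub>M\<^esub> m')}"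

text \<open>
  The additive group of \<open>M\<^sub>f\<close>, in the multiplicative notation of \<^typ>\<open>'a monoid\<close>. As with
  \<^const>\<open>rcoset_mult\<close>, the unions below are over the representatives of the given classes; all
  the sets united are equal.
\<close>

definition localization ::
    "('a, 'b) ring_scheme \<Rightarrow> ('a, 'm, 'c) module_scheme \<Rightarrow> 'a \<Rightarrow> ('m \<times> nat) set monoid" where
  "localization R M f =
    \<lparr>carrier = {module_frac R M f m k | m k. m \<in> carrier M},
     monoid.mult = (\<lambda>A B. \<Union>(m, k)\<in>A. \<Union>(m', k')\<in>B.
        module_frac R M f ((f [^]\<^bsub>R\<^esub> k') \<odot>\<^bsub>M\<^esub> m \<oplus>\<^bsub>M\<^esub> (f [^]\<^bsub>R\<^esub> k) \<odot>\<^bsub>M\<^esub> m') (k + k')),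
     one = module_frac R M f \<zero>\<^bsub>M\<^esub> 0\<rparr>"

text \<open>The canonical map \<open>M\<^sub>f \<rightarrow> M\<^bsub>fg\<^esub>\<close>, \<open>m / f\<^sup>k \<mapsto> g\<^sup>k m / (fg)\<^sup>k\<close>.\<close>

definition localization_map ::
    "('a, 'b) ring_scheme \<Rightarrow> ('a, 'm, 'c) module_scheme \<Rightarrow> 'a \<Rightarrow> 'a
      \<Rightarrow> ('m \<times> nat) set \<Rightarrow> ('m \<times> nat) set" where
  "localization_map R M f g A =
    (\<Union>(m, k)\<in>A. module_frac R M (f \<otimes>\<^bsub>R\<^esub> g) ((g [^]\<^bsub>R\<^esub> k) \<odot>\<^bsub>M\<^esub> m) k)"


section \<open>Local cohomology and depth\<close>

text \<open>
  Local cohomology of \<open>M\<close> with support in the ideal generated by the finitely many elements \<open>x i\<close>,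
  \<open>i \<in> V\<close>, as the cohomology of the extended Cech complex
  \<open>0 \<rightarrow> M \<rightarrow> \<Oplus>\<^sub>i M\<^bsub>x\<^sub>i\<^esub> \<rightarrow> \<Oplus>\<^bsub>i<j\<^esub> M\<^bsub>x\<^sub>i x\<^sub>j\<^esub> \<rightarrow> \<dots> \<rightarrow> M\<^bsub>\<Prod>x\<^sub>i\<^esub> \<rightarrow> 0\<close>, whose degree \<open>p\<close> part is the (finite) product
  of the localizations at \<open>\<Prod>\<^bsub>i\<in>F\<^esub> x\<^sub>i\<close> for \<open>F \<subseteq> V\<close> with \<open>|F| = p\<close>. The term for \<open>p = 0\<close> is the
  localization of \<open>M\<close> at \<open>1\<close>, i.e. \<open>M\<close>. Over a Noetherian ring, such as \<open>K[x\<^sub>1,\<dots>,x\<^sub>n]\<close>, these groups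
  are the right derived functors of the functor of sections with support in that ideal.
\<close>

definition faces :: "'i set \<Rightarrow> nat \<Rightarrow> 'i set set" where
  "faces V p = {F. F \<subseteq> V \<and> finite F \<and> card F = p}"

definition cech_group ::
    "('a, 'b) ring_scheme \<Rightarrow> 'i::linorder set \<Rightarrow> ('i \<Rightarrow> 'a) \<Rightarrow> ('a, 'm, 'c) module_scheme \<Rightarrow> nat
      \<Rightarrow> ('i set \<Rightarrow> ('m \<times> nat) set) monoid" where
  "cech_group R V x M p = product_group (faces V p) (\<lambda>F. localization R M (finprod R x F))"

text \<open>
  The component of the coboundary at \<open>F\<close> is the alternating sum over \<open>i \<in> F\<close> of the images of the
  components at \<open>F - {i}\<close>; sums and signs are \<^const>\<open>finprod\<close> and integer powers in the
  multiplicatively written group.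
\<close>

definition cech_diff ::
    "('a, 'b) ring_scheme \<Rightarrow> 'i::linorder set \<Rightarrow> ('i \<Rightarrow> 'a) \<Rightarrow> ('a, 'm, 'c) module_scheme \<Rightarrow> nat
      \<Rightarrow> ('i set \<Rightarrow> ('m \<times> nat) set) \<Rightarrow> ('i set \<Rightarrow> ('m \<times> nat) set)" where
  "cech_diff R V x M p c =
    (\<lambda>F \<in> faces V (Suc p).
       finprod (localization R M (finprod R x F))
         (\<lambda>i. localization_map R M (finprod R x (F - {i})) (x i) (c (F - {i}))
                [^]\<^bsub>localization R M (finprod R x F)\<^esub> ((- 1) ^ card {j \<in> F. j < i} :: int))
         F)"

definition cech_cocycles ::
    "('a, 'b) ring_scheme \<Rightarrow> 'i::linorder set \<Rightarrow> ('i \<Rightarrow> 'a) \<Rightarrow> ('a, 'm, 'c) module_scheme \<Rightarrow> nat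
      \<Rightarrow> ('i set \<Rightarrow> ('m \<times> nat) set) set" where
  "cech_cocycles R V x M p =
    kernel (cech_group R V x M p) (cech_group R V x M (Suc p)) (cech_diff R V x M p)"

definition cech_coboundaries ::
    "('a, 'b) ring_scheme \<Rightarrow> 'i::linorder set \<Rightarrow> ('i \<Rightarrow> 'a) \<Rightarrow> ('a, 'm, 'c) module_scheme \<Rightarrow> nat
      \<Rightarrow> ('i set \<Rightarrow> ('m \<times> nat) set) set" where
  "cech_coboundaries R V x M p =
    (case p of 0 \<Rightarrow> {\<one>\<^bsub>cech_group R V x M 0\<^esub>}
     | Suc q \<Rightarrow> cech_diff R V x M q ` carrier (cech_group R V x M q))"

definition local_cohomology ::
    "('a, 'b) ring_scheme \<Rightarrow> 'i::linorder set \<Rightarrow> ('i \<Rightarrow> 'a) \<Rightarrow> ('a, 'm, 'c) module_scheme \<Rightarrow> nat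
      \<Rightarrow> ('i set \<Rightarrow> ('m \<times> nat) set) set monoid" where
  "local_cohomology R V x M p =
    (cech_group R V x M p)\<lparr>carrier := cech_cocycles R V x M p\<rparr> Mod cech_coboundaries R V x M p"

text \<open>
  Depth over \<open>K[x\<^sub>1,\<dots>,x\<^sub>n]\<close> with respect to \<open>\<mm> = (x\<^sub>1,\<dots>,x\<^sub>n)\<close>. The infimum in \<^typ>\<open>enat\<close> is the
  minimum whenever some \<open>H\<^sup>i\<close> is nonzero, and \<open>\<infinity>\<close> otherwise.
\<close>

definition depth :: "nat \<Rightarrow> ('k::field mpoly, 'm) module \<Rightarrow> enat" where
  "depth n M =
    Inf {enat i | i. \<not> trivial_group (local_cohomology (polynomial_ring n) {1..n} var M i)}"

end

theory Submission
  imports Defs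
begin

text \<open>
  Write \<open>n = 2 m + 1\<close>; in all cases the depth is \<open>m + m div (2 t + 1)\<close>. The path is bipartite, so \<open>J\<^sup>t\<close>
  is the intersection of the ideals \<open>(x\<^sub>j, x\<^bsub>j+1\<^esub>)\<^sup>t\<close>, and the Cech complex splits into multidegrees
  \<open>a \<in> \<int>\<^sup>n\<close>. The piece of degree \<open>a\<close> is spanned by the sets \<open>F\<close> that contain all \<open>i\<close> with \<open>a\<^sub>i < 0\<close> and miss some
  light edge, that is, some edge \<open>{j, j + 1}\<close> with nonnegative entries of sum below \<open>t\<close>. Up to a degree shift its
  cohomology is that of the complementary family of vertex covers of the light edges, which is computed
  by removing one, two or three vertices at a time from the left end of the path: it is zero or one-dimensional, and
  in the second case the path decomposes into light pairs and single vertices, the degree of the class being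
  \<open>n - 1\<close> minus the number of pairs. Between two single vertices there are at most \<open>t\<close> consecutive
  pairs, since the right hand exponents of consecutive pairs strictly decrease from at most \<open>t - 1\<close>; this bounds the
  number of pairs, and the bound is attained.
\<close>

section \<open>Cochain complexes of set families\<close>

text \<open>The depth asks only whether cohomology vanishes, so no cohomology space is formed on the
  combinatorial side: the truth value \<open>exact_at\<close> is carried through every removal of
  vertices, and the parts of a long exact sequence become implications between such values.

  The formula comes from a count. A class with \<open>P\<close> pairs and \<open>s\<close> single
  vertices has \<open>n = 2 P + s\<close>, and in the family of covers it sits in degree
  \<open>P + s\<close>. The single vertices leave \<open>s + 1\<close> gaps for runs, hence
  \<open>P \<le> t (s + 1)\<close>, and the smallest degree arises from as many pairs as this
  allows. Passing from covers to the complementary family lowers the degree by one.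

  The obstacle on the algebraic side is that fractions are sets of pairs and operations on them are
  unions over representatives. Each localization is therefore replaced by the finitely supported
  functions on its possible exponent vectors, where the Cech differential acts separately in each
  degree. Finite support must be kept when primitives found degree by degree are put
  together.\<close>

definition fsgn :: "'i::linorder \<Rightarrow> 'i set \<Rightarrow> 'k::comm_ring_1" where
  "fsgn i F = (- 1) ^ card {j \<in> F. j < i}"

definition cobd :: "('i::linorder set \<Rightarrow> 'k::comm_ring_1) \<Rightarrow> 'i set \<Rightarrow> 'k" where
  "cobd c F = (\<Sum>i\<in>F. fsgn i F * c (F - {i}))"

definition cobd_on :: "'i::linorder set set \<Rightarrow> ('i set \<Rightarrow> 'k::comm_ring_1) \<Rightarrow> 'i set \<Rightarrow> 'k" where
  "cobd_on \<F> c = (\<lambda>F. if F \<in> \<F> then cobd c F else 0)"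

definition cochains :: "'i::linorder set set \<Rightarrow> nat \<Rightarrow> ('i set \<Rightarrow> 'k::comm_ring_1) set" where
  "cochains \<F> p = {c. \<forall>F. c F \<noteq> 0 \<longrightarrow> F \<in> \<F> \<and> card F = p}"

text \<open>The clause \<open>Suc (card F) = p\<close> makes the space of coboundaries zero in degree 0.\<close>

definition exact_at :: "'k::comm_ring_1 itself \<Rightarrow> 'i::linorder set set \<Rightarrow> nat \<Rightarrow> bool" where
  "exact_at _ \<F> p \<longleftrightarrow> (\<forall>c \<in> cochains \<F> p. cobd_on \<F> c = (\<lambda>_. 0 :: 'k) \<longrightarrow>
     (\<exists>b. (\<forall>F. b F \<noteq> 0 \<longrightarrow> F \<in> \<F> \<and> Suc (card F) = p) \<and> cobd_on \<F> b = c))"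

text \<open>Convexity makes the truncated coboundary \<open>cobd_on\<close> square to zero. It
  covers both kinds of families that occur: cover families, closed upwards within the vertex set,
  and degree pieces, closed downwards as far as the forced vertices permit.\<close>

definition convex_family :: "'i set set \<Rightarrow> bool" where
  "convex_family \<F> \<longleftrightarrow> (\<forall>F\<in>\<F>. finite F) \<and>
     (\<forall>F\<in>\<F>. \<forall>H\<in>\<F>. \<forall>G. F \<subseteq> G \<longrightarrow> G \<subseteq> H \<longrightarrow> G \<in> \<F>)"

definition upper_in :: "'i set set \<Rightarrow> 'i set set \<Rightarrow> bool" where
  "upper_in \<A> \<F> \<longleftrightarrow> \<A> \<subseteq> \<F> \<and> (\<forall>F\<in>\<A>. \<forall>G\<in>\<F>. F \<subseteq> G \<longrightarrow> G \<in> \<A>)"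

lemma convex_familyD:
  assumes "convex_family \<F>" "F \<in> \<F>" "H \<in> \<F>" "F \<subseteq> G" "G \<subseteq> H"
  shows "G \<in> \<F>"
  using assms unfolding convex_family_def by metis

lemma convex_family_finite: "convex_family \<F> \<Longrightarrow> F \<in> \<F> \<Longrightarrow> finite F"
  unfolding convex_family_def by simp

lemma upper_inD: "upper_in \<A> \<F> \<Longrightarrow> F \<in> \<A> \<Longrightarrow> G \<in> \<F> \<Longrightarrow> F \<subseteq> G \<Longrightarrow> G \<in> \<A>"
  unfolding upper_in_def by simp

lemma upper_in_subset: "upper_in \<A> \<F> \<Longrightarrow> F \<in> \<A> \<Longrightarrow> F \<in> \<F>"
  unfolding upper_in_def by blast

lemma fsgn_sq [simp]: "fsgn i F * fsgn i F = (1 :: 'k::comm_ring_1)"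
  by (simp add: fsgn_def flip: power_add mult_2)

lemma fsgn_sq_left [simp]: "fsgn i F * (fsgn i F * x) = (x :: 'k::comm_ring_1)"
  by (simp flip: mult.assoc)

lemma fsgn_remove:
  assumes "finite F" "j \<in> F"
  shows "fsgn i (F - {j}) = (if j < i then - fsgn i F else fsgn i F :: 'k::comm_ring_1)"
proof (cases "j < i")
  case True
  have "{k \<in> F. k < i} = insert j {k \<in> F - {j}. k < i}" using True assms by auto
  then have "card {k \<in> F. k < i} = Suc (card {k \<in> F - {j}. k < i})" using assms by simp
  then show ?thesis using True by (simp add: fsgn_def)
next
  case False
  then have "{k \<in> F - {j}. k < i} = {k \<in> F. k < i}" by auto
  then show ?thesis using False by (simp add: fsgn_def)
qed

lemma cobd_cobd:
  fixes c :: "'i::linorder set \<Rightarrow> 'k::comm_ring_1"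
  assumes "finite F"
  shows "cobd (cobd c) F = 0"
proof -
  define g :: "'i \<Rightarrow> 'i \<Rightarrow> 'k" where "g i j = fsgn i F * (fsgn j (F - {i}) * c (F - {i} - {j}))" for i j
  \<comment> \<open>The two orders of removing \<open>i\<close> and \<open>j\<close> differ by one
    sign, because only the larger index notices the removal of the smaller one.\<close>
  have anti: "g i j = - g j i" if "i \<in> F" "j \<in> F" "i < j" for i j
  proof -
    have "F - {j} - {i} = F - {i} - {j}" by auto
    moreover have "\<not> j < i" using that by simp
    ultimately show ?thesis using that assms by (simp add: g_def fsgn_remove algebra_simps)
  qed
  have fin: "finite {j \<in> F. j < i}" "finite {j \<in> F. i < j}" for i using assms by auto
  have "cobd (cobd c) F = (\<Sum>i\<in>F. \<Sum>j\<in>F - {i}. g i j)"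
    unfolding cobd_def g_def by (simp add: sum_distrib_left)
  also have "\<dots> = (\<Sum>i\<in>F. (\<Sum>j\<in>{j \<in> F. j < i}. g i j) + (\<Sum>j\<in>{j \<in> F. i < j}. g i j))"
  proof (rule sum.cong[OF refl])
    fix i
    have eq: "F - {i} = {j \<in> F. j < i} \<union> {j \<in> F. i < j}" by auto
    show "(\<Sum>j\<in>F - {i}. g i j) = (\<Sum>j\<in>{j \<in> F. j < i}. g i j) + (\<Sum>j\<in>{j \<in> F. i < j}. g i j)"
      unfolding eq by (rule sum.union_disjoint[OF fin]) auto
  qed
  also have "\<dots> = (\<Sum>i\<in>F. \<Sum>j\<in>{j \<in> F. j < i}. g i j) + (\<Sum>i\<in>F. \<Sum>j\<in>{j \<in> F. i < j}. g i j)"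
    by (simp add: sum.distrib)
  also have "(\<Sum>i\<in>F. \<Sum>j\<in>{j \<in> F. i < j}. g i j) = (\<Sum>j\<in>F. \<Sum>i\<in>{i \<in> F. i < j}. g i j)"
    by (rule sum.swap_restrict) (use assms in auto)
  also have "\<dots> = (\<Sum>j\<in>F. \<Sum>i\<in>{i \<in> F. i < j}. - g j i)"
    by (intro sum.cong refl) (auto intro: anti)
  finally show ?thesis by (simp add: sum_negf)
qed

lemma cobd_on_diff:
  "cobd_on \<F> (\<lambda>F. c F - b F) = (\<lambda>F. cobd_on \<F> c F - cobd_on \<F> b F)"
  by (auto simp: cobd_on_def cobd_def fun_eq_iff sum_subtractf algebra_simps)

lemma cobd_on_add:
  "cobd_on \<F> (\<lambda>F. c F + b F) = (\<lambda>F. cobd_on \<F> c F + cobd_on \<F> b F)"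
  by (auto simp: cobd_on_def cobd_def fun_eq_iff sum.distrib algebra_simps)

lemma cobd_on_zero [simp]: "cobd_on \<F> (\<lambda>_. 0) = (\<lambda>_. 0)"
  by (auto simp: cobd_on_def cobd_def)

text \<open>If \<open>F\<close> is a member but \<open>F - {i}\<close> is not, convexity keeps every
  \<open>F - {i} - {j}\<close> out of the family as well. The inner truncation thus erases only
  values that are zero anyway.\<close>

lemma cobd_on_cobd_on:
  fixes c :: "'i::linorder set \<Rightarrow> 'k::comm_ring_1"
  assumes "convex_family \<F>" "\<And>F. c F \<noteq> 0 \<Longrightarrow> F \<in> \<F>"
  shows "cobd_on \<F> (cobd_on \<F> c) = (\<lambda>_. 0)"
proof
  fix F
  show "cobd_on \<F> (cobd_on \<F> c) F = 0"
  proof (cases "F \<in> \<F>")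
    case True
    have eq: "cobd_on \<F> c (F - {i}) = cobd c (F - {i})" for i
    proof (cases "F - {i} \<in> \<F>")
      case False
      have "c (F - {i} - {j}) = 0" for j
      proof (rule ccontr)
        assume "c (F - {i} - {j}) \<noteq> 0"
        then have "F - {i} - {j} \<in> \<F>" using assms by blast
        then have "F - {i} \<in> \<F>"
          by (rule convex_familyD[OF assms(1) _ True]) auto
        then show False using False by simp
      qed
      then show ?thesis using False by (simp add: cobd_on_def cobd_def)
    qed (simp add: cobd_on_def)
    have "cobd_on \<F> (cobd_on \<F> c) F = cobd (cobd_on \<F> c) F"
      using True by (simp add: cobd_on_def)
    also have "\<dots> = cobd (cobd c) F"
      by (simp only: cobd_def[of "cobd_on \<F> c"] cobd_def[of "cobd c"] eq)
    also have "\<dots> = 0" using True assms by (intro cobd_cobd convex_family_finite)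
    finally show ?thesis .
  qed (simp add: cobd_on_def)
qed

lemma cobd_on_nonzeroD:
  assumes "cobd_on \<F> b F \<noteq> 0" "convex_family \<F>"
  shows "F \<in> \<F>" "\<exists>i\<in>F. b (F - {i}) \<noteq> 0 \<and> card F = Suc (card (F - {i}))"
proof -
  show F: "F \<in> \<F>" using assms by (auto simp: cobd_on_def split: if_splits)
  then have fin: "finite F" using assms by (auto simp: convex_family_def)
  obtain i where i: "i \<in> F" "b (F - {i}) \<noteq> 0"
  proof (rule ccontr)
    assume "\<not> thesis"
    then have "b (F - {i}) = 0" if "i \<in> F" for i using \<open>\<And>i. i \<in> F \<Longrightarrow> b (F - {i}) \<noteq> 0 \<Longrightarrow> thesis\<close> that by blast
    then have "cobd b F = 0" unfolding cobd_def by (intro sum.neutral) simp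
    then show False using assms F by (simp add: cobd_on_def)
  qed
  then show "\<exists>i\<in>F. b (F - {i}) \<noteq> 0 \<and> card F = Suc (card (F - {i}))"
    using card.remove[OF fin i(1)] by (intro bexI[OF _ i(1)] conjI)
qed

lemma cochains_cobd_on:
  assumes "convex_family \<F>" "\<And>F. b F \<noteq> 0 \<Longrightarrow> F \<in> \<F> \<and> Suc (card F) = p"
  shows "cobd_on \<F> b \<in> cochains \<F> p"
  unfolding cochains_def
proof (intro CollectI allI impI)
  fix F assume F: "cobd_on \<F> b F \<noteq> 0"
  obtain i where "b (F - {i}) \<noteq> 0" "card F = Suc (card (F - {i}))"
    using cobd_on_nonzeroD(2)[OF F assms(1)] by blast
  then show "F \<in> \<F> \<and> card F = p" using cobd_on_nonzeroD(1)[OF F assms(1)] assms(2) by simp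
qed

lemma cochainsD: "c \<in> cochains \<F> p \<Longrightarrow> c F \<noteq> 0 \<Longrightarrow> F \<in> \<F> \<and> card F = p"
  unfolding cochains_def by simp

lemma cochains_outside: "c \<in> cochains \<F> p \<Longrightarrow> F \<notin> \<F> \<Longrightarrow> c F = 0"
  unfolding cochains_def by blast

lemma exact_atI:
  assumes "\<And>c. c \<in> cochains \<F> p \<Longrightarrow> cobd_on \<F> c = (\<lambda>_. 0 :: 'k::comm_ring_1) \<Longrightarrow>
     (\<exists>b. (\<forall>F. b F \<noteq> 0 \<longrightarrow> F \<in> \<F> \<and> Suc (card F) = p) \<and> cobd_on \<F> b = c)"
  shows "exact_at TYPE('k) \<F> p"
  unfolding exact_at_def by (intro ballI impI assms)

lemma exact_atE:
  fixes c :: "'i::linorder set \<Rightarrow> 'k::comm_ring_1"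
  assumes "exact_at TYPE('k) \<F> p" "c \<in> cochains \<F> p" "cobd_on \<F> c = (\<lambda>_. 0)"
  obtains b where "\<forall>F. b F \<noteq> 0 \<longrightarrow> F \<in> \<F> \<and> Suc (card F) = p" "cobd_on \<F> b = c"
proof -
  from assms(1)[unfolded exact_at_def, rule_format, OF assms(2,3)]
  obtain b where b: "(\<forall>F. b F \<noteq> 0 \<longrightarrow> F \<in> \<F> \<and> Suc (card F) = p) \<and> cobd_on \<F> b = c" by (rule exE)
  show ?thesis by (rule that[OF conjunct1[OF b] conjunct2[OF b]])
qed

lemma exact_witnessI:
  assumes "cobd_on \<F> b = c" and supp: "\<And>F. b F \<noteq> 0 \<Longrightarrow> F \<in> \<F> \<and> Suc (card F) = p"
  shows "\<exists>b. (\<forall>F. b F \<noteq> 0 \<longrightarrow> F \<in> \<F> \<and> Suc (card F) = p) \<and> cobd_on \<F> b = c"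
  by (rule exI[of _ b]) (simp add: assms(1) supp)

text \<open>Toggling \<open>v\<close> gives a contracting homotopy. With \<open>b\<close> the
  contraction of \<open>c\<close> by \<open>v\<close>, the cocycle \<open>e = c - db\<close>
  vanishes on all sets containing \<open>v\<close>; evaluating its coboundary at
  \<open>insert v F\<close> leaves the single term \<open>e F\<close> up to sign, so
  \<open>e\<close> is zero.\<close>

lemma exact_cone:
  fixes v :: "'i::linorder"
  assumes conv: "convex_family \<F>" and cone: "\<And>F. insert v F \<in> \<F> \<longleftrightarrow> F - {v} \<in> \<F>"
  shows "exact_at TYPE('k::comm_ring_1) \<F> p"
proof (rule exact_atI)
  fix c :: "'i set \<Rightarrow> 'k"
  assume c: "c \<in> cochains \<F> p" and dc: "cobd_on \<F> c = (\<lambda>_. 0)"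
  define b where "b F = (if v \<in> F then 0 else fsgn v (insert v F) * c (insert v F))" for F
  have b: "F \<in> \<F> \<and> Suc (card F) = p" if "b F \<noteq> 0" for F
  proof -
    have F: "v \<notin> F" "c (insert v F) \<noteq> 0" using that by (auto simp: b_def split: if_splits)
    then have "insert v F \<in> \<F>" "card (insert v F) = p" using c by (auto simp: cochains_def)
    moreover have "finite (insert v F)" using convex_family_finite[OF conv calculation(1)] .
    ultimately show ?thesis using cone[of F] F by simp
  qed
  define e where "e F = c F - cobd_on \<F> b F" for F
  have de: "cobd_on \<F> e = (\<lambda>_. 0)"
    unfolding e_def cobd_on_diff using cobd_on_cobd_on[OF conv, of b] b dc by simp
  have esupp: "F \<in> \<F>" if "e F \<noteq> 0" for F
  proof (rule ccontr)
    assume F: "F \<notin> \<F>"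
    then have "c F = 0" "cobd_on \<F> b F = 0"
      using cochains_outside[OF c] by (simp_all add: cobd_on_def)
    then show False using that by (simp add: e_def)
  qed
  have e1: "e F = 0" if "v \<in> F" for F
  proof (cases "F \<in> \<F>")
    case True
    then have fin: "finite F" using conv by (auto simp: convex_family_def)
    have "cobd b F = fsgn v F * b (F - {v}) + (\<Sum>i\<in>F - {v}. fsgn i F * b (F - {i}))"
      unfolding cobd_def using fin that by (simp add: sum.remove)
    also have "(\<Sum>i\<in>F - {v}. fsgn i F * b (F - {i})) = 0"
      using that by (intro sum.neutral) (auto simp: b_def)
    also have "b (F - {v}) = fsgn v F * c F" using that by (simp add: b_def insert_absorb)
    finally have "cobd b F = c F" by simp
    then show ?thesis using True by (simp add: e_def cobd_on_def)
  qed (use esupp in blast)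
  have "e F = 0" for F
  proof (rule ccontr)
    assume ne: "e F \<noteq> 0"
    then have F: "F \<in> \<F>" "v \<notin> F" using esupp e1 by auto
    then have G: "insert v F \<in> \<F>" using cone[of F] by simp
    have fin: "finite F" using F conv by (auto simp: convex_family_def)
    have "0 = cobd e (insert v F)" using fun_cong[OF de, of "insert v F"] G by (simp add: cobd_on_def)
    also have "\<dots> = fsgn v (insert v F) * e F + (\<Sum>i\<in>F. fsgn i (insert v F) * e (insert v F - {i}))"
      unfolding cobd_def using fin F by simp
    also have "(\<Sum>i\<in>F. fsgn i (insert v F) * e (insert v F - {i})) = 0"
    proof (rule sum.neutral, rule ballI)
      fix i assume "i \<in> F"
      then have "v \<in> insert v F - {i}" using F by auto
      then show "fsgn i (insert v F) * e (insert v F - {i}) = 0" using e1 by simp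
    qed
    finally have "fsgn v (insert v F) * (fsgn v (insert v F) * e F) = 0" by simp
    then show False using ne by simp
  qed
  then have "cobd_on \<F> b = c" unfolding e_def by (intro ext) (metis eq_iff_diff_eq_0)
  then show "\<exists>b. (\<forall>F. b F \<noteq> 0 \<longrightarrow> F \<in> \<F> \<and> Suc (card F) = p) \<and> cobd_on \<F> b = c"
    by (rule exact_witnessI) (rule b)
qed

section \<open>Subcomplex and quotient complex of an upper subfamily\<close>

lemma cobd_on_upper:
  assumes "upper_in \<A> \<F>" "\<And>F. c F \<noteq> 0 \<Longrightarrow> F \<in> \<A>"
  shows "cobd_on \<A> c = cobd_on \<F> c"
proof
  fix F
  have "cobd c F = 0" if "F \<in> \<F>" "F \<notin> \<A>"
    unfolding cobd_def
  proof (rule sum.neutral, rule ballI)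
    fix i
    have "F - {i} \<notin> \<A>" using that upper_inD[OF assms(1), of "F - {i}" F] by blast
    then have "c (F - {i}) = 0" using assms(2) by blast
    then show "fsgn i F * c (F - {i}) = 0" by simp
  qed
  then show "cobd_on \<A> c F = cobd_on \<F> c F"
    using assms(1) by (auto simp: cobd_on_def upper_in_def)
qed

text \<open>A set outside \<open>\<A>\<close> has no face in \<open>\<A>\<close>, so erasing a
  cochain on \<open>\<A>\<close> does not change its coboundary off \<open>\<A>\<close>: erasing is
  the cochain map onto the quotient complex.\<close>

lemma cobd_on_lower:
  assumes "upper_in \<A> \<F>" "\<And>F. c F \<noteq> 0 \<Longrightarrow> F \<in> \<F>" "F \<in> \<F> - \<A>"
  shows "cobd_on (\<F> - \<A>) (\<lambda>F. if F \<in> \<A> then 0 else c F) F = cobd_on \<F> c F"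
proof -
  have "(if F - {i} \<in> \<A> then 0 else c (F - {i})) = c (F - {i})" for i
    using assms(2)[of "F - {i}"] assms(3) upper_inD[OF assms(1), of "F - {i}" F] by auto
  then show ?thesis using assms(3) by (simp add: cobd_on_def cobd_def)
qed

lemma convex_upper:
  assumes "upper_in \<A> \<F>" "convex_family \<F>"
  shows "convex_family \<A>"
  unfolding convex_family_def
proof (intro conjI ballI allI impI)
  show "finite F" if "F \<in> \<A>" for F
    using convex_family_finite[OF assms(2)] upper_in_subset[OF assms(1) that] .
  fix F H G assume h: "F \<in> \<A>" "H \<in> \<A>" "F \<subseteq> G" "G \<subseteq> H"
  then show "G \<in> \<A>"
    using convex_familyD[OF assms(2), of F H G] upper_in_subset[OF assms(1)]
      upper_inD[OF assms(1), of F G] by blast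
qed

text \<open>
  The next three lemmas are pieces of the long exact sequence of
  \<open>0 \<rightarrow> C(\<A>) \<rightarrow> C(\<F>) \<rightarrow> C(\<F> - \<A>) \<rightarrow> 0\<close>.
\<close>

lemma exact_at_extension:
  assumes up: "upper_in \<A> \<F>" and conv: "convex_family \<F>"
    and exA: "exact_at TYPE('k::comm_ring_1) \<A> p" and exB: "exact_at TYPE('k) (\<F> - \<A>) p"
  shows "exact_at TYPE('k) \<F> p"
proof (rule exact_atI)
  fix c :: "_ \<Rightarrow> 'k"
  assume c: "c \<in> cochains \<F> p" and dc: "cobd_on \<F> c = (\<lambda>_. 0)"
  define c' where "c' = (\<lambda>F. if F \<in> \<A> then 0 else c F)"
  have c': "c' \<in> cochains (\<F> - \<A>) p" using c by (auto simp: cochains_def c'_def)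
  have dc': "cobd_on (\<F> - \<A>) c' = (\<lambda>_. 0)"
  proof
    fix F show "cobd_on (\<F> - \<A>) c' F = 0"
    proof (cases "F \<in> \<F> - \<A>")
      case True
      then show ?thesis using cobd_on_lower[OF up _ True, of c] c dc
        unfolding c'_def by (auto simp: cochains_def)
    qed (simp only: cobd_on_def if_False)
  qed
  obtain e where e': "\<forall>F. e F \<noteq> 0 \<longrightarrow> F \<in> \<F> - \<A> \<and> Suc (card F) = p"
      "cobd_on (\<F> - \<A>) e = c'"
    by (rule exact_atE[OF exB c' dc'])
  note e = e'(1)[rule_format] e'(2)
  have e0: "(\<lambda>F. if F \<in> \<A> then 0 else e F) = e"
  proof
    show "(if F \<in> \<A> then 0 else e F) = e F" for F using e(1)[of F] by (cases "e F = 0") auto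
  qed
  \<comment> \<open>Subtracting the coboundary of the lifted primitive \<open>e\<close> kills
    \<open>c\<close> off \<open>\<A>\<close>; what remains is a cocycle of the subcomplex.\<close>
  define c2 where "c2 = (\<lambda>F. c F - cobd_on \<F> e F)"
  have de: "cobd_on \<F> e \<in> cochains \<F> p" using e(1) by (intro cochains_cobd_on[OF conv]) auto
  have dd: "cobd_on \<F> (cobd_on \<F> e) = (\<lambda>_. 0)"
    by (rule cobd_on_cobd_on[OF conv]) (use e(1) in blast)
  have c2F: "c2 \<in> cochains \<F> p" using c de by (auto simp: c2_def cochains_def) metis+
  have "c2 F = 0" if "F \<in> \<F> - \<A>" for F
    using cobd_on_lower[OF up _ that, of e] e that unfolding e0 by (auto simp: c2_def c'_def)
  then have c2: "c2 \<in> cochains \<A> p" using c2F by (auto simp: cochains_def)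
  have "cobd_on \<A> c2 = cobd_on \<F> c2"
    using c2 by (intro cobd_on_upper[OF up]) (auto simp: cochains_def)
  also have "\<dots> = (\<lambda>_. 0)" unfolding c2_def cobd_on_diff dd dc by simp
  finally have dc2: "cobd_on \<A> c2 = (\<lambda>_. 0)" .
  obtain f where f': "\<forall>F. f F \<noteq> 0 \<longrightarrow> F \<in> \<A> \<and> Suc (card F) = p" "cobd_on \<A> f = c2"
    by (rule exact_atE[OF exA c2 dc2])
  note f = f'(1)[rule_format] f'(2)
  have df: "cobd_on \<F> f = c2" using cobd_on_upper[OF up, of f] f by auto
  define b where "b = (\<lambda>F. e F + f F)"
  have "cobd_on \<F> b = c" unfolding b_def cobd_on_add df by (auto simp: c2_def)
  moreover have "F \<in> \<F> \<and> Suc (card F) = p" if "b F \<noteq> 0" for F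
  proof (cases "e F = 0")
    case True
    then show ?thesis using that f(1)[of F] up by (auto simp: b_def upper_in_def)
  next
    case False
    then show ?thesis using e(1)[of F] by auto
  qed
  ultimately show "\<exists>b. (\<forall>F. b F \<noteq> 0 \<longrightarrow> F \<in> \<F> \<and> Suc (card F) = p) \<and> cobd_on \<F> b = c"
    by (rule exact_witnessI)
qed

lemma exact_at_lower:
  assumes up: "upper_in \<A> \<F>" and conv: "convex_family \<F>"
    and exA: "exact_at TYPE('k::comm_ring_1) \<A> (Suc p)" and exF: "exact_at TYPE('k) \<F> p"
  shows "exact_at TYPE('k) (\<F> - \<A>) p"
proof (rule exact_atI)
  fix c :: "_ \<Rightarrow> 'k"
  assume c: "c \<in> cochains (\<F> - \<A>) p" and dc: "cobd_on (\<F> - \<A>) c = (\<lambda>_. 0)"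
  have c0: "(\<lambda>F. if F \<in> \<A> then 0 else c F) = c"
    using cochains_outside[OF c] by (intro ext) simp
  have cF: "c \<in> cochains \<F> p" using c by (auto simp: cochains_def)
  have dF: "cobd_on \<F> c \<in> cochains \<F> (Suc p)"
    using cF by (intro cochains_cobd_on[OF conv]) (auto simp: cochains_def)
  have "cobd_on \<F> c F = 0" if "F \<in> \<F> - \<A>" for F
    using cobd_on_lower[OF up _ that, of c] cF dc unfolding c0 by (auto simp: cochains_def)
  \<comment> \<open>This is the connecting map: the coboundary of \<open>c\<close> in the large
    family vanishes off \<open>\<A>\<close>, so it lives in the subcomplex and is a cocycle
    there.\<close>
  then have dA: "cobd_on \<F> c \<in> cochains \<A> (Suc p)" using dF by (auto simp: cochains_def)
  have "cobd_on \<A> (cobd_on \<F> c) = cobd_on \<F> (cobd_on \<F> c)"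
    using dA by (intro cobd_on_upper[OF up]) (auto simp: cochains_def)
  also have "\<dots> = (\<lambda>_. 0)" using cF by (intro cobd_on_cobd_on[OF conv]) (auto simp: cochains_def)
  finally have ddA: "cobd_on \<A> (cobd_on \<F> c) = (\<lambda>_. 0)" .
  obtain b where b': "\<forall>F. b F \<noteq> 0 \<longrightarrow> F \<in> \<A> \<and> Suc (card F) = Suc p"
      "cobd_on \<A> b = cobd_on \<F> c"
    by (rule exact_atE[OF exA dA ddA])
  note b = b'(1)[rule_format] b'(2)
  have db: "cobd_on \<F> b = cobd_on \<F> c" using cobd_on_upper[OF up, of b] b by auto
  define c2 where "c2 = (\<lambda>F. c F - b F)"
  have c2: "c2 \<in> cochains \<F> p"
    unfolding cochains_def
  proof (intro CollectI allI impI)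
    fix F assume "c2 F \<noteq> 0"
    then consider "c F \<noteq> 0" | "b F \<noteq> 0" by (cases "c F = 0") (auto simp: c2_def)
    then show "F \<in> \<F> \<and> card F = p"
      using cF b(1)[of F] up by cases (auto simp: cochains_def upper_in_def)
  qed
  have dc2: "cobd_on \<F> c2 = (\<lambda>_. 0)" unfolding c2_def cobd_on_diff db by simp
  obtain e where e': "\<forall>F. e F \<noteq> 0 \<longrightarrow> F \<in> \<F> \<and> Suc (card F) = p" "cobd_on \<F> e = c2"
    by (rule exact_atE[OF exF c2 dc2])
  note e = e'(1)[rule_format] e'(2)
  define e' where "e' = (\<lambda>F. if F \<in> \<A> then 0 else e F)"
  have "cobd_on (\<F> - \<A>) e' = c"
  proof
    fix F show "cobd_on (\<F> - \<A>) e' F = c F"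
    proof (cases "F \<in> \<F> - \<A>")
      case True
      then have "cobd_on (\<F> - \<A>) e' F = c2 F"
        using cobd_on_lower[OF up _ True, of e] e unfolding e'_def by auto
      also have "\<dots> = c F" using True b(1) by (auto simp: c2_def)
      finally show ?thesis .
    next
      case False
      then have "c F = 0" using c by (auto simp: cochains_def)
      moreover have "cobd_on (\<F> - \<A>) e' F = 0" using False unfolding cobd_on_def by (simp only: if_False)
      ultimately show ?thesis by simp
    qed
  qed
  moreover have "F \<in> \<F> - \<A> \<and> Suc (card F) = p" if "e' F \<noteq> 0" for F
    using e(1)[of F] that by (auto simp: e'_def split: if_splits)
  ultimately show "\<exists>b. (\<forall>F. b F \<noteq> 0 \<longrightarrow> F \<in> \<F> - \<A> \<and> Suc (card F) = p) \<and> cobd_on (\<F> - \<A>) b = c"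
    by (rule exact_witnessI)
qed

lemma exact_at_upper:
  assumes up: "upper_in \<A> \<F>" and conv: "convex_family \<F>"
    and exB: "exact_at TYPE('k::comm_ring_1) (\<F> - \<A>) p" and exF: "exact_at TYPE('k) \<F> (Suc p)"
  shows "exact_at TYPE('k) \<A> (Suc p)"
proof (rule exact_atI)
  fix c :: "_ \<Rightarrow> 'k"
  assume c: "c \<in> cochains \<A> (Suc p)" and dc: "cobd_on \<A> c = (\<lambda>_. 0)"
  have cF: "c \<in> cochains \<F> (Suc p)" using c up by (auto simp: cochains_def upper_in_def)
  have dcF: "cobd_on \<F> c = (\<lambda>_. 0)"
    using cobd_on_upper[OF up, of c] c dc by (auto simp: cochains_def)
  obtain b where b': "\<forall>F. b F \<noteq> 0 \<longrightarrow> F \<in> \<F> \<and> Suc (card F) = Suc p" "cobd_on \<F> b = c"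
    by (rule exact_atE[OF exF cF dcF])
  note b = b'(1)[rule_format] b'(2)
  define b' where "b' = (\<lambda>F. if F \<in> \<A> then 0 else b F)"
  have b': "b' \<in> cochains (\<F> - \<A>) p" using b(1) by (auto simp: cochains_def b'_def)
  have db': "cobd_on (\<F> - \<A>) b' = (\<lambda>_. 0)"
  proof
    fix F show "cobd_on (\<F> - \<A>) b' F = 0"
    proof (cases "F \<in> \<F> - \<A>")
      case True
      then have "cobd_on (\<F> - \<A>) b' F = c F"
        using cobd_on_lower[OF up _ True, of b] b unfolding b'_def by auto
      also have "\<dots> = 0" using True c by (auto simp: cochains_def)
      finally show ?thesis .
    qed (simp only: cobd_on_def if_False)
  qed
  obtain e where e': "\<forall>F. e F \<noteq> 0 \<longrightarrow> F \<in> \<F> - \<A> \<and> Suc (card F) = p"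
      "cobd_on (\<F> - \<A>) e = b'"
    by (rule exact_atE[OF exB b' db'])
  note e = e'(1)[rule_format] e'(2)
  have e0: "(\<lambda>F. if F \<in> \<A> then 0 else e F) = e"
  proof
    show "(if F \<in> \<A> then 0 else e F) = e F" for F using e(1)[of F] by (cases "e F = 0") auto
  qed
  have de: "cobd_on \<F> e \<in> cochains \<F> p" using e(1) by (intro cochains_cobd_on[OF conv]) auto
  have dd: "cobd_on \<F> (cobd_on \<F> e) = (\<lambda>_. 0)"
    by (rule cobd_on_cobd_on[OF conv]) (use e(1) in blast)
  \<comment> \<open>Off \<open>\<A>\<close> the primitive \<open>b\<close> is a cocycle and bounds
    \<open>e\<close>. Subtracting the coboundary of \<open>e\<close> moves \<open>b\<close> into
    \<open>\<A>\<close> without changing its own coboundary.\<close>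
  define b2 where "b2 = (\<lambda>F. b F - cobd_on \<F> e F)"
  have b2A: "b2 F = 0" if "F \<in> \<F> - \<A>" for F
    using cobd_on_lower[OF up _ that, of e] e that unfolding e0 by (auto simp: b2_def b'_def)
  have b2: "F \<in> \<A> \<and> Suc (card F) = Suc p" if "b2 F \<noteq> 0" for F
  proof -
    have "F \<in> \<F> \<and> card F = p"
      using that b(1)[of F] de by (cases "b F = 0") (auto simp: b2_def cochains_def)
    then show ?thesis using b2A[of F] that by auto
  qed
  have "cobd_on \<A> b2 = cobd_on \<F> b2" by (rule cobd_on_upper[OF up]) (use b2 in blast)
  also have "\<dots> = c" unfolding b2_def cobd_on_diff dd b(2) by simp
  finally show "\<exists>b. (\<forall>F. b F \<noteq> 0 \<longrightarrow> F \<in> \<A> \<and> Suc (card F) = Suc p) \<and> cobd_on \<A> b = c"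
    using b2 by (rule exact_witnessI)
qed

section \<open>Degree shift by a common vertex, and the one-face family\<close>

lemma exact_at_0:
  assumes "\<And>F. F \<in> \<F> \<Longrightarrow> finite F \<and> F \<noteq> {}"
  shows "exact_at TYPE('k::comm_ring_1) \<F> 0"
proof (rule exact_atI)
  fix c :: "_ \<Rightarrow> 'k" assume "c \<in> cochains \<F> 0"
  then have "c F = 0" for F
    using cochainsD[of c \<F> 0 F] assms[of F] by (cases "c F = 0") auto
  then have "c = (\<lambda>_. 0)" by (rule ext)
  then show "\<exists>b. (\<forall>F. b F \<noteq> 0 \<longrightarrow> F \<in> \<F> \<and> Suc (card F) = 0) \<and> cobd_on \<F> b = c"
    by (intro exI[of _ "\<lambda>_. 0"]) simp
qed

text \<open>A common smallest element \<open>i\<close> raises all positions by one, so insertion of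
  \<open>i\<close> commutes with the coboundary up to the factor -1, which is absorbed by negating
  primitives. Working from the left end of the path is what keeps \<open>i\<close> smallest.\<close>

lemma exact_at_shift:
  fixes i :: "'i::linorder"
  assumes fin: "\<And>G. G \<in> \<G> \<Longrightarrow> finite G" and less: "\<And>G j. G \<in> \<G> \<Longrightarrow> j \<in> G \<Longrightarrow> i < j"
  shows "exact_at TYPE('k::comm_ring_1) (insert i ` \<G>) (Suc p) \<longleftrightarrow> exact_at TYPE('k) \<G> p"
proof -
  have ni: "i \<notin> G" if "G \<in> \<G>" for G using less[OF that] by blast
  have diff: "insert i G - {i} = G" if "G \<in> \<G>" for G using ni[OF that] by simp
  have notin: "G \<notin> insert i ` \<G>" if "G \<in> \<G>" for G using ni that by blast
  have card: "card (insert i G) = Suc (card G)" if "G \<in> \<G>" for G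
    using ni[OF that] fin[OF that] by simp
  \<comment> \<open>The face that omits \<open>i\<close> is \<open>G\<close> itself; it lies outside
    the shifted family and contributes nothing.\<close>
  have key: "cobd c (insert i G) = - cobd (\<lambda>G. c (insert i G)) G"
    if "G \<in> \<G>" "\<And>F. c F \<noteq> 0 \<Longrightarrow> F \<in> insert i ` \<G>" for c :: "'i set \<Rightarrow> 'k" and G
  proof -
    have c0: "c G = 0" using that notin by blast
    have s: "fsgn j (insert i G) = - (fsgn j G :: 'k)" if "j \<in> G" for j
      using fsgn_remove[of "insert i G" i j, where 'k='k] less[OF \<open>G \<in> \<G>\<close> that]
        fin[OF \<open>G \<in> \<G>\<close>] diff[OF \<open>G \<in> \<G>\<close>] by (metis add.inverse_inverse finite_insert insertI1)
    have r: "insert i G - {j} = insert i (G - {j})" if "j \<in> G" for j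
      using ni[OF \<open>G \<in> \<G>\<close>] that by auto
    have "cobd c (insert i G) = (\<Sum>j\<in>G. fsgn j (insert i G) * c (insert i G - {j}))"
      unfolding cobd_def using fin[OF that(1)] ni[OF that(1)] c0 diff[OF that(1)] by simp
    also have "\<dots> = (\<Sum>j\<in>G. - (fsgn j G * c (insert i (G - {j}))))"
      by (intro sum.cong refl) (simp add: s r)
    finally show ?thesis by (simp add: cobd_def sum_negf)
  qed
  define dn :: "('i set \<Rightarrow> 'k) \<Rightarrow> 'i set \<Rightarrow> 'k" where "dn c G = (if G \<in> \<G> then c (insert i G) else 0)" for c G
  define up :: "('i set \<Rightarrow> 'k) \<Rightarrow> 'i set \<Rightarrow> 'k" where
    "up c F = (if F \<in> insert i ` \<G> then c (F - {i}) else 0)" for c F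
  have dnup: "dn (up c) = c" if "\<And>G. c G \<noteq> 0 \<Longrightarrow> G \<in> \<G>" for c
  proof
    show "dn (up c) G = c G" for G using that[of G] diff[of G] by (auto simp: dn_def up_def)
  qed
  have dn_d: "cobd_on \<G> (dn c) = (\<lambda>G. - dn (cobd_on (insert i ` \<G>) c) G)"
    if "\<And>F. c F \<noteq> 0 \<Longrightarrow> F \<in> insert i ` \<G>" for c
  proof
    fix G
    show "cobd_on \<G> (dn c) G = - dn (cobd_on (insert i ` \<G>) c) G"
    proof (cases "G \<in> \<G>")
      case True
      have "dn c (G - {j}) = c (insert i (G - {j}))" if "j \<in> G" for j
      proof (cases "G - {j} \<in> \<G>")
        case False
        have "insert i (G - {j}) \<notin> insert i ` \<G>"
        proof
          assume "insert i (G - {j}) \<in> insert i ` \<G>"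
          then obtain H where H: "insert i (G - {j}) = insert i H" "H \<in> \<G>" by auto
          then have "G - {j} = H" using ni[OF True] ni[OF H(2)] by (metis Diff_insert_absorb Diff_iff)
          then show False using H False by simp
        qed
        then show ?thesis using that False \<open>\<And>F. c F \<noteq> 0 \<Longrightarrow> F \<in> insert i ` \<G>\<close> by (auto simp: dn_def)
      qed (simp add: dn_def)
      then have "cobd (dn c) G = cobd (\<lambda>G. c (insert i G)) G" unfolding cobd_def by simp
      then show ?thesis using True key[OF True that] by (simp add: cobd_on_def dn_def)
    qed (simp add: cobd_on_def dn_def)
  qed
  have dn0: "c = c'" if "\<And>F. c F \<noteq> 0 \<Longrightarrow> F \<in> insert i ` \<G>" "\<And>F. c' F \<noteq> 0 \<Longrightarrow> F \<in> insert i ` \<G>"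
    "dn c = dn c'" for c c'
  proof
    fix F show "c F = c' F"
    proof (cases "F \<in> insert i ` \<G>")
      case True
      then obtain G where "G \<in> \<G>" "F = insert i G" by auto
      then show ?thesis using fun_cong[OF that(3), of G] by (simp add: dn_def)
    next
      case False then show ?thesis using that by metis
    qed
  qed
  have dsupp: "F \<in> insert i ` \<G>" if "cobd_on (insert i ` \<G>) c F \<noteq> 0" for c :: "'i set \<Rightarrow> 'k" and F
    using that by (auto simp: cobd_on_def split: if_splits)
  have upsupp: "F \<in> insert i ` \<G>" if "up e F \<noteq> 0" for e F
    using that by (auto simp: up_def split: if_splits)
  show ?thesis
  proof
    assume ex: "exact_at TYPE('k) (insert i ` \<G>) (Suc p)"
    show "exact_at TYPE('k) \<G> p"
    proof (rule exact_atI)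
      fix c :: "'i set \<Rightarrow> 'k" assume c: "c \<in> cochains \<G> p" and dc: "cobd_on \<G> c = (\<lambda>_. 0)"
      have cG: "\<And>G. c G \<noteq> 0 \<Longrightarrow> G \<in> \<G>" using c by (auto simp: cochains_def)
      have uc: "up c \<in> cochains (insert i ` \<G>) (Suc p)"
        unfolding cochains_def
      proof (intro CollectI allI impI)
        fix F assume "up c F \<noteq> 0"
        then obtain G where G: "G \<in> \<G>" "F = insert i G" "c (F - {i}) \<noteq> 0"
          by (auto simp: up_def split: if_splits)
        then show "F \<in> insert i ` \<G> \<and> card F = Suc p"
          using cochainsD[OF c, of G] ni[OF G(1)] by (simp add: card)
      qed
      have "dn (cobd_on (insert i ` \<G>) (up c)) = dn (\<lambda>_. 0)"
      proof -
        have "cobd_on \<G> (dn (up c)) = (\<lambda>G. - dn (cobd_on (insert i ` \<G>) (up c)) G)"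
          by (rule dn_d) (rule upsupp)
        then have "dn (cobd_on (insert i ` \<G>) (up c)) G = 0" for G
          using fun_cong[of _ _ G] dnup[of c, OF cG] dc by (simp add: fun_eq_iff)
        then show ?thesis by (intro ext) (simp add: dn_def[of "\<lambda>_. 0"])
      qed
      then have duc: "cobd_on (insert i ` \<G>) (up c) = (\<lambda>_. 0)" 
        by (rule dn0[rotated 2]) (auto dest: dsupp)
      obtain b where b': "\<forall>F. b F \<noteq> 0 \<longrightarrow> F \<in> insert i ` \<G> \<and> Suc (card F) = Suc p"
          "cobd_on (insert i ` \<G>) b = up c"
        by (rule exact_atE[OF ex uc duc])
      note b = b'(1)[rule_format] b'(2)
      have "cobd_on \<G> (dn b) = (\<lambda>G. - c G)"
        using dn_d[of b] b by (simp add: dnup[of c, OF cG])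
      then have "cobd_on \<G> (\<lambda>G. 0 - dn b G) = c" unfolding cobd_on_diff by simp
      moreover have "G \<in> \<G> \<and> Suc (card G) = p" if "0 - dn b G \<noteq> 0" for G
      proof -
        have "G \<in> \<G>" "b (insert i G) \<noteq> 0" using that by (auto simp: dn_def split: if_splits)
        then show ?thesis using b(1)[of "insert i G"] card[of G] by simp
      qed
      ultimately show "\<exists>b. (\<forall>F. b F \<noteq> 0 \<longrightarrow> F \<in> \<G> \<and> Suc (card F) = p) \<and> cobd_on \<G> b = c"
        by (rule exact_witnessI)
    qed
  next
    assume ex: "exact_at TYPE('k) \<G> p"
    show "exact_at TYPE('k) (insert i ` \<G>) (Suc p)"
    proof (rule exact_atI)
      fix c :: "'i set \<Rightarrow> 'k"
      assume c: "c \<in> cochains (insert i ` \<G>) (Suc p)" and dc: "cobd_on (insert i ` \<G>) c = (\<lambda>_. 0)"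
      have cG: "\<And>F. c F \<noteq> 0 \<Longrightarrow> F \<in> insert i ` \<G>" using c by (auto simp: cochains_def)
      have dnc: "dn c \<in> cochains \<G> p"
        unfolding cochains_def
      proof (intro CollectI allI impI)
        fix G assume "dn c G \<noteq> 0"
        then have "G \<in> \<G>" "c (insert i G) \<noteq> 0" by (auto simp: dn_def split: if_splits)
        then show "G \<in> \<G> \<and> card G = p" using cochainsD[OF c, of "insert i G"] card by simp
      qed
      have ddn: "cobd_on \<G> (dn c) = (\<lambda>_. 0)" using dn_d[of c, OF cG] dc by (simp add: dn_def)
      obtain b where b': "\<forall>F. b F \<noteq> 0 \<longrightarrow> F \<in> \<G> \<and> Suc (card F) = p" "cobd_on \<G> b = dn c"
        by (rule exact_atE[OF ex dnc ddn])
      note b = b'(1)[rule_format] b'(2)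
      define b' where "b' = up (\<lambda>G. - b G)"
      have db': "dn b' = (\<lambda>G. - b G)" unfolding b'_def by (rule dnup) (use b in auto)
      have b's: "\<And>F. b' F \<noteq> 0 \<Longrightarrow> F \<in> insert i ` \<G>" unfolding b'_def by (rule upsupp)
      have "cobd_on \<G> (dn b') = (\<lambda>G. 0 - dn c G)"
        using cobd_on_diff[of \<G> "\<lambda>_. 0" b] b(2) by (simp add: db')
      then have "dn (cobd_on (insert i ` \<G>) b') = dn c"
        using dn_d[of b', OF b's] by (auto simp: fun_eq_iff)
      then have "cobd_on (insert i ` \<G>) b' = c"
        by (rule dn0[rotated 2]) (auto dest: dsupp cG)
      moreover have "F \<in> insert i ` \<G> \<and> Suc (card F) = Suc p" if "b' F \<noteq> 0" for F
      proof -
        have "F \<in> insert i ` \<G>" using b's[OF that] .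
        then obtain G where G: "G \<in> \<G>" "F = insert i G" by auto
        then have "b G \<noteq> 0" using that diff[OF G(1)] by (auto simp: b'_def up_def split: if_splits)
        then show ?thesis using b(1)[of G] G card[OF G(1)] by auto
      qed
      ultimately show "\<exists>b. (\<forall>F. b F \<noteq> 0 \<longrightarrow> F \<in> insert i ` \<G> \<and> Suc (card F) = Suc p) \<and>
          cobd_on (insert i ` \<G>) b = c" by (rule exact_witnessI)
    qed
  qed
qed

text \<open>This is the family reached beyond the right end of the path. Its only class sits in
  degree 0, so the degree of a class on the whole path is the sum of the contributions of the
  removed pieces.\<close>

lemma exact_at_empty_face:
  "exact_at TYPE('k::comm_ring_1) {{} :: 'i::linorder set} p \<longleftrightarrow> p \<noteq> 0"
proof
  assume ex: "exact_at TYPE('k) {{} :: 'i set} p"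
  show "p \<noteq> 0"
  proof
    assume p: "p = 0"
    define c :: "'i set \<Rightarrow> 'k" where "c F = (if F = {} then 1 else 0)" for F
    have c: "c \<in> cochains {{}} p" "cobd_on {{}} c = (\<lambda>_. 0)"
      using p by (auto simp: cochains_def c_def cobd_on_def cobd_def)
    obtain b where b': "\<forall>F. b F \<noteq> 0 \<longrightarrow> F \<in> {{}} \<and> Suc (card F) = p" "cobd_on {{}} b = c"
      by (rule exact_atE[OF ex c])
    note b = b'(1)[rule_format] b'(2)
    have "b = (\<lambda>_. 0)" using b(1) p by blast
    then have "c {} = 0" using b(2) by auto
    then show False by (simp add: c_def)
  qed
next
  assume p: "p \<noteq> 0"
  show "exact_at TYPE('k) {{} :: 'i set} p"
  proof (rule exact_atI)
    fix c :: "'i set \<Rightarrow> 'k" assume "c \<in> cochains {{}} p"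
    then have "c F = 0" for F
      using cochainsD[of c "{{}}" p F] p by (cases "c F = 0") auto
    then have "c = (\<lambda>_. 0)" by (rule ext)
    then show "\<exists>b. (\<forall>F. b F \<noteq> 0 \<longrightarrow> F \<in> {{}} \<and> Suc (card F) = p) \<and> cobd_on {{}} b = c"
      by (intro exI[of _ "\<lambda>_. 0"]) simp
  qed
qed

section \<open>Edge covers along a path\<close>

text \<open>An edge \<open>{j, j + 1}\<close> of a path is represented by its left end \<open>j\<close>.\<close>

definition path_covers :: "nat \<Rightarrow> nat set \<Rightarrow> nat set \<Rightarrow> nat \<Rightarrow> nat set set" where
  "path_covers n N E i = {F. F \<subseteq> {i..n} \<and> N \<inter> {i..n} \<subseteq> F \<and>
     (\<forall>j\<in>E. i \<le> j \<longrightarrow> j \<in> F \<or> Suc j \<in> F)}"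

text \<open>Light edges have nonnegative entries and forced vertices negative ones. A forced vertex
  therefore lies on no edge, and splitting it off covers none.\<close>

definition edges_avoid :: "nat \<Rightarrow> nat set \<Rightarrow> nat set \<Rightarrow> bool" where
  "edges_avoid n N E \<longleftrightarrow> (\<forall>j\<in>E. 1 \<le> j \<and> Suc j \<le> n \<and> j \<notin> N \<and> Suc j \<notin> N)"

lemma path_covers_convex: "convex_family (path_covers n N E i)"
  unfolding convex_family_def path_covers_def by (auto intro: finite_subset)

lemma path_covers_end:
  assumes "edges_avoid n N E"
  shows "path_covers n N E (Suc n) = {{}}"
  using assms by (auto simp: path_covers_def edges_avoid_def)

lemma path_covers_less: "G \<in> path_covers n N E i \<Longrightarrow> j \<in> G \<Longrightarrow> i \<le> j \<and> j \<le> n"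
  by (auto simp: path_covers_def)

lemma path_covers_finite: "G \<in> path_covers n N E i \<Longrightarrow> finite G"
  by (auto simp: path_covers_def intro: finite_subset)

section \<open>Removing vertices at the left end\<close>

lemma path_covers_forced:
  assumes ok: "edges_avoid n N E" and i: "i \<in> N" "i \<le> n"
  shows "path_covers n N E i = insert i ` path_covers n N E (Suc i)"
proof (intro equalityI subsetI)
  fix F assume F: "F \<in> path_covers n N E i"
  have "i \<in> F" using F i by (auto simp: path_covers_def)
  moreover have "F - {i} \<in> path_covers n N E (Suc i)"
    using F ok by (fastforce simp: path_covers_def edges_avoid_def)
  ultimately show "F \<in> insert i ` path_covers n N E (Suc i)"
    by (intro image_eqI[of _ _ "F - {i}"]) auto
next
  fix F assume "F \<in> insert i ` path_covers n N E (Suc i)"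
  then obtain G where G: "G \<in> path_covers n N E (Suc i)" "F = insert i G" by auto
  have "j \<in> F \<or> Suc j \<in> F" if "j \<in> E" "i \<le> j" for j
    using G that by (cases "j = i") (auto simp: path_covers_def)
  then show "F \<in> path_covers n N E i"
    using G i by (fastforce simp: path_covers_def)
qed

text \<open>A forced vertex counts as a single vertex: it uses up one vertex and contributes one
  degree. Degree 0 cannot occur, since every member contains \<open>i\<close>.\<close>

lemma path_covers_forced_exact:
  assumes "edges_avoid n N E" "i \<in> N" "i \<le> n"
  shows "\<not> exact_at TYPE('k::comm_ring_1) (path_covers n N E i) p \<longleftrightarrow>
    (\<exists>q. p = Suc q \<and> \<not> exact_at TYPE('k) (path_covers n N E (Suc i)) q)"
proof (cases p)
  case 0
  have "exact_at TYPE('k) (insert i ` path_covers n N E (Suc i)) 0"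
    by (rule exact_at_0) (auto intro: path_covers_finite)
  then show ?thesis using 0 by (simp add: path_covers_forced[OF assms])
next
  case (Suc q)
  have "exact_at TYPE('k) (insert i ` path_covers n N E (Suc i)) (Suc q) \<longleftrightarrow>
      exact_at TYPE('k) (path_covers n N E (Suc i)) q"
    by (rule exact_at_shift) (auto intro: path_covers_finite dest: path_covers_less)
  then show ?thesis using Suc by (simp add: path_covers_forced[OF assms])
qed

text \<open>A vertex that is neither forced nor on a remaining edge can be toggled freely, so the
  family is a cone over it and carries no class at all.\<close>

lemma path_covers_isolated_exact:
  assumes ok: "edges_avoid n N E" and i: "i \<notin> N" "i \<notin> E" "i \<le> n"
  shows "exact_at TYPE('k::comm_ring_1) (path_covers n N E i) p"
proof (rule exact_cone[OF path_covers_convex])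
  fix F :: "nat set"
  have "j \<noteq> i" if "j \<in> E" for j using that i by auto
  then show "insert i F \<in> path_covers n N E i \<longleftrightarrow> F - {i} \<in> path_covers n N E i"
    using i by (auto simp: path_covers_def)
qed

text \<open>
  If \<open>i\<close> is a leaf of the edge \<open>{i, i + 1}\<close>, the covers containing \<open>i + 1\<close> form a cone with apex \<open>i\<close>,
  so only the covers avoiding \<open>i + 1\<close> matter.
\<close>

lemma path_covers_leaf_exact:
  assumes ok: "edges_avoid n N E" and i: "i \<in> E"
  shows "exact_at TYPE('k::comm_ring_1) (path_covers n N E i) p \<longleftrightarrow>
    exact_at TYPE('k) {F \<in> path_covers n N E i. Suc i \<notin> F} p"
proof -
  let ?F = "path_covers n N E i" and ?A = "{F \<in> path_covers n N E i. Suc i \<in> F}"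
  have iN: "i \<notin> N" "i \<le> n" using ok i by (auto simp: edges_avoid_def)
  have up: "upper_in ?A ?F" by (auto simp: upper_in_def)
  have exA: "exact_at TYPE('k) ?A q" for q
  proof (rule exact_cone[OF convex_upper[OF up path_covers_convex]])
    fix F :: "nat set"
    show "insert i F \<in> ?A \<longleftrightarrow> F - {i} \<in> ?A"
      using iN by (auto simp: path_covers_def)
  qed
  have "?F - ?A = {F \<in> ?F. Suc i \<notin> F}" by auto
  then show ?thesis
    using exact_at_extension[OF up path_covers_convex exA, of p]
      exact_at_lower[OF up path_covers_convex exA, of p] by metis
qed

text \<open>Avoiding \<open>i + 1\<close> forces \<open>i\<close>. As \<open>i + 1\<close> lies on
  no further edge, the rest of the path is unconstrained by this choice and starts at
  \<open>i + 2\<close>. This is a pair: two vertices, one degree.\<close>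

lemma path_covers_edge_exact:
  assumes ok: "edges_avoid n N E" and i: "i \<in> E" "Suc i \<notin> E"
  shows "\<not> exact_at TYPE('k::comm_ring_1) (path_covers n N E i) p \<longleftrightarrow>
    (\<exists>q. p = Suc q \<and> \<not> exact_at TYPE('k) (path_covers n N E (i + 2)) q)"
proof -
  have iN: "i \<notin> N" "Suc i \<le> n" "Suc i \<notin> N" using ok i by (auto simp: edges_avoid_def)
  have eq: "{F \<in> path_covers n N E i. Suc i \<notin> F} = insert i ` path_covers n N E (i + 2)"
  proof (intro equalityI subsetI)
    fix F assume F: "F \<in> {F \<in> path_covers n N E i. Suc i \<notin> F}"
    have "i \<in> F" using F i by (auto simp: path_covers_def)
    moreover have "F - {i} \<in> path_covers n N E (i + 2)"
    proof -
      have "F - {i} \<subseteq> {i + 2..n}"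
      proof
        fix x assume "x \<in> F - {i}"
        then have "x \<in> {i..n}" "x \<noteq> i" "x \<noteq> Suc i" using F by (auto simp: path_covers_def)
        then show "x \<in> {i + 2..n}" by auto
      qed
      then show ?thesis using F by (auto simp: path_covers_def)
    qed
    ultimately show "F \<in> insert i ` path_covers n N E (i + 2)"
      by (intro image_eqI[of _ _ "F - {i}"]) auto
  next
    fix F assume "F \<in> insert i ` path_covers n N E (i + 2)"
    then obtain G where G: "G \<in> path_covers n N E (i + 2)" "F = insert i G" by auto
    have "j \<in> F \<or> Suc j \<in> F" if "j \<in> E" "i \<le> j" for j
    proof -
      have "j = i \<or> i + 2 \<le> j" using that i by (cases "j = Suc i") auto
      then show ?thesis using G that by (auto simp: path_covers_def)
    qed
    moreover have "N \<inter> {i..n} \<subseteq> F"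
    proof
      fix x assume x: "x \<in> N \<inter> {i..n}"
      then have "x \<noteq> i" "x \<noteq> Suc i" using iN by auto
      then have "x \<in> N \<inter> {i + 2..n}" using x by auto
      then show "x \<in> F" using G by (auto simp: path_covers_def)
    qed
    moreover have "F \<subseteq> {i..n}" "Suc i \<notin> F" using G iN by (auto simp: path_covers_def)
    ultimately show "F \<in> {F \<in> path_covers n N E i. Suc i \<notin> F}"
      by (simp add: path_covers_def)
  qed
  show ?thesis
  proof (cases p)
    case 0
    have "exact_at TYPE('k) (insert i ` path_covers n N E (i + 2)) 0"
      by (rule exact_at_0) (auto intro: path_covers_finite)
    then show ?thesis using 0 by (simp add: path_covers_leaf_exact[OF ok i(1)] eq)
  next
    case (Suc q)
    have "exact_at TYPE('k) (insert i ` path_covers n N E (i + 2)) (Suc q) \<longleftrightarrow>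
        exact_at TYPE('k) (path_covers n N E (i + 2)) q"
      by (rule exact_at_shift) (auto intro: path_covers_finite dest: path_covers_less)
    then show ?thesis using Suc by (simp add: path_covers_leaf_exact[OF ok i(1)] eq)
  qed
qed

text \<open>Avoiding \<open>i + 1\<close> forces both of its neighbours. An edge from
  \<open>i + 2\<close> to \<open>i + 3\<close> is then covered already, so the rest starts at
  \<open>i + 3\<close>. The three vertices contribute two degrees and count as a pair followed by a
  single vertex.\<close>

lemma path_covers_two_edges_exact:
  assumes ok: "edges_avoid n N E" and i: "i \<in> E" "Suc i \<in> E"
  shows "\<not> exact_at TYPE('k::comm_ring_1) (path_covers n N E i) p \<longleftrightarrow>
    (\<exists>q. p = Suc (Suc q) \<and> \<not> exact_at TYPE('k) (path_covers n N E (i + 3)) q)"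
proof -
  have iN: "i \<notin> N" "Suc (Suc i) \<le> n" "Suc i \<notin> N" "Suc (Suc i) \<notin> N"
    using ok i by (auto simp: edges_avoid_def)
  let ?G = "insert (i + 2) ` path_covers n N E (i + 3)"
  have eq: "{F \<in> path_covers n N E i. Suc i \<notin> F} = insert i ` ?G"
  proof (intro equalityI subsetI)
    fix F assume F: "F \<in> {F \<in> path_covers n N E i. Suc i \<notin> F}"
    have iF: "i \<in> F" "i + 2 \<in> F" using F i by (auto simp: path_covers_def)
    moreover have "F - {i, i + 2} \<in> path_covers n N E (i + 3)"
    proof -
      have "F - {i, i + 2} \<subseteq> {i + 3..n}"
      proof
        fix x assume "x \<in> F - {i, i + 2}"
        then have "x \<in> {i..n}" "x \<noteq> i" "x \<noteq> i + 2" "x \<noteq> Suc i" using F by (auto simp: path_covers_def)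
        then show "x \<in> {i + 3..n}" by auto
      qed
      then show ?thesis using F by (auto simp: path_covers_def)
    qed
    then have "insert (i + 2) (F - {i, i + 2}) \<in> ?G" by (rule imageI)
    moreover have "F = insert i (insert (i + 2) (F - {i, i + 2}))" using iF by auto
    ultimately show "F \<in> insert i ` ?G" by (rule_tac image_eqI)
  next
    fix F assume "F \<in> insert i ` ?G"
    then obtain G where G: "G \<in> path_covers n N E (i + 3)" "F = insert i (insert (i + 2) G)" by auto
    have "j \<in> F \<or> Suc j \<in> F" if "j \<in> E" "i \<le> j" for j
    proof -
      have "j = i \<or> j = Suc i \<or> j = i + 2 \<or> i + 3 \<le> j" using that by arith
      then consider "j = i" | "j = Suc i" | "j = i + 2" | "i + 3 \<le> j" by blast
      then show ?thesis using G that by cases (auto simp: path_covers_def)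
    qed
    moreover have "N \<inter> {i..n} \<subseteq> F"
    proof
      fix x assume x: "x \<in> N \<inter> {i..n}"
      then have "x \<noteq> i" "x \<noteq> Suc i" "x \<noteq> Suc (Suc i)" using iN by auto
      then have "x \<in> N \<inter> {i + 3..n}" using x by auto
      then show "x \<in> F" using G by (auto simp: path_covers_def)
    qed
    moreover have "F \<subseteq> {i..n}" "Suc i \<notin> F" using G iN by (auto simp: path_covers_def)
    ultimately show "F \<in> {F \<in> path_covers n N E i. Suc i \<notin> F}"
      by (simp add: path_covers_def)
  qed
  show ?thesis
  proof (cases p)
    case 0
    have "exact_at TYPE('k) (insert i ` ?G) 0"
      by (rule exact_at_0) (auto intro: path_covers_finite)
    then show ?thesis using 0 by (simp add: path_covers_leaf_exact[OF ok i(1)] eq)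
  next
    case (Suc q)
    have 1: "exact_at TYPE('k) (insert i ` ?G) (Suc q) \<longleftrightarrow> exact_at TYPE('k) ?G q"
      by (rule exact_at_shift) (auto intro: path_covers_finite dest: path_covers_less)
    show ?thesis
    proof (cases q)
      case 0
      have "exact_at TYPE('k) ?G 0"
        by (rule exact_at_0) (auto intro: path_covers_finite)
      then show ?thesis using 0 1 Suc by (simp add: path_covers_leaf_exact[OF ok i(1)] eq)
    next
      case (Suc r)
      have "exact_at TYPE('k) ?G (Suc r) \<longleftrightarrow> exact_at TYPE('k) (path_covers n N E (i + 3)) r"
        by (rule exact_at_shift) (auto intro: path_covers_finite dest: path_covers_less)
      then show ?thesis
        using 1 Suc \<open>p = Suc q\<close> by (simp add: path_covers_leaf_exact[OF ok i(1)] eq)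
    qed
  qed
qed

section \<open>From covers to sets that miss an edge\<close>

definition path_misses :: "nat \<Rightarrow> nat set \<Rightarrow> nat set \<Rightarrow> nat set set" where
  "path_misses n N E = {F. F \<subseteq> {1..n} \<and> N \<inter> {1..n} \<subseteq> F \<and> (\<exists>j\<in>E. j \<notin> F \<and> Suc j \<notin> F)}"

text \<open>All sets between the forced vertices and \<open>{1..n}\<close> form a cone over any
  vertex \<open>v\<close> that is not forced, so they are acyclic. In this family the covers are an
  upper subfamily with complement \<open>path_misses n N E\<close>, and the connecting map is the
  degree shift.\<close>

lemma path_misses_exact:
  assumes ok: "edges_avoid n N E" and v: "v \<in> {1..n}" "v \<notin> N"
  shows "exact_at TYPE('k::comm_ring_1) (path_misses n N E) p \<longleftrightarrow>
    exact_at TYPE('k) (path_covers n N E 1) (Suc p)"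
proof -
  let ?F = "{F. F \<subseteq> {1..n} \<and> N \<inter> {1..n} \<subseteq> F}" and ?A = "path_covers n N E 1"
  have conv: "convex_family ?F" unfolding convex_family_def by (auto intro: finite_subset)
  have exF: "exact_at TYPE('k) ?F q" for q
    by (rule exact_cone[OF conv, of v]) (use v in auto)
  have "1 \<le> j" if "j \<in> E" for j using ok that by (auto simp: edges_avoid_def)
  then have up: "upper_in ?A ?F" by (auto simp: upper_in_def path_covers_def)
  have "?F - ?A = path_misses n N E"
    using ok by (auto simp: path_covers_def path_misses_def edges_avoid_def)
  then show ?thesis
    using exact_at_lower[OF up conv _ exF, of p] exact_at_upper[OF up conv _ exF, of p] by metis
qed


section \<open>The extremal problem\<close>

definition neg_set :: "(nat \<Rightarrow> int) \<Rightarrow> nat set" where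
  "neg_set a = {j. a j < 0}"

definition light_edges :: "nat \<Rightarrow> nat \<Rightarrow> (nat \<Rightarrow> int) \<Rightarrow> nat set" where
  "light_edges n t a = {j. 1 \<le> j \<and> Suc j \<le> n \<and> 0 \<le> a j \<and> 0 \<le> a (Suc j) \<and> a j + a (Suc j) < int t}"

lemma light_edges_avoid: "edges_avoid n (neg_set a) (light_edges n t a)"
  by (auto simp: edges_avoid_def neg_set_def light_edges_def)

text \<open>
  Reading the path from left to right, a nonvanishing class of degree \<open>d\<close> splits the remaining
  \<open>L = n + 1 - i\<close> vertices into \<open>L - d\<close> pairs and \<open>2 d - L\<close> single vertices. In a run of consecutive pairs
  the right hand exponents strictly decrease, so that a run has at most \<open>t\<close> pairs, and at most \<open>y\<close>
  pairs if its first right hand exponent is below \<open>y\<close>.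
\<close>

lemma path_covers_bound:
  assumes "\<not> exact_at TYPE('k::comm_ring_1) (path_covers n (neg_set a) (light_edges n t a) i) d"
    and "1 \<le> t" "1 \<le> i" "i \<le> Suc n" "0 \<le> y" "i \<in> light_edges n t a \<Longrightarrow> a (Suc i) < y"
  shows "int (Suc n - i) - int d \<le> y + int t * (2 * int d - int (Suc n - i))"
  using assms
proof (induction "Suc n - i" arbitrary: i d y rule: less_induct)
  case less
  let ?N = "neg_set a" and ?E = "light_edges n t a"
  note ok = light_edges_avoid[of n a t]
  \<comment> \<open>\<open>t\<close> is the allowance with which every new run starts.\<close>
  have fresh: "j \<in> ?E \<Longrightarrow> a (Suc j) < int t" for j by (auto simp: light_edges_def)
  show ?case
  proof (cases "i = Suc n")
    case True
    then have "d = 0" using less.prems(1) by (simp add: path_covers_end[OF ok] exact_at_empty_face)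
    then show ?thesis using True less.prems by simp
  next
    case False
    then have i: "i \<le> n" using less.prems by simp
    consider "i \<in> ?N" | "i \<notin> ?N" "i \<notin> ?E" | "i \<in> ?E" "Suc i \<notin> ?E" | "i \<in> ?E" "Suc i \<in> ?E"
      by blast
    then show ?thesis
    proof cases
      case 1
      then obtain q where q: "d = Suc q"
          "\<not> exact_at TYPE('k) (path_covers n ?N ?E (Suc i)) q"
        using less.prems(1) path_covers_forced_exact[OF ok _ i] by blast
      \<comment> \<open>A single vertex leaves the number of pairs unchanged and raises
        \<open>2 d - L\<close> by one; the resulting \<open>t\<close> pays for the fresh allowance
        of the next run.\<close>
      have "int (Suc n - Suc i) - int q \<le> int t + int t * (2 * int q - int (Suc n - Suc i))"
        by (rule less.hyps[OF _ q(2) _ _ _ _ fresh]) (use i less.prems in auto)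
      moreover have "int (Suc n - i) = int (Suc n - Suc i) + 1" using i by simp
      ultimately show ?thesis using q(1) less.prems(5) by (simp add: algebra_simps)
    next
      case 2
      then show ?thesis using less.prems(1) path_covers_isolated_exact[OF ok _ _ i] by blast
    next
      case 3
      then obtain q where q: "d = Suc q"
          "\<not> exact_at TYPE('k) (path_covers n ?N ?E (i + 2)) q"
        using less.prems(1) path_covers_edge_exact[OF ok] by blast
      have E: "Suc i \<le> n" "0 \<le> a (Suc i)" "a (Suc i) < y"
        using 3 less.prems by (auto simp: light_edges_def)
      \<comment> \<open>A pair leaves \<open>2 d - L\<close> unchanged and is paid for by lowering
        the allowance from \<open>y\<close> to \<open>a (Suc i)\<close>, which is smaller.\<close>
      have "int (Suc n - (i + 2)) - int q \<le> a (Suc i) + int t * (2 * int q - int (Suc n - (i + 2)))"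
      proof (rule less.hyps[OF _ q(2)])
        assume "i + 2 \<in> ?E"
        then have "0 \<le> a (i + 2)" "a (i + 2) + a (Suc (i + 2)) < int t" "Suc (i + 2) \<le> n"
          by (auto simp: light_edges_def)
        \<comment> \<open>The edge at \<open>i + 1\<close> is not light although both its entries
          are nonnegative, so its sum is at least \<open>t\<close>. Comparison with the light edge
          at \<open>i + 2\<close> gives the strict decrease of right hand exponents.\<close>
        moreover have "int t \<le> a (Suc i) + a (i + 2)"
          using 3(2) E calculation by (auto simp: light_edges_def)
        ultimately show "a (Suc (i + 2)) < a (Suc i)" by simp
      qed (use E less.prems in auto)
      moreover have "int (Suc n - i) = int (Suc n - (i + 2)) + 2" using E by simp
      ultimately show ?thesis using q(1) E by (simp add: algebra_simps)
    next
      case 4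
      then obtain q where q: "d = Suc (Suc q)"
          "\<not> exact_at TYPE('k) (path_covers n ?N ?E (i + 3)) q"
        using less.prems(1) path_covers_two_edges_exact[OF ok] by blast
      have E: "Suc (Suc i) \<le> n" "0 \<le> a (Suc i)" "a (Suc i) < y"
        using 4 less.prems by (auto simp: light_edges_def)
      \<comment> \<open>The single vertex among the three opens a fresh run; their pair is paid for
        by \<open>y\<close>, which is at least 1 because it exceeds the nonnegative
        \<open>a (Suc i)\<close>.\<close>
      have "int (Suc n - (i + 3)) - int q \<le> int t + int t * (2 * int q - int (Suc n - (i + 3)))"
        by (rule less.hyps[OF _ q(2) _ _ _ _ fresh]) (use E less.prems in auto)
      moreover have "int (Suc n - i) = int (Suc n - (i + 3)) + 3" using E by simp
      ultimately show ?thesis using q(1) E by (simp add: algebra_simps)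
    qed
  qed
qed

text \<open>With initial allowance \<open>y = t\<close> and \<open>n = 2 m + 1\<close> the count of
  pairs becomes \<open>(2 t + 1) d \<ge> (2 t + 1) m + m + 1\<close>; the final 1 makes the bound on
  \<open>d\<close> strict.\<close>

lemma path_covers_degree_bound:
  assumes "\<not> exact_at TYPE('k::comm_ring_1) (path_covers n (neg_set a) (light_edges n t a) 1) d"
    and "1 \<le> t" "n = 2 * m + 1"
  shows "m + m div (2 * t + 1) < d"
proof -
  have "int (Suc n - 1) - int d \<le> int t + int t * (2 * int d - int (Suc n - 1))"
    by (rule path_covers_bound[OF assms(1)]) (use assms in \<open>auto simp: light_edges_def\<close>)
  then have "int (m * (2 * t + 1) + m + 1) \<le> int (d * (2 * t + 1))"
    using assms(3) by (simp add: algebra_simps)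
  then have le: "m * (2 * t + 1) + m + 1 \<le> d * (2 * t + 1)" by (simp only: of_nat_le_iff)
  show ?thesis
  proof (rule ccontr)
    assume "\<not> ?thesis"
    then have "d * (2 * t + 1) \<le> (m + m div (2 * t + 1)) * (2 * t + 1)" by (intro mult_right_mono) auto
    also have "\<dots> \<le> m * (2 * t + 1) + m"
      unfolding add_mult_distrib[of m] by (intro add_left_mono div_times_less_eq_dividend)
    finally show False using le by simp
  qed
qed

text \<open>
  The extremal exponents, read from the right end of the path: runs of \<open>t\<close> pairs
  \<open>(0, t - 1), (1, t - 2), \<dots>, (t - 1, 0)\<close> separated by single negative entries, and \<open>s\<close> further negative
  entries at the left end.
\<close>

definition run_exponents :: "nat \<Rightarrow> nat \<Rightarrow> nat \<Rightarrow> nat \<Rightarrow> int" where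
  "run_exponents n t s i =
     (if i < 1 \<or> n < i then 0
      else let r = (n - i) mod (2 * t + 1) in
        if i \<le> s \<or> r = 2 * t then -1
        else if even r then int (r div 2) else int t - int (r div 2) - 1)"

text \<open>A position is measured by the number \<open>l\<close> of vertices from \<open>i\<close>
  to the right end. Writing \<open>l - 1 = (2 t + 1) q + r\<close> counts \<open>q\<close> complete
  blocks to the right, each of \<open>2 t\<close> pair entries and a separator; \<open>r\<close> is
  the offset within the current block.\<close>

lemma run_exponents_at:
  assumes "s < i" "1 \<le> i" "i + l = Suc n" "l = Suc ((2 * t + 1) * q + r)" "r \<le> 2 * t"
  shows "run_exponents n t s i =
     (if r = 2 * t then -1 else if even r then int (r div 2) else int t - int (r div 2) - 1)"
proof -
  have "n - i = (2 * t + 1) * q + r" using assms by simp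
  then have "(n - i) mod (2 * t + 1) = r mod (2 * t + 1)" by (simp only: mod_mult_self4)
  then have "(n - i) mod (2 * t + 1) = r" using assms(5) by simp
  then show ?thesis using assms by (simp add: run_exponents_def Let_def)
qed

lemma run_exponents_runs:
  fixes n t s q u :: nat
  defines "a \<equiv> run_exponents n t s"
  assumes "1 \<le> t" "u \<le> t" "s + ((2 * t + 1) * q + 2 * u) \<le> n"
  shows "\<not> exact_at TYPE('k::comm_ring_1)
     (path_covers n (neg_set a) (light_edges n t a) (Suc n - ((2 * t + 1) * q + 2 * u))) (q * (t + 1) + u)"
  using assms(3,4)
proof (induction q arbitrary: u)
  have step: "\<not> exact_at TYPE('k)
     (path_covers n (neg_set a) (light_edges n t a) (Suc n - ((2 * t + 1) * q + 2 * Suc u))) (q * (t + 1) + Suc u)"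
    if ne: "\<not> exact_at TYPE('k)
     (path_covers n (neg_set a) (light_edges n t a) (Suc n - ((2 * t + 1) * q + 2 * u))) (q * (t + 1) + u)"
    and u: "Suc u \<le> t" "s + ((2 * t + 1) * q + 2 * Suc u) \<le> n" for q u
  proof -
    let ?l = "(2 * t + 1) * q + 2 * Suc u"
    let ?i = "Suc n - ?l"
    have i: "1 \<le> ?i" "s < ?i" "?i + ?l = Suc n" using u by auto
    \<comment> \<open>The new pair is \<open>(t - 1 - u, u)\<close>, with sum \<open>t - 1\<close>
      just below the threshold.\<close>
    have ai: "a ?i = int t - int u - 1"
      unfolding a_def using run_exponents_at[of s ?i ?l n t q "2 * u + 1"] i u by simp
    have aSi: "a (Suc ?i) = int u"
      unfolding a_def using run_exponents_at[of s "Suc ?i" "?l - 1" n t q "2 * u"] i u by simp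
    have E: "?i \<in> light_edges n t a" using ai aSi u i by (auto simp: light_edges_def)
    \<comment> \<open>The edge to the right of the pair is not light: the path ends there, or a
      separator follows, or the next pair follows and the sum is
      \<open>u + (t - u) = t\<close>.\<close>
    have "Suc ?i \<notin> light_edges n t a"
    proof (cases u)
      case 0
      show ?thesis
      proof (cases q)
        case (Suc p)
        have "a (Suc (Suc ?i)) = -1"
          unfolding a_def using run_exponents_at[of s "Suc (Suc ?i)" "?l - 2" n t p "2 * t"] i u 0 Suc by simp
        then show ?thesis by (simp add: light_edges_def)
      qed (use 0 i in \<open>auto simp: light_edges_def\<close>)
    next
      case (Suc v)
      have "a (Suc (Suc ?i)) = int t - int u"
        unfolding a_def using run_exponents_at[of s "Suc (Suc ?i)" "?l - 2" n t q "2 * v + 1"] i u Suc by simp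
      then show ?thesis using aSi by (simp add: light_edges_def)
    qed
    moreover have "?i + 2 = Suc n - ((2 * t + 1) * q + 2 * u)" using u by simp
    ultimately show ?thesis using path_covers_edge_exact[OF light_edges_avoid E] ne by force
  qed
  have runs: "\<not> exact_at TYPE('k)
     (path_covers n (neg_set a) (light_edges n t a) (Suc n - ((2 * t + 1) * q + 2 * u))) (q * (t + 1) + u)"
    if base: "\<not> exact_at TYPE('k)
     (path_covers n (neg_set a) (light_edges n t a) (Suc n - (2 * t + 1) * q)) (q * (t + 1))"
    and "u \<le> t" "s + ((2 * t + 1) * q + 2 * u) \<le> n" for q u
    using that(2,3)
  proof (induction u)
    case 0
    then show ?case using base by simp
  next
    case (Suc u)
    show ?case by (rule step[OF Suc.IH]) (use Suc.prems in auto)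
  qed
  {
    case 0
    have "path_covers n (neg_set a) (light_edges n t a) (Suc n) = {{}}"
      by (rule path_covers_end[OF light_edges_avoid])
    then show ?case using 0 by (intro runs) (simp_all add: exact_at_empty_face)
  next
    case (Suc q)
    let ?l = "(2 * t + 1) * Suc q"
    let ?i = "Suc n - ?l"
    have i: "1 \<le> ?i" "s < ?i" "?i + ?l = Suc n" "?i \<le> n" using Suc.prems by auto
    have "a ?i = -1"
      unfolding a_def using run_exponents_at[of s ?i ?l n t q "2 * t"] i by simp
    then have N: "?i \<in> neg_set a" by (simp add: neg_set_def)
    have "\<not> exact_at TYPE('k)
       (path_covers n (neg_set a) (light_edges n t a) (Suc n - ((2 * t + 1) * q + 2 * t))) (q * (t + 1) + t)"
      by (rule Suc.IH) (use Suc.prems in auto)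
    moreover have "Suc ?i = Suc n - ((2 * t + 1) * q + 2 * t)" using Suc.prems by simp
    ultimately have "\<not> exact_at TYPE('k)
       (path_covers n (neg_set a) (light_edges n t a) ?i) (Suc q * (t + 1))"
      using path_covers_forced_exact[OF light_edges_avoid N i(4), of t "Suc q * (t + 1)", where 'k='k]
      by (simp add: ac_simps)
    then show ?case using Suc.prems by (rule runs)
  }
qed

lemma extremal_exponents:
  assumes "1 \<le> t" "n = 2 * m + 1" "1 \<le> m"
  obtains a where "\<And>i. i \<notin> {1..n} \<Longrightarrow> a i = 0" "n \<notin> neg_set a"
    "\<not> exact_at TYPE('k::comm_ring_1) (path_covers n (neg_set a) (light_edges n t a) 1)
       (Suc (m + m div (2 * t + 1)))"
proof -
  define f where "f = m div (2 * t + 1)"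
  \<comment> \<open>The intended degree is \<open>m + f + 1\<close>. It equals \<open>n\<close>
    minus the number of pairs, which leaves \<open>m - f\<close> pairs to place.\<close>
  define P where "P = m - f"
  \<comment> \<open>Dividing \<open>P - 1\<close> instead of \<open>P\<close> keeps the leftmost run
    nonempty: \<open>q\<close> full runs with their separators, then a last run of \<open>u\<close>
    pairs, where \<open>1 \<le> u\<close> and \<open>u \<le> t\<close>.\<close>
  define q where "q = (P - 1) div t"
  define u where "u = P - t * q"
  define l where "l = (2 * t + 1) * q + 2 * u"
  define s where "s = n - l"
  define a where "a = run_exponents n t s"
  have "f < m" unfolding f_def using assms by (intro div_less_dividend) auto
  then have P: "1 \<le> P" "m = P + f" by (auto simp: P_def)
  have "m < (2 * t + 1) * Suc f"
    unfolding f_def using dividend_less_times_div[of "2 * t + 1" m] by simp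
  \<comment> \<open>Subtracting \<open>f\<close> from \<open>m \<le> (2 t + 1) (f + 1) - 1\<close>
    shows that \<open>P\<close> pairs fit into \<open>2 f + 2\<close> runs. These need at most
    \<open>2 f + 1\<close> separators, which is exactly \<open>n - 2 P\<close>, the number of
    vertices outside the pairs.\<close>
  then have "P \<le> t * (2 * f + 2)" using P by (simp add: algebra_simps)
  then have "P - 1 < t * (2 * f + 2)" using P by linarith
  then have q: "q < 2 * f + 2" unfolding q_def using assms by (simp add: less_mult_imp_div_less mult.commute)
  have "P - 1 = t * q + (P - 1) mod t" "(P - 1) mod t < t" using assms by (simp_all add: q_def)
  then have u: "1 \<le> u" "u \<le> t" "P = t * q + u" using P by (auto simp: u_def)
  have l: "l = 2 * P + q" using u(3) by (simp add: l_def algebra_simps)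
  then have "l \<le> n" using q P assms by simp
  then have sl: "s + l = n" by (simp add: s_def)
  \<comment> \<open>The \<open>s\<close> leftover vertices carry negative entries, hence are forced,
    and each adds one degree.\<close>
  have left: "\<not> exact_at TYPE('k) (path_covers n (neg_set a) (light_edges n t a) (Suc s - j)) (q * (t + 1) + u + j)"
    if "j \<le> s" for j
    using that
  proof (induction j)
    case 0
    have "Suc s = Suc n - ((2 * t + 1) * q + 2 * u)" using sl l_def by simp
    then show ?case using run_exponents_runs[OF assms(1) u(2), where s=s and n=n and q=q and 'k='k] sl
      unfolding a_def[symmetric] l_def by simp
  next
    case (Suc j)
    let ?i = "Suc s - Suc j"
    have i: "1 \<le> ?i" "?i \<le> s" "?i \<le> n" using Suc.prems sl by auto
    have "?i \<in> neg_set a" using i by (simp add: a_def run_exponents_def neg_set_def)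
    then show ?case
      using path_covers_forced_exact[OF light_edges_avoid[of n a t] _ i(3), where 'k='k] Suc i
      by (simp add: Suc_diff_le)
  qed
  \<comment> \<open>Here \<open>q (t + 1) + u + s = P + q + s = n - P\<close>.\<close>
  have "q * (t + 1) + u + s = Suc (m + f)" using sl l u P assms by (simp add: algebra_simps)
  then have "\<not> exact_at TYPE('k) (path_covers n (neg_set a) (light_edges n t a) 1) (Suc (m + f))"
    using left[of s] by simp
  \<comment> \<open>The right end belongs to a pair and has exponent 0. It serves as the vertex of
    the cone in the passage from covers to their complement.\<close>
  moreover have "n \<notin> neg_set a"
  proof -
    have "0 < l" using l P by simp
    then have "a n = 0" using sl assms by (simp add: a_def run_exponents_def)
    then show ?thesis by (simp add: neg_set_def)
  qed
  moreover have "a i = 0" if "i \<notin> {1..n}" for i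
    using that by (auto simp: a_def run_exponents_def)
  ultimately show ?thesis using that unfolding f_def by blast
qed

section \<open>The polynomial ring and its monomials\<close>

abbreviation xmon :: "(nat \<Rightarrow>\<^sub>0 nat) \<Rightarrow> 'k::field mpoly" where
  "xmon m \<equiv> Poly_Mapping.single m 1"

text \<open>For finite \<open>F\<close> this is the exponent vector of the \<open>k\<close>-th power
  of the product of the variables in \<open>F\<close>, the standard denominator at the face
  \<open>F\<close>.\<close>

definition exps :: "nat set \<Rightarrow> nat \<Rightarrow> nat \<Rightarrow>\<^sub>0 nat" where
  "exps F k = (\<Sum>i\<in>F. Poly_Mapping.single i k)"

lemma lookup_exps:
  assumes "finite F"
  shows "Poly_Mapping.lookup (exps F k) i = (if i \<in> F then k else 0)"
  using assms by (simp add: exps_def lookup_sum lookup_single when_def)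

lemma keys_exps: "finite F \<Longrightarrow> Poly_Mapping.keys (exps F k) \<subseteq> F"
  by (rule subsetI, rule ccontr) (simp add: in_keys_iff lookup_exps)

lemma exps_add: "finite F \<Longrightarrow> exps F (k + l) = exps F k + exps F l"
  by (rule poly_mapping_eqI) (simp add: lookup_exps lookup_add)

lemma exps_0 [simp]: "exps F 0 = 0"
  by (simp add: exps_def)

lemma xmon_power: "finite F \<Longrightarrow> xmon (exps F k) ^ l = (xmon (exps F (k * l)) :: 'k::field mpoly)"
  by (induction l) (simp_all add: mult_single exps_add)

lemma prod_var:
  assumes "finite F"
  shows "(\<Prod>i\<in>F. var i) = (xmon (exps F 1) :: 'k::field mpoly)"
  using assms by (induction F rule: finite_induct) (simp_all add: exps_def var_def mult_single)

lemma lookup_xmon_mult_add: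
  "Poly_Mapping.lookup (xmon m * p) (m + b) = Poly_Mapping.lookup (p :: 'k::field mpoly) b"
proof -
  have "Poly_Mapping.lookup (xmon m * p) (m + b) =
      Sum_any (\<lambda>q. Poly_Mapping.lookup p q when m + b = m + q)"
    by (simp add: lookup_mult prod_fun_def lookup_single when_mult)
  also have "\<dots> = Sum_any (\<lambda>q. Poly_Mapping.lookup p q when q = b)"
    by (rule Sum_any.cong) (auto intro: when_cong)
  finally show ?thesis by simp
qed

lemma lookup_xmon_mult_not:
  assumes "\<And>b. c \<noteq> m + b"
  shows "Poly_Mapping.lookup (xmon m * (p :: 'k::field mpoly)) c = 0"
  using assms by (simp add: lookup_mult prod_fun_def lookup_single when_mult)

lemma keys_xmon_mult:
  "Poly_Mapping.keys (xmon m * (p :: 'k::field mpoly)) = (+) m ` Poly_Mapping.keys p"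
proof (intro equalityI subsetI)
  fix c assume "c \<in> Poly_Mapping.keys (xmon m * p)"
  then have c: "Poly_Mapping.lookup (xmon m * p) c \<noteq> 0" by (simp add: in_keys_iff)
  then obtain b where "c = m + b" using lookup_xmon_mult_not by metis
  then show "c \<in> (+) m ` Poly_Mapping.keys p" using c by (auto simp: lookup_xmon_mult_add in_keys_iff)
qed (auto simp: lookup_xmon_mult_add in_keys_iff)

lemma sum_monomials:
  "(\<Sum>m\<in>Poly_Mapping.keys p. Poly_Mapping.single m (Poly_Mapping.lookup p m)) = (p :: 'k::field mpoly)"
proof (rule poly_mapping_eqI)
  fix c
  have "Poly_Mapping.lookup (\<Sum>m\<in>Poly_Mapping.keys p. Poly_Mapping.single m (Poly_Mapping.lookup p m)) c
      = (\<Sum>m\<in>Poly_Mapping.keys p. if c = m then Poly_Mapping.lookup p m else 0)"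
    by (simp add: lookup_sum lookup_single when_def eq_commute)
  also have "\<dots> = Poly_Mapping.lookup p c" by (simp add: in_keys_iff)
  finally show "Poly_Mapping.lookup (\<Sum>m\<in>Poly_Mapping.keys p. Poly_Mapping.single m (Poly_Mapping.lookup p m)) c
      = Poly_Mapping.lookup p c" .
qed

text \<open>A polynomial is the sum of its terms. This reduces inclusions between the ideals below
  to a divisibility argument for one monomial at a time.\<close>

lemma monomial_closure:
  fixes p :: "'k::field mpoly"
  assumes "0 \<in> S" "\<And>a b. a \<in> S \<Longrightarrow> b \<in> S \<Longrightarrow> a + b \<in> S"
    and "\<And>m. m \<in> Poly_Mapping.keys p \<Longrightarrow> Poly_Mapping.single m (Poly_Mapping.lookup p m) \<in> S"
  shows "p \<in> S"
proof -
  have "(\<Sum>m\<in>K. Poly_Mapping.single m (Poly_Mapping.lookup p m)) \<in> S" if "K \<subseteq> Poly_Mapping.keys p" for K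
    using finite_subset[OF that finite_keys] that
    by (induction K rule: finite_induct) (auto intro: assms)
  from this[of "Poly_Mapping.keys p"] show ?thesis by (simp add: sum_monomials)
qed

section \<open>Ring structure on the carrier\<close>

lemma polynomial_ring_simps [simp]:
  "p \<otimes>\<^bsub>polynomial_ring n\<^esub> q = p * q" "p \<oplus>\<^bsub>polynomial_ring n\<^esub> q = p + q"
  "\<one>\<^bsub>polynomial_ring n\<^esub> = 1" "\<zero>\<^bsub>polynomial_ring n\<^esub> = 0"
  by (simp_all add: polynomial_ring_def)

lemma carrier_polynomial_ring:
  "p \<in> carrier (polynomial_ring n) \<longleftrightarrow>
    (\<forall>m \<in> Poly_Mapping.keys p. Poly_Mapping.keys m \<subseteq> {1..n})"
  by (simp add: polynomial_ring_def)

lemma carrier_add: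
  "p \<in> carrier (polynomial_ring n) \<Longrightarrow> q \<in> carrier (polynomial_ring n) \<Longrightarrow>
    p + q \<in> carrier (polynomial_ring n)"
  using keys_add[of p q] unfolding carrier_polynomial_ring by blast

lemma carrier_mult:
  assumes "p \<in> carrier (polynomial_ring n)" "q \<in> carrier (polynomial_ring n)"
  shows "p * q \<in> carrier (polynomial_ring n)"
  unfolding carrier_polynomial_ring
proof
  fix m assume "m \<in> Poly_Mapping.keys (p * q)"
  then obtain a b where "m = a + b" "a \<in> Poly_Mapping.keys p" "b \<in> Poly_Mapping.keys q"
    using keys_mult by blast
  then show "Poly_Mapping.keys m \<subseteq> {1..n}"
    using assms keys_add[of a b] unfolding carrier_polynomial_ring by blast
qed

lemma carrier_uminus:
  "p \<in> carrier (polynomial_ring n) \<Longrightarrow> - p \<in> carrier (polynomial_ring n)"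
  by (simp add: carrier_polynomial_ring in_keys_iff)

lemma carrier_zero: "0 \<in> carrier (polynomial_ring n)"
  by (simp add: carrier_polynomial_ring)

lemma carrier_xmon: "Poly_Mapping.keys m \<subseteq> {1..n} \<Longrightarrow> xmon m \<in> carrier (polynomial_ring n)"
  by (simp add: carrier_polynomial_ring)

lemma carrier_xmon_exps:
  "F \<subseteq> {1..n} \<Longrightarrow> (xmon (exps F k) :: 'k::field mpoly) \<in> carrier (polynomial_ring n)"
  by (intro carrier_xmon order_trans[OF keys_exps]) (auto intro: finite_subset)

lemma cring_polynomial_ring: "cring (polynomial_ring n :: 'k::field mpoly ring)"
proof (rule cringI)
  show "abelian_group (polynomial_ring n :: 'k mpoly ring)"
  proof (rule abelian_groupI)
    show "\<exists>q\<in>carrier (polynomial_ring n). q \<oplus>\<^bsub>polynomial_ring n\<^esub> p = \<zero>\<^bsub>polynomial_ring n\<^esub>"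
      if "p \<in> carrier (polynomial_ring n)" for p :: "'k mpoly"
      using carrier_uminus[OF that] by (intro bexI[of _ "- p"]) simp_all
  qed (auto simp: carrier_add carrier_zero ac_simps)
  show "Group.comm_monoid (polynomial_ring n :: 'k mpoly ring)"
  proof (rule comm_monoidI)
    show "\<one>\<^bsub>polynomial_ring n\<^esub> \<in> carrier (polynomial_ring n :: 'k mpoly ring)"
      by (simp add: carrier_polynomial_ring)
  qed (auto simp: carrier_mult ac_simps)
qed (simp add: distrib_right)

lemma minus_polynomial_ring:
  assumes "p \<in> carrier (polynomial_ring n)" "q \<in> carrier (polynomial_ring n)"
  shows "p \<ominus>\<^bsub>polynomial_ring n\<^esub> q = p - (q :: 'k::field mpoly)"
proof -
  interpret cring "polynomial_ring n :: 'k mpoly ring" by (rule cring_polynomial_ring)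
  have "\<ominus>\<^bsub>polynomial_ring n\<^esub> q = - q"
    by (rule minus_equality) (use assms carrier_uminus in auto)
  then show ?thesis by (simp add: a_minus_def)
qed

lemma pow_polynomial_ring: "p [^]\<^bsub>polynomial_ring n\<^esub> k = (p :: 'k::field mpoly) ^ (k :: nat)"
  by (induction k) (simp_all add: nat_pow_def)

lemma finprod_var:
  assumes "F \<subseteq> {1..n}"
  shows "finprod (polynomial_ring n) var F = (xmon (exps F 1) :: 'k::field mpoly)"
proof -
  interpret cring "polynomial_ring n :: 'k mpoly ring" by (rule cring_polynomial_ring)
  have "finite F" using assms finite_subset by blast
  then show ?thesis using assms
  proof (induction F rule: finite_induct)
    case empty
    then show ?case by (simp add: exps_def)
  next
    case (insert i F)
    have v: "var j \<in> carrier (polynomial_ring n :: 'k mpoly ring)" if "j \<in> {1..n}" for j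
      using that by (simp add: var_def carrier_xmon)
    have "finprod (polynomial_ring n) var (insert i F) =
        var i \<otimes>\<^bsub>polynomial_ring n\<^esub> (finprod (polynomial_ring n) var F :: 'k mpoly)"
      by (rule finprod_insert) (use insert v in auto)
    also have "\<dots> = var i * xmon (exps F 1)" using insert by simp
    also have "\<dots> = xmon (exps (insert i F) 1)"
      using insert(1,2) by (simp add: var_def mult_single exps_def)
    finally show ?case .
  qed
qed

section \<open>Powers of the cover ideal of a path\<close>

text \<open>This is the intersection of the ideals \<open>(x_j, x_{j+1})^t\<close> over all edges,
  the \<open>t\<close>-th symbolic power of the cover ideal. Each of them is a monomial ideal, so
  membership is a condition on single exponent vectors.\<close>

definition edge_power :: "nat \<Rightarrow> nat \<Rightarrow> 'k::field mpoly set" where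
  "edge_power n t = {p \<in> carrier (polynomial_ring n). \<forall>m\<in>Poly_Mapping.keys p. \<forall>j. 1 \<le> j \<longrightarrow> Suc j \<le> n \<longrightarrow>
     t \<le> Poly_Mapping.lookup m j + Poly_Mapping.lookup m (Suc j)}"

lemma edge_power_carrier: "p \<in> edge_power n t \<Longrightarrow> p \<in> carrier (polynomial_ring n)"
  by (simp add: edge_power_def)

lemma edge_powerD:
  "p \<in> edge_power n t \<Longrightarrow> m \<in> Poly_Mapping.keys p \<Longrightarrow> 1 \<le> j \<Longrightarrow> Suc j \<le> n \<Longrightarrow>
    t \<le> Poly_Mapping.lookup m j + Poly_Mapping.lookup m (Suc j)"
  by (simp add: edge_power_def)

lemma edge_power_add:
  assumes "p \<in> edge_power n t" "q \<in> edge_power n t"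
  shows "p + q \<in> edge_power n t"
  using assms keys_add[of p q] carrier_add[of p n q] unfolding edge_power_def by blast

lemma edge_power_mult:
  assumes "p \<in> edge_power n s" "q \<in> edge_power n t"
  shows "p * q \<in> edge_power n (s + t)"
  unfolding edge_power_def
proof (intro CollectI conjI ballI allI impI)
  show "p * q \<in> carrier (polynomial_ring n)" using assms by (intro carrier_mult edge_power_carrier)
  fix m j assume m: "m \<in> Poly_Mapping.keys (p * q)" and j: "1 \<le> j" "Suc j \<le> n"
  then obtain a b where "m = a + b" "a \<in> Poly_Mapping.keys p" "b \<in> Poly_Mapping.keys q"
    using keys_mult by blast
  then show "s + t \<le> Poly_Mapping.lookup m j + Poly_Mapping.lookup m (Suc j)"
    using edge_powerD[OF assms(1) _ j, of a] edge_powerD[OF assms(2) _ j, of b] by (simp add: lookup_add)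
qed

lemma edge_power_0: "edge_power n 0 = carrier (polynomial_ring n)"
  by (auto simp: edge_power_def)

lemma edge_power_ideal: "ideal (edge_power n t) (polynomial_ring n :: 'k::field mpoly ring)"
proof (rule idealI)
  interpret cring "polynomial_ring n :: 'k mpoly ring" by (rule cring_polynomial_ring)
  show "ring (polynomial_ring n :: 'k mpoly ring)" by (rule ring_axioms)
  show "subgroup (edge_power n t) (add_monoid (polynomial_ring n :: 'k mpoly ring))"
  proof (rule add.subgroupI)
    show "edge_power n t \<subseteq> carrier (polynomial_ring n :: 'k mpoly ring)"
      using edge_power_carrier by blast
    have "0 \<in> (edge_power n t :: 'k mpoly set)" by (simp add: edge_power_def carrier_zero)
    then show "edge_power n t \<noteq> ({} :: 'k mpoly set)" by blast
    show "\<ominus>\<^bsub>polynomial_ring n\<^esub> p \<in> edge_power n t" if "p \<in> edge_power n t" for p :: "'k mpoly"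
    proof -
      have "\<ominus>\<^bsub>polynomial_ring n\<^esub> p = - p"
        using minus_polynomial_ring[OF carrier_zero edge_power_carrier[OF that]]
          minus_eq[of "0 :: 'k mpoly" p] a_inv_closed[OF edge_power_carrier[OF that]] by simp
      moreover have "- p \<in> edge_power n t"
        using that carrier_uminus[of p n] by (simp add: edge_power_def in_keys_iff)
      ultimately show ?thesis by simp
    qed
  qed (simp_all add: edge_power_add)
  \<comment> \<open>Absorption is the product rule with one factor in \<open>edge_power n 0\<close>,
    the whole ring.\<close>
  show "x \<otimes>\<^bsub>polynomial_ring n\<^esub> a \<in> edge_power n t" "a \<otimes>\<^bsub>polynomial_ring n\<^esub> x \<in> edge_power n t"
    if "a \<in> edge_power n t" "x \<in> carrier (polynomial_ring n)" for a x :: "'k mpoly"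
    using edge_power_mult[of x n 0 a t] edge_power_mult[of a n t x 0] that
    by (simp_all add: edge_power_0)
qed

lemma edge_power_single:
  assumes "Poly_Mapping.keys m \<subseteq> {1..n}"
    "\<And>j. 1 \<le> j \<Longrightarrow> Suc j \<le> n \<Longrightarrow> t \<le> Poly_Mapping.lookup m j + Poly_Mapping.lookup m (Suc j)"
  shows "Poly_Mapping.single m c \<in> (edge_power n t :: 'k::field mpoly set)"
  using assms by (cases "c = 0") (auto simp: edge_power_def carrier_polynomial_ring)

section \<open>Generators of the cover ideal and of its powers\<close>

lemma path_vertex_cover:
  "vertex_cover {1..n} (path_edges n) C \<longleftrightarrow>
    C \<subseteq> {1..n} \<and> (\<forall>j. 1 \<le> j \<longrightarrow> Suc j \<le> n \<longrightarrow> j \<in> C \<or> Suc j \<in> C)"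
  by (auto simp: vertex_cover_def path_edges_def)

lemma single_split:
  assumes "finite C" "\<And>i. i \<in> C \<Longrightarrow> 1 \<le> Poly_Mapping.lookup m i"
  shows "Poly_Mapping.single m c = Poly_Mapping.single (m - exps C 1) c * (xmon (exps C 1) :: 'k::field mpoly)"
proof -
  have "m - exps C 1 + exps C 1 = m"
    by (rule poly_mapping_eqI) (use assms in \<open>auto simp: lookup_add lookup_minus lookup_exps\<close>)
  then show ?thesis by (simp add: mult_single)
qed

text \<open>The support of a monomial in the intersection meets every edge, so it contains a minimal
  vertex cover, and the corresponding generator divides the monomial.\<close>

lemma cover_ideal_path: "cover_ideal n (path_edges n) = (edge_power n 1 :: 'k::field mpoly set)"
proof
  interpret cring "polynomial_ring n :: 'k mpoly ring" by (rule cring_polynomial_ring)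
  let ?S = "{\<Prod>i\<in>C. var i | C. minimal_vertex_cover {1..n} (path_edges n) C} :: 'k mpoly set"
  have S: "?S \<subseteq> edge_power n 1"
  proof
    fix p assume "p \<in> ?S"
    then obtain C where C: "p = (\<Prod>i\<in>C. var i)" "vertex_cover {1..n} (path_edges n) C"
      by (auto simp: minimal_vertex_cover_def)
    have C': "C \<subseteq> {1..n}" "\<And>j. 1 \<le> j \<Longrightarrow> Suc j \<le> n \<Longrightarrow> j \<in> C \<or> Suc j \<in> C"
      using C(2) unfolding path_vertex_cover by blast+
    have fin: "finite C" using C' finite_subset by blast
    have p: "p = xmon (exps C 1)" using C prod_var[OF fin] by simp
    show "p \<in> edge_power n 1"
      unfolding p
    proof (rule edge_power_single)
      show "Poly_Mapping.keys (exps C 1) \<subseteq> {1..n}"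
        using C' keys_exps[OF fin, of 1] by blast
    qed (use C' in \<open>auto simp: lookup_exps[OF fin]\<close>)
  qed
  show "cover_ideal n (path_edges n) \<subseteq> (edge_power n 1 :: 'k mpoly set)"
    unfolding cover_ideal_def by (rule genideal_minimal[OF edge_power_ideal S])
  have Sc: "?S \<subseteq> carrier (polynomial_ring n)" using S edge_power_carrier by blast
  interpret J: ideal "Idl\<^bsub>polynomial_ring n\<^esub> ?S" "polynomial_ring n :: 'k mpoly ring"
    by (rule genideal_ideal[OF Sc])
  show "(edge_power n 1 :: 'k mpoly set) \<subseteq> cover_ideal n (path_edges n)"
    unfolding cover_ideal_def
  proof
    fix p :: "'k mpoly" assume p: "p \<in> edge_power n 1"
    show "p \<in> Idl\<^bsub>polynomial_ring n\<^esub> ?S"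
    proof (rule monomial_closure)
      show "0 \<in> Idl\<^bsub>polynomial_ring n\<^esub> ?S" using J.zero_closed by simp
      show "a + b \<in> Idl\<^bsub>polynomial_ring n\<^esub> ?S"
        if "a \<in> Idl\<^bsub>polynomial_ring n\<^esub> ?S" "b \<in> Idl\<^bsub>polynomial_ring n\<^esub> ?S" for a b
        using J.a_closed[OF that] by simp
      fix m assume m: "m \<in> Poly_Mapping.keys p"
      let ?P = "\<lambda>C. C \<subseteq> Poly_Mapping.keys m \<and> vertex_cover {1..n} (path_edges n) C"
      have km: "Poly_Mapping.keys m \<subseteq> {1..n}"
        using edge_power_carrier[OF p] m by (auto simp: carrier_polynomial_ring)
      have "?P (Poly_Mapping.keys m)"
        unfolding path_vertex_cover
      proof (intro conjI allI impI)
        fix j assume "1 \<le> j" "Suc j \<le> n"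
        from edge_powerD[OF p m this]
        show "j \<in> Poly_Mapping.keys m \<or> Suc j \<in> Poly_Mapping.keys m" by (auto simp: in_keys_iff)
      qed (use km in simp_all)
      \<comment> \<open>A cover of least cardinality inside the support is minimal among all covers,
        since a smaller cover contained in it would also lie in the support.\<close>
      then obtain C where C: "?P C" and least: "\<And>D. ?P D \<Longrightarrow> card C \<le> card D"
        using ex_has_least_nat[of ?P "Poly_Mapping.keys m" card] by blast
      have fin: "finite C" using C finite_subset[OF _ finite_keys] by blast
      have "\<not> vertex_cover {1..n} (path_edges n) D" if "D \<subset> C" for D
      proof
        assume "vertex_cover {1..n} (path_edges n) D"
        then have "?P D" using that C by blast
        then show False using least[of D] psubset_card_mono[OF fin that] by simp
      qed
      then have "minimal_vertex_cover {1..n} (path_edges n) C"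
        using C by (simp add: minimal_vertex_cover_def)
      then have "(\<Prod>i\<in>C. var i) \<in> ?S" by blast
      then have xC: "xmon (exps C 1) \<in> Idl\<^bsub>polynomial_ring n\<^esub> ?S"
        using genideal_self[OF Sc] prod_var[OF fin, where 'k='k] by auto
      have split: "Poly_Mapping.single m (Poly_Mapping.lookup p m) =
          Poly_Mapping.single (m - exps C 1) (Poly_Mapping.lookup p m) * xmon (exps C 1)"
      proof (rule single_split[OF fin])
        fix i assume "i \<in> C"
        then have "i \<in> Poly_Mapping.keys m" using C by blast
        then show "1 \<le> Poly_Mapping.lookup m i" by (simp add: in_keys_iff)
      qed
      have "Poly_Mapping.keys (m - exps C 1) \<subseteq> Poly_Mapping.keys m"
        by (auto simp: in_keys_iff lookup_minus)
      then have "Poly_Mapping.single (m - exps C 1) (Poly_Mapping.lookup p m) \<in> carrier (polynomial_ring n)"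
        using km unfolding carrier_polynomial_ring by auto
      then show "Poly_Mapping.single m (Poly_Mapping.lookup p m) \<in> Idl\<^bsub>polynomial_ring n\<^esub> ?S"
        unfolding split using J.I_l_closed[OF xC] by simp
    qed
  qed
qed

text \<open>
  The path is bipartite: if \<open>m\<^sub>j + m\<^bsub>j+1\<^esub> \<ge> t + 1\<close> on all edges, then the odd \<open>i\<close> with
  \<open>m\<^sub>i \<ge> t + 1\<close> and the even \<open>i\<close> with \<open>m\<^sub>i \<ge> 1\<close> form a vertex cover, and dividing by its monomial lowers
  an edge sum by two only if that sum is at least \<open>t + 2\<close>.
\<close>

lemma edge_power_Suc:
  "ideal_prod (polynomial_ring n) (edge_power n t) (edge_power n 1) = (edge_power n (Suc t) :: 'k::field mpoly set)"
proof
  show "ideal_prod (polynomial_ring n) (edge_power n t) (edge_power n 1) \<subseteq> (edge_power n (Suc t) :: 'k mpoly set)"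
  proof
    fix p :: "'k mpoly" assume "p \<in> ideal_prod (polynomial_ring n) (edge_power n t) (edge_power n 1)"
    then show "p \<in> edge_power n (Suc t)"
    proof induction
      case (prod i j)
      then show ?case using edge_power_mult[of i n t j 1] by simp
    qed (simp add: edge_power_add)
  qed
  show "(edge_power n (Suc t) :: 'k mpoly set) \<subseteq> ideal_prod (polynomial_ring n) (edge_power n t) (edge_power n 1)"
  proof
    fix p :: "'k mpoly" assume p: "p \<in> edge_power n (Suc t)"
    let ?P = "ideal_prod (polynomial_ring n) (edge_power n t) (edge_power n 1) :: 'k mpoly set"
    show "p \<in> ?P"
    proof (rule monomial_closure)
      have zero: "0 \<in> (edge_power n s :: 'k mpoly set)" for s by (simp add: edge_power_def carrier_zero)
      show "0 \<in> ?P" using ideal_prod.prod[OF zero[of t] zero[of 1], of "polynomial_ring n"] by simp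
      show "a + b \<in> ?P" if "a \<in> ?P" "b \<in> ?P" for a b using ideal_prod.sum[OF that] by simp
      fix m assume m: "m \<in> Poly_Mapping.keys p"
      let ?m = "Poly_Mapping.lookup m"
      define C where "C = {i \<in> {1..n}. if odd i then Suc t \<le> ?m i else 1 \<le> ?m i}"
      have km: "Poly_Mapping.keys m \<subseteq> {1..n}"
        using edge_power_carrier[OF p] m by (auto simp: carrier_polynomial_ring)
      have sum: "Suc t \<le> ?m j + ?m (Suc j)" if "1 \<le> j" "Suc j \<le> n" for j
        using edge_powerD[OF p m that] .
      have mem: "i \<in> C \<longleftrightarrow> (if odd i then Suc t \<le> ?m i else 1 \<le> ?m i)" if "1 \<le> i" "i \<le> n" for i
        using that by (simp add: C_def)
      have fin: "finite C" and Cn: "C \<subseteq> {1..n}" by (auto simp: C_def)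
      have split: "Poly_Mapping.single m (Poly_Mapping.lookup p m) =
          Poly_Mapping.single (m - exps C 1) (Poly_Mapping.lookup p m) * xmon (exps C 1)"
        by (rule single_split[OF fin]) (auto simp: C_def split: if_splits)
      have 1: "Poly_Mapping.single (m - exps C 1) (Poly_Mapping.lookup p m) \<in> edge_power n t"
      proof (rule edge_power_single)
        show "Poly_Mapping.keys (m - exps C 1) \<subseteq> {1..n}"
          using km by (auto simp: in_keys_iff lookup_minus)
        fix j assume j: "1 \<le> j" "Suc j \<le> n"
        show "t \<le> Poly_Mapping.lookup (m - exps C 1) j + Poly_Mapping.lookup (m - exps C 1) (Suc j)"
          using sum[OF j] j mem[of j] mem[of "Suc j"]
          by (cases "odd j") (auto simp: lookup_minus lookup_exps[OF fin])
      qed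
      have 2: "xmon (exps C 1) \<in> (edge_power n 1 :: 'k mpoly set)"
      proof (rule edge_power_single)
        show "Poly_Mapping.keys (exps C 1) \<subseteq> {1..n}"
          using Cn keys_exps[OF fin, of 1] by blast
        fix j assume j: "1 \<le> j" "Suc j \<le> n"
        show "1 \<le> Poly_Mapping.lookup (exps C 1) j + Poly_Mapping.lookup (exps C 1) (Suc j)"
          using sum[OF j] j mem[of j] mem[of "Suc j"]
          by (cases "odd j") (auto simp: lookup_exps[OF fin])
      qed
      show "Poly_Mapping.single m (Poly_Mapping.lookup p m) \<in> ?P"
        unfolding split using ideal_prod.prod[OF 1 2, of "polynomial_ring n"]
        by (simp only: polynomial_ring_simps)
    qed
  qed
qed

lemma cover_ideal_power:
  "cover_ideal n (path_edges n) [^]\<^bsub>ideals_set (polynomial_ring n)\<^esub> t = (edge_power n t :: 'k::field mpoly set)"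
proof (induction t)
  case 0
  then show ?case by (simp add: nat_pow_def ideals_set_def edge_power_0)
next
  case (Suc t)
  let ?J = "cover_ideal n (path_edges n) :: 'k mpoly set"
  have "?J [^]\<^bsub>ideals_set (polynomial_ring n)\<^esub> Suc t =
      ideal_prod (polynomial_ring n) (?J [^]\<^bsub>ideals_set (polynomial_ring n)\<^esub> t) ?J"
    by (simp add: nat_pow_def ideals_set_def)
  also have "\<dots> = edge_power n (Suc t)"
    unfolding Suc.IH unfolding cover_ideal_path by (rule edge_power_Suc)
  finally show ?case .
qed

section \<open>Multigraded pieces of the localizations\<close>

text \<open>
  The monomial fraction \<open>x\<^sup>m / (\<Prod>\<^bsub>i\<in>F\<^esub> x\<^sub>i)\<^sup>k\<close> has the exponent vector \<open>frac_exp F k m\<close>.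
\<close>

definition frac_exp :: "nat set \<Rightarrow> nat \<Rightarrow> (nat \<Rightarrow>\<^sub>0 nat) \<Rightarrow> nat \<Rightarrow> int" where
  "frac_exp F k m = (\<lambda>i. int (Poly_Mapping.lookup m i) - (if i \<in> F then int k else 0))"

text \<open>The degrees in \<open>\<int>\<close>-valued vectors of length \<open>n\<close>, encoded
  as functions on all naturals. Fixing the value 0 outside \<open>{1..n}\<close> makes each degree a
  single function.\<close>

definition exp_range :: "nat \<Rightarrow> (nat \<Rightarrow> int) set" where
  "exp_range n = {a. \<forall>i. i \<notin> {1..n} \<longrightarrow> a i = 0}"

text \<open>
  \<open>allowed n t F\<close> consists of the exponent vectors of the nonzero monomials of \<open>(R/J\<^sup>t)\<^bsub>x\<^sub>F\<^esub>\<close>.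
\<close>

definition allowed :: "nat \<Rightarrow> nat \<Rightarrow> nat set \<Rightarrow> (nat \<Rightarrow> int) set" where
  "allowed n t F = {a \<in> exp_range n. neg_set a \<subseteq> F \<and> (\<exists>j\<in>light_edges n t a. j \<notin> F \<and> Suc j \<notin> F)}"

text \<open>The coefficient in degree \<open>a\<close> of the image of \<open>p / x_F^k\<close> in
  the localized quotient. Degrees that are not allowed are set to zero, because their monomials
  vanish there; the preimage under \<open>frac_exp F k\<close> is unique by injectivity.\<close>

definition frac_coeff :: "nat \<Rightarrow> nat \<Rightarrow> nat set \<Rightarrow> 'k::field mpoly \<Rightarrow> nat \<Rightarrow> (nat \<Rightarrow> int) \<Rightarrow> 'k" where
  "frac_coeff n t F p k a =
     (if a \<in> allowed n t F \<and> a \<in> range (frac_exp F k)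
      then Poly_Mapping.lookup p (inv_into UNIV (frac_exp F k) a) else 0)"

lemma inj_frac_exp: "inj (frac_exp F k)"
proof (rule injI)
  fix m m' assume "frac_exp F k m = frac_exp F k m'"
  then have "Poly_Mapping.lookup m i = Poly_Mapping.lookup m' i" for i
    by (auto simp: frac_exp_def dest: fun_cong[of _ _ i])
  then show "m = m'" by (rule poly_mapping_eqI)
qed

lemma frac_coeff_exp:
  "frac_exp F k m \<in> allowed n t F \<Longrightarrow> frac_coeff n t F p k (frac_exp F k m) = Poly_Mapping.lookup p m"
  by (simp add: frac_coeff_def inv_f_f[OF inj_frac_exp])

lemma frac_coeff_outside: "a \<notin> allowed n t F \<Longrightarrow> frac_coeff n t F p k a = 0"
  by (simp add: frac_coeff_def)

lemma frac_coeff_not_exp: "a \<notin> range (frac_exp F k) \<Longrightarrow> frac_coeff n t F p k a = 0"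
  by (simp add: frac_coeff_def)

lemma frac_coeff_add: "frac_coeff n t F (p + q) k = (\<lambda>a. frac_coeff n t F p k a + frac_coeff n t F q k a)"
  by (auto simp: frac_coeff_def lookup_add)

lemma frac_coeff_diff: "frac_coeff n t F (p - q) k = (\<lambda>a. frac_coeff n t F p k a - frac_coeff n t F q k a)"
  by (auto simp: frac_coeff_def lookup_minus)

lemma frac_coeff_zero: "frac_coeff n t F 0 k = (\<lambda>_. 0)"
  by (auto simp: frac_coeff_def)

lemma frac_coeff_finite: "finite {a. frac_coeff n t F p k a \<noteq> 0}"
proof (rule finite_subset)
  show "{a. frac_coeff n t F p k a \<noteq> 0} \<subseteq> frac_exp F k ` Poly_Mapping.keys p"
    by (auto simp: frac_coeff_def in_keys_iff inv_f_f[OF inj_frac_exp] split: if_splits)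
qed simp

lemma frac_exp_expand: "finite F \<Longrightarrow> frac_exp F (k + l) (exps F l + m) = frac_exp F k m"
  by (auto simp: frac_exp_def lookup_add lookup_exps)

text \<open>Expanding a fraction by \<open>x_F^l\<close> moves numerator and denominator together
  and changes no degree. This allows fractions to be brought to a common denominator.\<close>

lemma frac_coeff_expand:
  assumes "finite F"
  shows "frac_coeff n t F (xmon (exps F l) * p) (k + l) = frac_coeff n t F p k"
proof
  fix a
  consider "a \<notin> allowed n t F" | m where "a \<in> allowed n t F" "a = frac_exp F k m"
    | m' where "a \<in> allowed n t F" "a \<notin> range (frac_exp F k)" "a = frac_exp F (k + l) m'"
    | "a \<notin> range (frac_exp F k)" "a \<notin> range (frac_exp F (k + l))" by blast
  then show "frac_coeff n t F (xmon (exps F l) * p) (k + l) a = frac_coeff n t F p k a"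
  proof cases
    case (2 m)
    then have "a = frac_exp F (k + l) (exps F l + m)" by (simp add: frac_exp_expand assms)
    then show ?thesis using 2 frac_coeff_exp[of F "k + l" "exps F l + m" n t "xmon (exps F l) * p"]
        frac_coeff_exp[of F k m n t p] by (simp add: lookup_xmon_mult_add)
  next
    case (3 m')
    have "m' \<noteq> exps F l + m" for m using 3 frac_exp_expand[OF assms, of k l m] by auto
    then show ?thesis using 3 frac_coeff_exp[of F "k + l" m' n t "xmon (exps F l) * p"]
      by (simp add: lookup_xmon_mult_not frac_coeff_not_exp)
  qed (simp_all add: frac_coeff_outside frac_coeff_not_exp)
qed

lemma frac_exp_allowed:
  assumes p: "p \<in> carrier (polynomial_ring n)" and m: "m \<in> Poly_Mapping.keys p" and F: "F \<subseteq> {1..n}"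
    and j: "1 \<le> j" "Suc j \<le> n" "j \<notin> F" "Suc j \<notin> F"
    "Poly_Mapping.lookup m j + Poly_Mapping.lookup m (Suc j) < t"
  shows "frac_exp F k m \<in> allowed n t F"
proof -
  have "Poly_Mapping.keys m \<subseteq> {1..n}" using p m by (simp only: carrier_polynomial_ring)
  then have "frac_exp F k m \<in> exp_range n"
    using F by (auto simp: exp_range_def frac_exp_def in_keys_iff)
  moreover have "neg_set (frac_exp F k m) \<subseteq> F" by (auto simp: neg_set_def frac_exp_def)
  moreover have "j \<in> light_edges n t (frac_exp F k m)"
    using j by (auto simp: light_edges_def frac_exp_def)
  ultimately show ?thesis using j by (auto simp: allowed_def)
qed

text \<open>Multiplication by \<open>x_F\<close> leaves exponents off \<open>F\<close> unchanged. An
  edge disjoint from \<open>F\<close> with sum below \<open>t\<close> therefore stays an obstruction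
  for every \<open>l\<close>, while every edge meeting \<open>F\<close> reaches sum \<open>t\<close>
  eventually. This identifies the kernel of localization.\<close>

lemma frac_coeff_eq_zero:
  assumes p: "p \<in> carrier (polynomial_ring n)" and F: "F \<subseteq> {1..n}"
  shows "frac_coeff n t F p k = (\<lambda>_. 0) \<longleftrightarrow> (\<exists>l. xmon (exps F l) * p \<in> (edge_power n t :: 'k::field mpoly set))"
proof
  have fin: "finite F" using F finite_subset by blast
  assume zero: "frac_coeff n t F p k = (\<lambda>_. 0)"
  \<comment> \<open>The power \<open>l = t\<close> suffices, since each edge meeting
    \<open>F\<close> gains at least \<open>t\<close>.\<close>
  have "xmon (exps F t) * p \<in> (edge_power n t :: 'k mpoly set)"
    unfolding edge_power_def
  proof (intro CollectI conjI ballI allI impI)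
    show "xmon (exps F t) * p \<in> carrier (polynomial_ring n)"
      by (intro carrier_mult carrier_xmon_exps F p)
    fix c j assume "c \<in> Poly_Mapping.keys (xmon (exps F t) * p)" and j: "1 \<le> j" "Suc j \<le> n"
    then obtain m where m: "c = exps F t + m" "m \<in> Poly_Mapping.keys p"
      unfolding keys_xmon_mult by blast
    show "t \<le> Poly_Mapping.lookup c j + Poly_Mapping.lookup c (Suc j)"
    proof (rule ccontr)
      assume "\<not> ?thesis"
      then have "j \<notin> F" "Suc j \<notin> F" "Poly_Mapping.lookup m j + Poly_Mapping.lookup m (Suc j) < t"
        using m(1) by (auto simp: lookup_add lookup_exps[OF fin] split: if_splits)
      then have "frac_exp F k m \<in> allowed n t F" by (rule frac_exp_allowed[OF p m(2) F j])
      then have "frac_coeff n t F p k (frac_exp F k m) = Poly_Mapping.lookup p m" by (rule frac_coeff_exp)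
      then show False using zero m(2) by (simp add: in_keys_iff)
    qed
  qed
  then show "\<exists>l. xmon (exps F l) * p \<in> (edge_power n t :: 'k mpoly set)" by blast
next
  have fin: "finite F" using F finite_subset by blast
  assume "\<exists>l. xmon (exps F l) * p \<in> (edge_power n t :: 'k mpoly set)"
  then obtain l where l: "xmon (exps F l) * p \<in> (edge_power n t :: 'k mpoly set)" by blast
  show "frac_coeff n t F p k = (\<lambda>_. 0)"
  proof
    fix a
    show "frac_coeff n t F p k a = 0"
    proof (rule ccontr)
      assume ne: "frac_coeff n t F p k a \<noteq> 0"
      then have a: "a \<in> allowed n t F" "a \<in> range (frac_exp F k)"
        by (auto simp: frac_coeff_def split: if_splits)
      then obtain m where m: "a = frac_exp F k m" by blast
      then have "m \<in> Poly_Mapping.keys p" using ne a frac_coeff_exp[of F k m n t p] by (simp add: in_keys_iff)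
      then have key: "exps F l + m \<in> Poly_Mapping.keys (xmon (exps F l) * p)"
        unfolding keys_xmon_mult by blast
      obtain j where j: "j \<in> light_edges n t a" "j \<notin> F" "Suc j \<notin> F" using a by (auto simp: allowed_def)
      then have "1 \<le> j" "Suc j \<le> n" by (auto simp: light_edges_def)
      from edge_powerD[OF l key this] show False
        using j m by (auto simp: light_edges_def frac_exp_def lookup_add lookup_exps[OF fin])
    qed
  qed
qed

text \<open>A direct sum of one-dimensional pieces indexed by the allowed degrees, whence the finite
  support. It is the model of the localization at the face \<open>F\<close>.\<close>

definition frac_space :: "nat \<Rightarrow> nat \<Rightarrow> nat set \<Rightarrow> ((nat \<Rightarrow> int) \<Rightarrow> 'k::field) set" where
  "frac_space n t F = {h. finite {a. h a \<noteq> 0} \<and> (\<forall>a. h a \<noteq> 0 \<longrightarrow> a \<in> allowed n t F)}"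

lemma frac_coeff_space: "frac_coeff n t F p k \<in> frac_space n t F"
  using frac_coeff_finite frac_coeff_outside unfolding frac_space_def by blast

lemma frac_exp_surj:
  assumes a: "a \<in> exp_range n" and F: "F \<subseteq> {1..n}"
    and nn: "\<And>i. 0 \<le> a i + (if i \<in> F then int k else 0)"
  obtains m where "Poly_Mapping.keys m \<subseteq> {1..n}" "frac_exp F k m = a"
proof -
  let ?f = "\<lambda>i. nat (a i + (if i \<in> F then int k else 0))"
  have sub: "{i. ?f i \<noteq> 0} \<subseteq> {1..n}"
  proof (rule subsetI, rule ccontr)
    fix i assume "i \<in> {i. ?f i \<noteq> 0}" "i \<notin> {1..n}"
    moreover from this have "a i = 0" "i \<notin> F" using a F by (auto simp: exp_range_def)
    ultimately show False by simp
  qed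
  then have fin: "finite {i. ?f i \<noteq> 0}" by (rule finite_subset) simp
  let ?m = "Abs_poly_mapping ?f"
  have l: "Poly_Mapping.lookup ?m = ?f" by (rule lookup_Abs_poly_mapping[OF fin])
  have "Poly_Mapping.keys ?m \<subseteq> {1..n}" using sub by (simp add: Poly_Mapping.keys.rep_eq l)
  moreover have "frac_exp F k ?m = a"
    unfolding frac_exp_def l using nn by (intro ext) simp
  ultimately show ?thesis by (rule that)
qed

lemma frac_coeff_surj:
  assumes h: "h \<in> frac_space n t F" and F: "F \<subseteq> {1..n}"
  obtains p k where "p \<in> carrier (polynomial_ring n)" "frac_coeff n t F p k = (h :: _ \<Rightarrow> 'k::field)"
proof -
  let ?S = "{a. h a \<noteq> 0}"
  have fin: "finite ?S" and S: "?S \<subseteq> allowed n t F" using h by (auto simp: frac_space_def)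
  \<comment> \<open>One denominator must serve all degrees in the support: any \<open>k\<close> that
    bounds all absolute values of entries will do, and their total is such a bound.\<close>
  define k where "k = (\<Sum>a\<in>?S. \<Sum>i\<in>{1..n}. nat \<bar>a i\<bar>)"
  have "\<exists>m. Poly_Mapping.keys m \<subseteq> {1..n} \<and> frac_exp F k m = a" if "a \<in> ?S" for a
  proof -
    have a: "a \<in> exp_range n" "neg_set a \<subseteq> F" using S that by (auto simp: allowed_def)
    have "0 \<le> a i + (if i \<in> F then int k else 0)" for i
    proof (cases "i \<in> F")
      case True
      have "nat \<bar>a i\<bar> \<le> (\<Sum>i\<in>{1..n}. nat \<bar>a i\<bar>)"
        using True F by (intro member_le_sum) auto
      also have "\<dots> \<le> k"
        unfolding k_def using that fin by (intro member_le_sum[where f = "\<lambda>a. \<Sum>i\<in>{1..n}. nat \<bar>a i\<bar>"]) auto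
      finally show ?thesis using True by simp
    next
      case False
      then have "i \<notin> neg_set a" using a by blast
      then show ?thesis using False by (simp add: neg_set_def)
    qed
    then show ?thesis using frac_exp_surj[OF a(1) F, of k] by blast
  qed
  then obtain \<mu> where \<mu>: "\<And>a. a \<in> ?S \<Longrightarrow> Poly_Mapping.keys (\<mu> a) \<subseteq> {1..n}"
      "\<And>a. a \<in> ?S \<Longrightarrow> frac_exp F k (\<mu> a) = a"
    by metis
  define p where "p = (\<Sum>a\<in>?S. Poly_Mapping.single (\<mu> a) (h a))"
  have lp: "Poly_Mapping.lookup p m = h (frac_exp F k m)" for m
  proof -
    have "Poly_Mapping.lookup p m = (\<Sum>a\<in>?S. if \<mu> a = m then h a else 0)"
      unfolding p_def by (simp add: lookup_sum lookup_single when_def)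
    also have "\<dots> = (\<Sum>a\<in>?S. if a = frac_exp F k m then h a else 0)"
    proof (rule sum.cong[OF refl])
      fix a assume a: "a \<in> ?S"
      have "\<mu> a = m \<longleftrightarrow> a = frac_exp F k m"
        using \<mu>(2)[OF a] injD[OF inj_frac_exp, of F k "\<mu> a" m] by auto
      then show "(if \<mu> a = m then h a else 0) = (if a = frac_exp F k m then h a else 0)" by simp
    qed
    also have "\<dots> = h (frac_exp F k m)" using fin by (simp add: sum.delta)
    finally show ?thesis .
  qed
  have pc: "p \<in> carrier (polynomial_ring n)"
    unfolding carrier_polynomial_ring
  proof
    fix m assume "m \<in> Poly_Mapping.keys p"
    then have "frac_exp F k m \<in> ?S" by (simp add: in_keys_iff lp)
    then have "\<mu> (frac_exp F k m) = m" using \<mu>(2) injD[OF inj_frac_exp] by metis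
    then show "Poly_Mapping.keys m \<subseteq> {1..n}" using \<mu>(1)[OF \<open>frac_exp F k m \<in> ?S\<close>] by simp
  qed
  have "frac_coeff n t F p k a = h a" for a
  proof (cases "a \<in> range (frac_exp F k)")
    case True
    then obtain m where m: "a = frac_exp F k m" by blast
    show ?thesis
    proof (cases "a \<in> allowed n t F")
      case True
      then show ?thesis using frac_coeff_exp[of F k m n t p] m lp by simp
    next
      case False
      then have "h a = 0" using S by blast
      then show ?thesis using frac_coeff_outside[OF False] by simp
    qed
  next
    case False
    have "a \<notin> ?S"
    proof
      assume "a \<in> ?S"
      then have "a = frac_exp F k (\<mu> a)" using \<mu>(2) by simp
      then show False using False by blast
    qed
    then show ?thesis using False by (simp add: frac_coeff_not_exp)
  qed
  then have "frac_coeff n t F p k = h" by (rule ext)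
  then show ?thesis using pc that by blast
qed

text \<open>Passing from \<open>p / x_F^k\<close> to \<open>x_i^k p / (x_F x_i)^k\<close> keeps all
  exponent vectors. The canonical map is thus the identity on coefficients, except that it kills the
  degrees whose light edges off \<open>F\<close> all contain \<open>i\<close>.\<close>

lemma frac_coeff_restrict:
  assumes F: "insert i F \<subseteq> {1..n}" "i \<notin> F"
  shows "frac_coeff n t (insert i F) (xmon (exps {i} k) * p) k =
    (\<lambda>a. if a \<in> allowed n t (insert i F) then frac_coeff n t F (p :: 'k::field mpoly) k a else 0)"
proof
  fix a
  have ex: "frac_exp (insert i F) k (exps {i} k + m) = frac_exp F k m" for m
    using F(2) by (auto simp: frac_exp_def lookup_add lookup_exps)
  let ?lhs = "frac_coeff n t (insert i F) (xmon (exps {i} k) * p) k a"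
  show "?lhs = (if a \<in> allowed n t (insert i F) then frac_coeff n t F p k a else 0)"
  proof (cases "a \<in> allowed n t (insert i F)")
    case True
    show ?thesis
    proof (cases "a \<in> range (frac_exp F k)")
      case exp: True
      then obtain m where m: "a = frac_exp F k m" by blast
      \<comment> \<open>A degree that occurs over the denominator \<open>x_F^k\<close> has negative
        entries only in \<open>F\<close>, so being allowed at the larger face makes it allowed at
        \<open>F\<close>.\<close>
      have "neg_set a \<subseteq> F" unfolding m by (auto simp: neg_set_def frac_exp_def)
      then have "a \<in> allowed n t F" using True by (auto simp: allowed_def)
      then show ?thesis
        using True m ex[of m] frac_coeff_exp[of F k m n t p]
          frac_coeff_exp[of "insert i F" k "exps {i} k + m" n t "xmon (exps {i} k) * p"]
        by (simp add: lookup_xmon_mult_add)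
    next
      case nexp: False
      have "?lhs = 0"
      proof (cases "a \<in> range (frac_exp (insert i F) k)")
        case True
        then obtain m' where m': "a = frac_exp (insert i F) k m'" by blast
        then have "m' \<noteq> exps {i} k + m" for m using nexp ex[of m] by auto
        then show ?thesis
          using m' \<open>a \<in> allowed n t (insert i F)\<close>
            frac_coeff_exp[of "insert i F" k m' n t "xmon (exps {i} k) * p"]
          by (simp add: lookup_xmon_mult_not)
      qed (rule frac_coeff_not_exp)
      then show ?thesis using nexp by (simp add: frac_coeff_not_exp)
    qed
  qed (simp add: frac_coeff_outside)
qed

section \<open>The localizations as groups\<close>

abbreviation residue :: "nat \<Rightarrow> nat \<Rightarrow> 'k::field mpoly \<Rightarrow> 'k mpoly set" where
  "residue n t p \<equiv> edge_power n t +>\<^bsub>polynomial_ring n\<^esub> p"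

abbreviation power_quotient :: "nat \<Rightarrow> nat \<Rightarrow> ('k::field mpoly, 'k mpoly set) module" where
  "power_quotient n t \<equiv> quotient_module (polynomial_ring n) (edge_power n t)"

abbreviation face_localization :: "nat \<Rightarrow> nat \<Rightarrow> nat set \<Rightarrow> ('k::field mpoly set \<times> nat) set monoid" where
  "face_localization n t F \<equiv>
    localization (polynomial_ring n) (power_quotient n t) (finprod (polynomial_ring n) var F)"

lemma residue_eq_iff:
  assumes "p \<in> carrier (polynomial_ring n)" "q \<in> carrier (polynomial_ring n)"
  shows "residue n t p = residue n t q \<longleftrightarrow> p - q \<in> (edge_power n t :: 'k::field mpoly set)"
proof -
  interpret cring "polynomial_ring n :: 'k mpoly ring" by (rule cring_polynomial_ring)
  show ?thesis
    using quotient_eq_iff_same_a_r_cos[OF edge_power_ideal assms, of t] minus_polynomial_ring[OF assms] by simp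
qed

lemma carrier_power_quotient:
  "carrier (power_quotient n t) = residue n t ` carrier (polynomial_ring n :: 'k::field mpoly ring)"
  by (auto simp: quotient_module_def FactRing_def A_RCOSETS_def')

lemma smult_power_quotient:
  assumes "p \<in> carrier (polynomial_ring n)" "q \<in> carrier (polynomial_ring n)"
  shows "p \<odot>\<^bsub>power_quotient n t\<^esub> residue n t q = residue n t (p * (q :: 'k::field mpoly))"
proof -
  interpret ideal "edge_power n t" "polynomial_ring n :: 'k mpoly ring" by (rule edge_power_ideal)
  show ?thesis using rcoset_mult_add[OF assms] by (simp add: quotient_module_def FactRing_def)
qed

lemma add_power_quotient:
  assumes "p \<in> carrier (polynomial_ring n)" "q \<in> carrier (polynomial_ring n)"
  shows "residue n t p \<oplus>\<^bsub>power_quotient n t\<^esub> residue n t q = residue n t (p + (q :: 'k::field mpoly))"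
proof -
  interpret ideal "edge_power n t" "polynomial_ring n :: 'k mpoly ring" by (rule edge_power_ideal)
  show ?thesis using a_rcos_sum[OF assms] by (simp add: quotient_module_def FactRing_def)
qed

lemma zero_power_quotient: "\<zero>\<^bsub>power_quotient n t\<^esub> = residue n t (0 :: 'k::field mpoly)"
proof -
  have z: "0 \<in> carrier (polynomial_ring n :: 'k mpoly ring)" by (rule carrier_zero)
  have zt: "0 \<in> (edge_power n t :: 'k mpoly set)" by (simp add: edge_power_def carrier_zero)
  have quot_zero: "\<zero>\<^bsub>power_quotient n t\<^esub> = (edge_power n t :: 'k mpoly set)"
    by (simp add: quotient_module_def FactRing_def)
  interpret ideal "edge_power n t" "polynomial_ring n :: 'k mpoly ring" by (rule edge_power_ideal)
  show ?thesis unfolding quot_zero by (rule a_coset_join2[OF z a_subgroup zt, symmetric])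
qed

text \<open>The left side is the equality of fractions used by \<open>module_frac\<close>. Over the
  common denominator with exponent \<open>k + k'\<close> it becomes the vanishing criterion for a
  difference, and \<open>frac_coeff_expand\<close> removes the expansion again.\<close>

lemma residue_expand_eq_iff:
  assumes p: "p \<in> carrier (polynomial_ring n)" and q: "q \<in> carrier (polynomial_ring n)" and F: "F \<subseteq> {1..n}"
  shows "(\<exists>l. residue n t (xmon (exps F (l + k')) * p) = residue n t (xmon (exps F (l + k)) * q)) \<longleftrightarrow>
    frac_coeff n t F p k = frac_coeff n t F (q :: 'k::field mpoly) k'"
proof -
  have fin: "finite F" using F finite_subset by blast
  let ?x = "\<lambda>k. xmon (exps F k) :: 'k mpoly"
  have x: "?x k \<in> carrier (polynomial_ring n)" for k by (rule carrier_xmon_exps[OF F])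
  have xx: "?x (l + k) * r = ?x l * (?x k * r)" for l k r
    by (simp add: exps_add[OF fin] mult_single flip: mult.assoc)
  have "residue n t (?x (l + k') * p) = residue n t (?x (l + k) * q) \<longleftrightarrow>
      ?x l * (?x k' * p - ?x k * q) \<in> edge_power n t" for l
    unfolding xx right_diff_distrib by (intro residue_eq_iff carrier_mult x p q)
  then have "(\<exists>l. residue n t (?x (l + k') * p) = residue n t (?x (l + k) * q)) \<longleftrightarrow>
      frac_coeff n t F (?x k' * p - ?x k * q) (k + k') = (\<lambda>_. 0)"
    using carrier_add[OF carrier_mult[OF x p] carrier_uminus[OF carrier_mult[OF x q]], of k' k]
    by (subst frac_coeff_eq_zero[OF _ F]) simp_all
  also have "\<dots> \<longleftrightarrow> frac_coeff n t F (?x k' * p) (k + k') = frac_coeff n t F (?x k * q) (k' + k)"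
    by (simp add: frac_coeff_diff fun_eq_iff add.commute)
  also have "\<dots> \<longleftrightarrow> frac_coeff n t F p k = frac_coeff n t F q k'"
    by (simp only: frac_coeff_expand[OF fin])
  finally show ?thesis .
qed

text \<open>The fraction with coefficient function \<open>h\<close>, as the set of all pairs that
  represent it. Indexing fractions by \<open>h\<close> turns the set-valued operations into
  pointwise ones.\<close>

definition frac_class ::
    "nat \<Rightarrow> nat \<Rightarrow> nat set \<Rightarrow> ((nat \<Rightarrow> int) \<Rightarrow> 'k::field) \<Rightarrow> ('k mpoly set \<times> nat) set" where
  "frac_class n t F h = {(residue n t q, l) | q l. q \<in> carrier (polynomial_ring n) \<and> frac_coeff n t F q l = h}"

lemma frac_classI:
  "q \<in> carrier (polynomial_ring n) \<Longrightarrow> (residue n t q, l) \<in> frac_class n t F (frac_coeff n t F q l)"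
  unfolding frac_class_def by blast

lemma finprod_var_pow:
  "F \<subseteq> {1..n} \<Longrightarrow> finprod (polynomial_ring n) var F [^]\<^bsub>polynomial_ring n\<^esub> (k::nat)
    = (xmon (exps F k) :: 'k::field mpoly)"
  using finite_subset[of F "{1..n}"]
  by (simp only: finprod_var pow_polynomial_ring) (simp add: xmon_power)

lemma module_frac_eq:
  assumes p: "p \<in> carrier (polynomial_ring n)" and F: "F \<subseteq> {1..n}"
  shows "module_frac (polynomial_ring n) (power_quotient n t) (finprod (polynomial_ring n) var F) (residue n t p) k
    = frac_class n t F (frac_coeff n t F (p :: 'k::field mpoly) k)" (is "?L = ?R")
proof -
  have x: "(xmon (exps F k) :: 'k mpoly) \<in> carrier (polynomial_ring n)" for k by (rule carrier_xmon_exps[OF F])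
  have iff: "(residue n t q, k') \<in> ?L \<longleftrightarrow> frac_coeff n t F q k' = frac_coeff n t F p k"
    if q: "q \<in> carrier (polynomial_ring n)" for q k'
  proof -
    have "(residue n t q, k') \<in> ?L \<longleftrightarrow>
        (\<exists>l. residue n t (xmon (exps F (l + k')) * p) = residue n t (xmon (exps F (l + k)) * q))"
      using q by (simp add: module_frac_def carrier_power_quotient finprod_var_pow[OF F]
          smult_power_quotient[OF x p] smult_power_quotient[OF x q])
    then show ?thesis using residue_expand_eq_iff[OF p q F] by metis
  qed
  show ?thesis
  proof (intro equalityI subsetI)
    fix z assume z: "z \<in> ?L"
    then obtain q k' where q: "q \<in> carrier (polynomial_ring n)" "z = (residue n t q, k')"
      by (auto simp: module_frac_def carrier_power_quotient)
    then show "z \<in> ?R" using z iff[OF q(1), of k'] unfolding frac_class_def by blast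
  next
    fix z assume "z \<in> ?R"
    then obtain q k' where "q \<in> carrier (polynomial_ring n)" "z = (residue n t q, k')"
        "frac_coeff n t F q k' = frac_coeff n t F p k"
      unfolding frac_class_def by blast
    then show "z \<in> ?L" using iff by blast
  qed
qed

lemma frac_class_inj:
  assumes h: "h \<in> frac_space n t F" and F: "F \<subseteq> {1..n}" and eq: "frac_class n t F h = frac_class n t F h'"
  shows "h = (h' :: _ \<Rightarrow> 'k::field)"
proof -
  obtain p k where p: "p \<in> carrier (polynomial_ring n)" "frac_coeff n t F p k = h"
    by (rule frac_coeff_surj[OF h F])
  have "(residue n t p, k) \<in> frac_class n t F h'" using frac_classI[OF p(1), of t k F] p(2) eq by simp
  then obtain q where q: "q \<in> carrier (polynomial_ring n)" "frac_coeff n t F q k = h'"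
      "residue n t p = residue n t q"
    unfolding frac_class_def by blast
  \<comment> \<open>Equal residues over the same exponent \<open>k\<close> put the difference into
    the ideal at once, which is the vanishing criterion with \<open>l = 0\<close>.\<close>
  then have "xmon (exps F 0) * (p - q) \<in> edge_power n t"
    using residue_eq_iff[OF p(1) q(1)] by simp
  then have ex: "\<exists>l. xmon (exps F l) * (p - q) \<in> edge_power n t" by (rule exI)
  have "p - q \<in> carrier (polynomial_ring n)" using carrier_add[OF p(1) carrier_uminus[OF q(1)]] by simp
  then have "frac_coeff n t F (p - q) k = (\<lambda>_. 0)"
    using frac_coeff_eq_zero[OF _ F, of "p - q" t k] ex by blast
  then show ?thesis using p q by (simp add: frac_coeff_diff fun_eq_iff)
qed

section \<open>Group operations and canonical maps in terms of coefficients\<close>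

lemma carrier_face_localization:
  assumes "F \<subseteq> {1..n}"
  shows "carrier (face_localization n t F) = frac_class n t F ` (frac_space n t F :: (_ \<Rightarrow> 'k::field) set)"
proof (intro equalityI subsetI)
  fix A :: "('k mpoly set \<times> nat) set" assume "A \<in> carrier (face_localization n t F)"
  then obtain p k where "p \<in> carrier (polynomial_ring n)"
      "A = module_frac (polynomial_ring n) (power_quotient n t) (finprod (polynomial_ring n) var F) (residue n t p) k"
    by (auto simp: localization_def carrier_power_quotient)
  then show "A \<in> frac_class n t F ` frac_space n t F"
    using module_frac_eq[OF _ assms] frac_coeff_space by blast
next
  fix A :: "('k mpoly set \<times> nat) set" assume "A \<in> frac_class n t F ` frac_space n t F"
  then obtain h where h: "h \<in> frac_space n t F" "A = frac_class n t F h" by blast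
  obtain p k where p: "p \<in> carrier (polynomial_ring n)" "frac_coeff n t F p k = h"
    by (rule frac_coeff_surj[OF h(1) assms])
  then have "A = module_frac (polynomial_ring n) (power_quotient n t) (finprod (polynomial_ring n) var F) (residue n t p) k"
    using h module_frac_eq[OF p(1) assms] by simp
  then show "A \<in> carrier (face_localization n t F)"
    using p(1) by (auto simp: localization_def carrier_power_quotient)
qed

lemma one_face_localization:
  assumes "F \<subseteq> {1..n}"
  shows "\<one>\<^bsub>face_localization n t F\<^esub> = frac_class n t F (\<lambda>_. 0 :: 'k::field)"
  using module_frac_eq[OF carrier_zero assms, of t 0]
  by (simp add: localization_def zero_power_quotient frac_coeff_zero)

text \<open>The product is a union over all pairs of representatives. Every set in the union is the
  class of the pointwise sum, so the union collapses.\<close>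

lemma mult_face_localization:
  fixes h h' :: "_ \<Rightarrow> 'k::field"
  assumes F: "F \<subseteq> {1..n}" and h: "h \<in> frac_space n t F" "h' \<in> frac_space n t F"
  shows "frac_class n t F h \<otimes>\<^bsub>face_localization n t F\<^esub> frac_class n t F h' = frac_class n t F (\<lambda>a. h a + h' a)"
proof -
  have fin: "finite F" using F finite_subset by blast
  define mf where "mf = module_frac (polynomial_ring n) (power_quotient n t :: ('k mpoly, 'k mpoly set) module)
      (finprod (polynomial_ring n) var F)"
  define \<Phi> where "\<Phi> m k m' k' = mf
      ((finprod (polynomial_ring n) var F [^]\<^bsub>polynomial_ring n\<^esub> k') \<odot>\<^bsub>power_quotient n t\<^esub> m
        \<oplus>\<^bsub>power_quotient n t\<^esub> (finprod (polynomial_ring n) var F [^]\<^bsub>polynomial_ring n\<^esub> k) \<odot>\<^bsub>power_quotient n t\<^esub> m')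
      (k + k')" for m m' :: "'k mpoly set" and k k' :: nat
  have x: "(xmon (exps F k) :: 'k mpoly) \<in> carrier (polynomial_ring n)" for k by (rule carrier_xmon_exps[OF F])
  have \<Phi>: "\<Phi> m k m' k' = frac_class n t F (\<lambda>a. h a + h' a)"
    if mk: "(m, k) \<in> frac_class n t F h" "(m', k') \<in> frac_class n t F h'" for m k m' k'
  proof -
    obtain p where p: "p \<in> carrier (polynomial_ring n)" "m = residue n t p" "frac_coeff n t F p k = h"
      using mk(1) unfolding frac_class_def by blast
    obtain q where q: "q \<in> carrier (polynomial_ring n)" "m' = residue n t q" "frac_coeff n t F q k' = h'"
      using mk(2) unfolding frac_class_def by blast
    note xp = carrier_mult[OF x p(1), of k'] and xq = carrier_mult[OF x q(1), of k]
    have "\<Phi> m k m' k' = mf (residue n t (xmon (exps F k') * p + xmon (exps F k) * q)) (k + k')"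
      unfolding \<Phi>_def p(2) q(2) finprod_var_pow[OF F] smult_power_quotient[OF x p(1)]
        smult_power_quotient[OF x q(1)] add_power_quotient[OF xp xq] ..
    also have "\<dots> = frac_class n t F (frac_coeff n t F (xmon (exps F k') * p + xmon (exps F k) * q) (k + k'))"
      unfolding mf_def by (rule module_frac_eq[OF carrier_add[OF xp xq] F])
    also have "frac_coeff n t F (xmon (exps F k') * p + xmon (exps F k) * q) (k + k') = (\<lambda>a. h a + h' a)"
      using frac_coeff_expand[OF fin, of n t k' p k] frac_coeff_expand[OF fin, of n t k q k'] p(3) q(3)
      by (simp add: frac_coeff_add add.commute)
    finally show ?thesis .
  qed
  \<comment> \<open>Both factors have a representative, so the union is not taken over an empty
    index set.\<close>
  have ne: "\<exists>m k. (m, k) \<in> frac_class n t F g" if "g \<in> frac_space n t F" for g :: "_ \<Rightarrow> 'k"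
    by (rule frac_coeff_surj[OF that F]) (use frac_classI in blast)
  have "frac_class n t F h \<otimes>\<^bsub>face_localization n t F\<^esub> frac_class n t F h' =
      (\<Union>(m, k)\<in>frac_class n t F h. \<Union>(m', k')\<in>frac_class n t F h'. \<Phi> m k m' k')"
    by (simp add: localization_def \<Phi>_def mf_def)
  also have "\<dots> = frac_class n t F (\<lambda>a. h a + h' a)"
  proof (intro equalityI subsetI)
    fix z assume "z \<in> (\<Union>(m, k)\<in>frac_class n t F h. \<Union>(m', k')\<in>frac_class n t F h'. \<Phi> m k m' k')"
    then show "z \<in> frac_class n t F (\<lambda>a. h a + h' a)" using \<Phi> by auto
  next
    fix z assume z: "z \<in> frac_class n t F (\<lambda>a. h a + h' a)"
    obtain m k m' k' where mk: "(m, k) \<in> frac_class n t F h" "(m', k') \<in> frac_class n t F h'"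
      using ne h by metis
    then have "z \<in> \<Phi> m k m' k'" using z \<Phi> by simp
    then show "z \<in> (\<Union>(m, k)\<in>frac_class n t F h. \<Union>(m', k')\<in>frac_class n t F h'. \<Phi> m k m' k')"
      using mk by blast
  qed
  finally show ?thesis .
qed

lemma frac_space_zero: "(\<lambda>_. 0) \<in> frac_space n t F"
  by (simp add: frac_space_def)

lemma frac_space_add:
  assumes "h \<in> frac_space n t F" "h' \<in> frac_space n t F"
  shows "(\<lambda>a. h a + h' a) \<in> frac_space n t F"
proof -
  have "finite {a. h a + h' a \<noteq> 0}"
    by (rule finite_subset[of _ "{a. h a \<noteq> 0} \<union> {a. h' a \<noteq> 0}"]) (use assms in \<open>auto simp: frac_space_def\<close>)
  moreover have "a \<in> allowed n t F" if "h a + h' a \<noteq> 0" for a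
    using assms that by (cases "h a = 0") (auto simp: frac_space_def)
  ultimately show ?thesis by (simp add: frac_space_def)
qed

lemma frac_space_scale:
  assumes "h \<in> frac_space n t F"
  shows "(\<lambda>a. c * h a) \<in> frac_space n t F"
proof -
  have "finite {a. c * h a \<noteq> 0}"
    by (rule finite_subset[of _ "{a. h a \<noteq> 0}"]) (use assms in \<open>auto simp: frac_space_def\<close>)
  then show ?thesis using assms by (auto simp: frac_space_def)
qed

lemma frac_space_sum:
  assumes "finite I" "\<And>i. i \<in> I \<Longrightarrow> g i \<in> frac_space n t F"
  shows "(\<lambda>a. \<Sum>i\<in>I. g i a) \<in> frac_space n t F"
  using assms by (induction I rule: finite_induct) (simp_all add: frac_space_zero frac_space_add)

lemma comm_group_face_localization:
  assumes F: "F \<subseteq> {1..n}"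
  shows "comm_group (face_localization n t F :: ('k::field mpoly set \<times> nat) set monoid)"
proof (rule comm_groupI)
  let ?G = "face_localization n t F :: ('k mpoly set \<times> nat) set monoid"
  note simps = carrier_face_localization[OF F] one_face_localization[OF F]
  show "x \<otimes>\<^bsub>?G\<^esub> y \<in> carrier ?G" if xy: "x \<in> carrier ?G" "y \<in> carrier ?G" for x y
    using xy mult_face_localization[OF F] frac_space_add unfolding simps by fastforce
  show "\<one>\<^bsub>?G\<^esub> \<in> carrier ?G" unfolding simps using frac_space_zero by blast
  show "x \<otimes>\<^bsub>?G\<^esub> y \<otimes>\<^bsub>?G\<^esub> z = x \<otimes>\<^bsub>?G\<^esub> (y \<otimes>\<^bsub>?G\<^esub> z)"
    if xyz: "x \<in> carrier ?G" "y \<in> carrier ?G" "z \<in> carrier ?G" for x y z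
    using xyz unfolding simps
    by (auto simp: mult_face_localization[OF F] frac_space_add add.assoc)
  show "x \<otimes>\<^bsub>?G\<^esub> y = y \<otimes>\<^bsub>?G\<^esub> x" if xy: "x \<in> carrier ?G" "y \<in> carrier ?G" for x y
    using xy unfolding simps by (auto simp: mult_face_localization[OF F] add.commute)
  show "\<one>\<^bsub>?G\<^esub> \<otimes>\<^bsub>?G\<^esub> x = x" if "x \<in> carrier ?G" for x
    using that unfolding simps by (auto simp: mult_face_localization[OF F] frac_space_zero)
  show "\<exists>y\<in>carrier ?G. y \<otimes>\<^bsub>?G\<^esub> x = \<one>\<^bsub>?G\<^esub>" if x: "x \<in> carrier ?G" for x
  proof -
    obtain h where h: "h \<in> frac_space n t F" "x = frac_class n t F h" using x unfolding simps by blast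
    have h': "(\<lambda>a. - 1 * h a) \<in> frac_space n t F" by (rule frac_space_scale[OF h(1)])
    have "frac_class n t F (\<lambda>a. - 1 * h a) \<otimes>\<^bsub>?G\<^esub> x = \<one>\<^bsub>?G\<^esub>"
      unfolding h(2) mult_face_localization[OF F h' h(1)] simps by simp
    then show ?thesis using h' unfolding carrier_face_localization[OF F] by blast
  qed
qed

lemma sign_pow_face_localization:
  assumes F: "F \<subseteq> {1..n}" and h: "h \<in> frac_space n t F"
  shows "frac_class n t F h [^]\<^bsub>face_localization n t F\<^esub> ((- 1) ^ c :: int)
    = frac_class n t F (\<lambda>a. (- 1) ^ c * h a :: 'k::field)"
proof -
  let ?G = "face_localization n t F :: ('k mpoly set \<times> nat) set monoid"
  interpret comm_group ?G by (rule comm_group_face_localization[OF F])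
  have cl: "frac_class n t F g \<in> carrier ?G" if "g \<in> frac_space n t F" for g
    using that unfolding carrier_face_localization[OF F] by blast
  have h': "(\<lambda>a. - 1 * h a) \<in> frac_space n t F" by (rule frac_space_scale[OF h])
  have "frac_class n t F (\<lambda>a. - 1 * h a) \<otimes>\<^bsub>?G\<^esub> frac_class n t F h = \<one>\<^bsub>?G\<^esub>"
    unfolding mult_face_localization[OF F h' h] one_face_localization[OF F] by simp
  then have "inv\<^bsub>?G\<^esub> (frac_class n t F h) = frac_class n t F (\<lambda>a. - 1 * h a)"
    by (rule inv_equality) (rule cl h h')+
  then have "frac_class n t F h [^]\<^bsub>?G\<^esub> (- 1 :: int) = frac_class n t F (\<lambda>a. - h a)"
    using int_pow_neg[OF cl[OF h], of 1] int_pow_1[OF cl[OF h]] by simp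
  then show ?thesis using int_pow_1[OF cl[OF h]] by (cases "even c") simp_all
qed

lemma finprod_face_localization:
  fixes g :: "nat \<Rightarrow> (nat \<Rightarrow> int) \<Rightarrow> 'k::field"
  assumes F: "F \<subseteq> {1..n}" and "finite I" "\<And>i. i \<in> I \<Longrightarrow> g i \<in> frac_space n t F"
  shows "finprod (face_localization n t F) (\<lambda>i. frac_class n t F (g i)) I = frac_class n t F (\<lambda>a. \<Sum>i\<in>I. g i a)"
  using assms(2,3)
proof (induction I rule: finite_induct)
  case empty
  interpret comm_group "face_localization n t F :: ('k mpoly set \<times> nat) set monoid"
    by (rule comm_group_face_localization[OF F])
  show ?case by (simp add: one_face_localization[OF F])
next
  case (insert i I)
  interpret comm_group "face_localization n t F :: ('k mpoly set \<times> nat) set monoid"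
    by (rule comm_group_face_localization[OF F])
  have "finprod (face_localization n t F) (\<lambda>i. frac_class n t F (g i)) (insert i I) =
      frac_class n t F (g i) \<otimes>\<^bsub>face_localization n t F\<^esub> finprod (face_localization n t F) (\<lambda>i. frac_class n t F (g i)) I"
    by (rule finprod_insert) (use insert in \<open>auto simp: carrier_face_localization[OF F]\<close>)
  also have "\<dots> = frac_class n t F (\<lambda>a. g i a + (\<Sum>i\<in>I. g i a))"
    using insert by (simp add: mult_face_localization[OF F] frac_space_sum)
  also have "\<dots> = frac_class n t F (\<lambda>a. \<Sum>i\<in>insert i I. g i a)" using insert by simp
  finally show ?case .
qed

text \<open>Here too all the united sets coincide and there is at least one of them. In coefficients
  the canonical map merely discards the degrees that are not allowed at \<open>F\<close>.\<close>

lemma localization_map_face: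
  fixes h :: "_ \<Rightarrow> 'k::field"
  assumes F: "F \<subseteq> {1..n}" and i: "i \<in> F" and h: "h \<in> frac_space n t (F - {i})"
  shows "localization_map (polynomial_ring n) (power_quotient n t) (finprod (polynomial_ring n) var (F - {i})) (var i)
      (frac_class n t (F - {i}) h) = frac_class n t F (\<lambda>a. if a \<in> allowed n t F then h a else 0)"
proof -
  let ?h = "\<lambda>a. if a \<in> allowed n t F then h a else 0"
  have F': "F - {i} \<subseteq> {1..n}" "finite (F - {i})" "insert i (F - {i}) = F" using F i finite_subset[OF F] by auto
  have vi: "var i [^]\<^bsub>polynomial_ring n\<^esub> k = (xmon (exps {i} k) :: 'k mpoly)" for k :: nat
    using xmon_power[of "{i}" 1 k] by (simp add: pow_polynomial_ring var_def exps_def)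
  have prod: "finprod (polynomial_ring n) var (F - {i}) \<otimes>\<^bsub>polynomial_ring n\<^esub> var i
      = (finprod (polynomial_ring n) var F :: 'k mpoly)"
  proof -
    have "exps (F - {i}) 1 + Poly_Mapping.single i 1 = exps F 1"
      using F i finite_subset[OF F] unfolding exps_def by (simp add: sum.remove add.commute)
    then show ?thesis
      by (simp add: finprod_var[OF F, unfolded One_nat_def] finprod_var[OF F'(1), unfolded One_nat_def]
          var_def mult_single)
  qed
  have x: "(xmon (exps {i} k) :: 'k mpoly) \<in> carrier (polynomial_ring n)" for k
    by (rule carrier_xmon_exps) (use F i in auto)
  have piece: "module_frac (polynomial_ring n) (power_quotient n t)
      (finprod (polynomial_ring n) var (F - {i}) \<otimes>\<^bsub>polynomial_ring n\<^esub> var i)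
      ((var i [^]\<^bsub>polynomial_ring n\<^esub> k) \<odot>\<^bsub>power_quotient n t\<^esub> m) k = frac_class n t F ?h"
    if mk: "(m, k) \<in> frac_class n t (F - {i}) h" for m k
  proof -
    obtain p where p: "p \<in> carrier (polynomial_ring n)" "m = residue n t p" "frac_coeff n t (F - {i}) p k = h"
      using mk unfolding frac_class_def by blast
    have "frac_coeff n t (insert i (F - {i})) (xmon (exps {i} k) * p) k =
      (\<lambda>a. if a \<in> allowed n t (insert i (F - {i})) then frac_coeff n t (F - {i}) p k a else 0)"
      by (rule frac_coeff_restrict) (use F F'(3) in auto)
    then have co: "frac_coeff n t F (xmon (exps {i} k) * p) k = ?h" unfolding F'(3) p(3) .
    show ?thesis
      unfolding prod vi p(2) smult_power_quotient[OF x p(1)]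
        module_frac_eq[OF carrier_mult[OF x p(1)] F] co ..
  qed
  have "\<exists>m k. (m, k) \<in> frac_class n t (F - {i}) h"
    by (rule frac_coeff_surj[OF h F'(1)]) (use frac_classI in blast)
  then show ?thesis unfolding localization_map_def using piece by fastforce
qed

section \<open>The Cech complex in multidegrees\<close>

abbreviation face_set :: "nat \<Rightarrow> nat \<Rightarrow> nat set set" where
  "face_set n p \<equiv> faces {1..n} p"

text \<open>Values away from the faces with \<open>p\<close> elements are fixed to zero, so that a
  Cech cochain comes from exactly one \<open>h\<close>.\<close>

definition graded_cochains :: "nat \<Rightarrow> nat \<Rightarrow> nat \<Rightarrow> (nat set \<Rightarrow> (nat \<Rightarrow> int) \<Rightarrow> 'k::field) set" where
  "graded_cochains n t p =
    {h. (\<forall>F\<in>face_set n p. h F \<in> frac_space n t F) \<and> (\<forall>F. F \<notin> face_set n p \<longrightarrow> h F = (\<lambda>_. 0))}"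

definition graded_diff ::
    "nat \<Rightarrow> nat \<Rightarrow> nat \<Rightarrow> (nat set \<Rightarrow> (nat \<Rightarrow> int) \<Rightarrow> 'k::field) \<Rightarrow> nat set \<Rightarrow> (nat \<Rightarrow> int) \<Rightarrow> 'k" where
  "graded_diff n t p h F a =
    (if F \<in> face_set n (Suc p) \<and> a \<in> allowed n t F then cobd (\<lambda>G. h G a) F else 0)"

definition cech_cochain ::
    "nat \<Rightarrow> nat \<Rightarrow> nat \<Rightarrow> (nat set \<Rightarrow> (nat \<Rightarrow> int) \<Rightarrow> 'k::field) \<Rightarrow> nat set \<Rightarrow> ('k mpoly set \<times> nat) set" where
  "cech_cochain n t p h = (\<lambda>F\<in>face_set n p. frac_class n t F (h F))"

abbreviation cech_grp :: "nat \<Rightarrow> nat \<Rightarrow> nat \<Rightarrow> (nat set \<Rightarrow> ('k::field mpoly set \<times> nat) set) monoid" where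
  "cech_grp n t p \<equiv> cech_group (polynomial_ring n) {1..n} var (power_quotient n t) p"

lemma face_setD: "F \<in> face_set n p \<Longrightarrow> F \<subseteq> {1..n}"
  by (simp add: faces_def)

lemma finite_face_set: "finite (face_set n p)"
  by (rule finite_subset[of _ "Pow {1..n}"]) (auto simp: faces_def)

lemma face_set_remove: "F \<in> face_set n (Suc p) \<Longrightarrow> i \<in> F \<Longrightarrow> F - {i} \<in> face_set n p"
  by (auto simp: faces_def)

lemma carrier_cech_grp:
  "carrier (cech_grp n t p) = cech_cochain n t p ` (graded_cochains n t p :: (_ \<Rightarrow> _ \<Rightarrow> 'k::field) set)"
proof (intro equalityI subsetI)
  fix c :: "nat set \<Rightarrow> ('k mpoly set \<times> nat) set" assume "c \<in> carrier (cech_grp n t p)"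
  then have c: "c \<in> (\<Pi>\<^sub>E F\<in>face_set n p. carrier (face_localization n t F))" by (simp add: cech_group_def)
  have "\<exists>h. h \<in> frac_space n t F \<and> c F = frac_class n t F h" if "F \<in> face_set n p" for F
    using PiE_mem[OF c that] carrier_face_localization[OF face_setD[OF that]] by blast
  then obtain h where h: "\<And>F. F \<in> face_set n p \<Longrightarrow> h F \<in> frac_space n t F \<and> c F = frac_class n t F (h F)"
    by metis
  define h' where "h' F = (if F \<in> face_set n p then h F else (\<lambda>_. 0))" for F
  have "h' \<in> graded_cochains n t p" using h by (auto simp: graded_cochains_def h'_def)
  moreover have "c = cech_cochain n t p h'"
  proof
    fix F show "c F = cech_cochain n t p h' F"
      using h PiE_arb[OF c] by (cases "F \<in> face_set n p") (auto simp: cech_cochain_def h'_def)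
  qed
  ultimately show "c \<in> cech_cochain n t p ` graded_cochains n t p" by blast
next
  fix c :: "nat set \<Rightarrow> ('k mpoly set \<times> nat) set" assume "c \<in> cech_cochain n t p ` graded_cochains n t p"
  then obtain h where h: "h \<in> graded_cochains n t p" "c = cech_cochain n t p h" by blast
  have "c \<in> (\<Pi>\<^sub>E F\<in>face_set n p. carrier (face_localization n t F))"
    unfolding h(2) cech_cochain_def
  proof (rule restrict_PiE_iff[THEN iffD2], rule ballI)
    fix F assume F: "F \<in> face_set n p"
    then have "h F \<in> frac_space n t F" using h(1) by (simp add: graded_cochains_def)
    then show "frac_class n t F (h F) \<in> carrier (face_localization n t F)"
      unfolding carrier_face_localization[OF face_setD[OF F]] by blast
  qed
  then show "c \<in> carrier (cech_grp n t p)" by (simp add: cech_group_def)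
qed

lemma cech_cochain_inj:
  fixes h h' :: "_ \<Rightarrow> _ \<Rightarrow> 'k::field"
  assumes h: "h \<in> graded_cochains n t p" "h' \<in> graded_cochains n t p"
    and eq: "cech_cochain n t p h = cech_cochain n t p h'"
  shows "h = h'"
proof
  fix F
  show "h F = h' F"
  proof (cases "F \<in> face_set n p")
    case True
    have "frac_class n t F (h F) = frac_class n t F (h' F)"
      using fun_cong[OF eq, of F] True by (simp add: cech_cochain_def)
    moreover have "h F \<in> frac_space n t F" using h(1) True by (simp add: graded_cochains_def)
    ultimately show ?thesis using frac_class_inj[OF _ face_setD[OF True]] by blast
  qed (use h in \<open>simp add: graded_cochains_def\<close>)
qed

lemma graded_cochains_zero: "(\<lambda>_ _. 0) \<in> graded_cochains n t p"
  by (simp add: graded_cochains_def frac_space_zero)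

lemma one_cech_grp: "\<one>\<^bsub>cech_grp n t p\<^esub> = cech_cochain n t p (\<lambda>_ _. 0 :: 'k::field)"
  unfolding cech_group_def one_product_group cech_cochain_def
  by (rule restrict_ext) (rule one_face_localization[OF face_setD])

lemma graded_cochains_add:
  assumes "h \<in> graded_cochains n t p" "h' \<in> graded_cochains n t p"
  shows "(\<lambda>F a. h F a + h' F a) \<in> graded_cochains n t p"
  using assms frac_space_add unfolding graded_cochains_def by fastforce

lemma mult_cech_grp:
  fixes h h' :: "_ \<Rightarrow> _ \<Rightarrow> 'k::field"
  assumes "h \<in> graded_cochains n t p" "h' \<in> graded_cochains n t p"
  shows "cech_cochain n t p h \<otimes>\<^bsub>cech_grp n t p\<^esub> cech_cochain n t p h' = cech_cochain n t p (\<lambda>F a. h F a + h' F a)"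
  unfolding cech_group_def mult_product_group
proof (unfold cech_cochain_def, rule restrict_ext)
  fix F assume F: "F \<in> face_set n p"
  then have "h F \<in> frac_space n t F" "h' F \<in> frac_space n t F" using assms by (auto simp: graded_cochains_def)
  then show "(\<lambda>F\<in>face_set n p. frac_class n t F (h F)) F \<otimes>\<^bsub>face_localization n t F\<^esub>
      (\<lambda>F\<in>face_set n p. frac_class n t F (h' F)) F = frac_class n t F (\<lambda>a. h F a + h' F a)"
    using F mult_face_localization[OF face_setD[OF F]] by simp
qed

lemma group_cech_grp: "group (cech_grp n t p :: (nat set \<Rightarrow> ('k::field mpoly set \<times> nat) set) monoid)"
  unfolding cech_group_def
  by (rule product_group) (rule comm_group.axioms(2)[OF comm_group_face_localization[OF face_setD]])

lemma graded_diff_expand: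
  assumes "F \<in> face_set n (Suc p)"
  shows "graded_diff n t p h F =
    (\<lambda>a. \<Sum>i\<in>F. (- 1) ^ card {j \<in> F. j < i} * (if a \<in> allowed n t F then h (F - {i}) a else 0))"
  using assms by (auto simp: graded_diff_def cobd_def fsgn_def)

lemma restrict_allowed_space:
  assumes "h \<in> frac_space n t G"
  shows "(\<lambda>a. if a \<in> allowed n t F then h a else 0) \<in> frac_space n t F"
proof -
  have "finite {a. (if a \<in> allowed n t F then h a else 0) \<noteq> 0}"
    by (rule finite_subset[of _ "{a. h a \<noteq> 0}"]) (use assms in \<open>auto simp: frac_space_def\<close>)
  then show ?thesis by (auto simp: frac_space_def)
qed

lemma graded_diff_cochains:
  fixes h :: "_ \<Rightarrow> _ \<Rightarrow> 'k::field"
  assumes h: "h \<in> graded_cochains n t p"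
  shows "graded_diff n t p h \<in> graded_cochains n t (Suc p)"
proof -
  have "graded_diff n t p h F \<in> frac_space n t F" if F: "F \<in> face_set n (Suc p)" for F
    unfolding graded_diff_expand[OF F]
  proof (rule frac_space_sum)
    show "finite F" using face_setD[OF F] finite_subset by blast
    fix i assume "i \<in> F"
    then have "h (F - {i}) \<in> frac_space n t (F - {i})"
      using h face_set_remove[OF F] by (simp add: graded_cochains_def)
    then show "(\<lambda>a. (- 1) ^ card {j \<in> F. j < i} * (if a \<in> allowed n t F then h (F - {i}) a else 0)) \<in> frac_space n t F"
      by (intro frac_space_scale restrict_allowed_space)
  qed
  moreover have "graded_diff n t p h F = (\<lambda>_. 0)" if "F \<notin> face_set n (Suc p)" for F
    using that by (auto simp: graded_diff_def)
  ultimately show ?thesis by (simp add: graded_cochains_def)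
qed

text \<open>The canonical maps only truncate to the allowed degrees, and the signs of
  \<open>cech_diff\<close> are those of \<open>fsgn\<close>. The differential therefore becomes a
  truncated simplicial coboundary for each exponent vector by itself.\<close>

lemma cech_diff_cochain:
  fixes h :: "_ \<Rightarrow> _ \<Rightarrow> 'k::field"
  assumes h: "h \<in> graded_cochains n t p"
  shows "cech_diff (polynomial_ring n) {1..n} var (power_quotient n t) p (cech_cochain n t p h)
    = cech_cochain n t (Suc p) (graded_diff n t p h)"
  unfolding cech_diff_def
proof (unfold cech_cochain_def[of n t "Suc p"], rule restrict_ext)
  fix F assume F: "F \<in> face_set n (Suc p)"
  have Fn: "F \<subseteq> {1..n}" and fin: "finite F" using face_setD[OF F] finite_subset by blast+
  interpret comm_group "face_localization n t F :: ('k mpoly set \<times> nat) set monoid"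
    by (rule comm_group_face_localization[OF Fn])
  let ?g = "\<lambda>i a. (- 1) ^ card {j \<in> F. j < i} * (if a \<in> allowed n t F then h (F - {i}) a else 0)"
  have hi: "h (F - {i}) \<in> frac_space n t (F - {i})" if "i \<in> F" for i
    using h face_set_remove[OF F that] by (simp add: graded_cochains_def)
  have g: "?g i \<in> frac_space n t F" if "i \<in> F" for i
    by (intro frac_space_scale restrict_allowed_space[OF hi[OF that]])
  have "finprod (face_localization n t F)
      (\<lambda>i. localization_map (polynomial_ring n) (power_quotient n t) (finprod (polynomial_ring n) var (F - {i})) (var i)
          (cech_cochain n t p h (F - {i})) [^]\<^bsub>face_localization n t F\<^esub> ((- 1) ^ card {j \<in> F. j < i} :: int)) F
    = finprod (face_localization n t F) (\<lambda>i. frac_class n t F (?g i)) F"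
  proof (rule finprod_cong')
    show "(\<lambda>i. frac_class n t F (?g i)) \<in> F \<rightarrow> carrier (face_localization n t F)"
      using g unfolding carrier_face_localization[OF Fn] by blast
    fix i assume i: "i \<in> F"
    have "cech_cochain n t p h (F - {i}) = frac_class n t (F - {i}) (h (F - {i}))"
      using face_set_remove[OF F i] by (simp add: cech_cochain_def)
    then show "localization_map (polynomial_ring n) (power_quotient n t) (finprod (polynomial_ring n) var (F - {i})) (var i)
          (cech_cochain n t p h (F - {i})) [^]\<^bsub>face_localization n t F\<^esub> ((- 1) ^ card {j \<in> F. j < i} :: int)
        = frac_class n t F (?g i)"
      by (simp only: localization_map_face[OF Fn i hi[OF i]]
          sign_pow_face_localization[OF Fn restrict_allowed_space[OF hi[OF i]]])
  qed simp
  also have "\<dots> = frac_class n t F (graded_diff n t p h F)"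
    unfolding graded_diff_expand[OF F] by (rule finprod_face_localization[OF Fn fin g])
  finally show "finprod (face_localization n t F)
      (\<lambda>i. localization_map (polynomial_ring n) (power_quotient n t) (finprod (polynomial_ring n) var (F - {i})) (var i)
          (cech_cochain n t p h (F - {i})) [^]\<^bsub>face_localization n t F\<^esub> ((- 1) ^ card {j \<in> F. j < i} :: int)) F
    = frac_class n t F (graded_diff n t p h F)" .
qed

lemma cech_diff_hom:
  "cech_diff (polynomial_ring n) {1..n} var (power_quotient n t) p \<in>
    hom (cech_grp n t p :: (nat set \<Rightarrow> ('k::field mpoly set \<times> nat) set) monoid) (cech_grp n t (Suc p))"
proof (rule homI)
  let ?d = "cech_diff (polynomial_ring n) {1..n} var (power_quotient n t :: ('k mpoly, 'k mpoly set) module) p"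
  fix c assume "c \<in> carrier (cech_grp n t p :: (nat set \<Rightarrow> ('k mpoly set \<times> nat) set) monoid)"
  then obtain h where h: "h \<in> graded_cochains n t p" "c = cech_cochain n t p h"
    unfolding carrier_cech_grp by blast
  show "?d c \<in> carrier (cech_grp n t (Suc p))"
    unfolding h(2) cech_diff_cochain[OF h(1)] carrier_cech_grp by (intro imageI graded_diff_cochains h(1))
  fix c' assume "c' \<in> carrier (cech_grp n t p :: (nat set \<Rightarrow> ('k mpoly set \<times> nat) set) monoid)"
  then obtain h' where h': "h' \<in> graded_cochains n t p" "c' = cech_cochain n t p h'"
    unfolding carrier_cech_grp by blast
  have "graded_diff n t p (\<lambda>F a. h F a + h' F a) = (\<lambda>F a. graded_diff n t p h F a + graded_diff n t p h' F a)"
    by (auto simp: graded_diff_def cobd_def fun_eq_iff sum.distrib algebra_simps)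
  then show "?d (c \<otimes>\<^bsub>cech_grp n t p\<^esub> c') = ?d c \<otimes>\<^bsub>cech_grp n t (Suc p)\<^esub> ?d c'"
    unfolding h(2) h'(2) mult_cech_grp[OF h(1) h'(1)] cech_diff_cochain[OF graded_cochains_add[OF h(1) h'(1)]]
      cech_diff_cochain[OF h(1)] cech_diff_cochain[OF h'(1)]
      mult_cech_grp[OF graded_diff_cochains[OF h(1)] graded_diff_cochains[OF h'(1)]] by simp
qed

section \<open>Cocycles, coboundaries and their quotient\<close>

abbreviation cocycles :: "nat \<Rightarrow> nat \<Rightarrow> nat \<Rightarrow> (nat set \<Rightarrow> ('k::field mpoly set \<times> nat) set) set" where
  "cocycles n t p \<equiv> cech_cocycles (polynomial_ring n) {1..n} var (power_quotient n t) p"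

abbreviation coboundaries :: "nat \<Rightarrow> nat \<Rightarrow> nat \<Rightarrow> (nat set \<Rightarrow> ('k::field mpoly set \<times> nat) set) set" where
  "coboundaries n t p \<equiv> cech_coboundaries (polynomial_ring n) {1..n} var (power_quotient n t) p"

lemma subgroup_cocycles: "subgroup (cocycles n t p) (cech_grp n t p :: (nat set \<Rightarrow> ('k::field mpoly set \<times> nat) set) monoid)"
proof -
  interpret group_hom "cech_grp n t p :: (nat set \<Rightarrow> ('k mpoly set \<times> nat) set) monoid" "cech_grp n t (Suc p)"
    "cech_diff (polynomial_ring n) {1..n} var (power_quotient n t) p"
    by (rule group_hom.intro[OF group_cech_grp group_cech_grp group_hom_axioms.intro[OF cech_diff_hom]])
  show ?thesis unfolding cech_cocycles_def by (rule subgroup_kernel)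
qed

lemma cocycles_eq:
  "cocycles n t p = cech_cochain n t p ` {h \<in> graded_cochains n t p. graded_diff n t p h = (\<lambda>_ _. 0 :: 'k::field)}"
proof -
  have iff: "cech_diff (polynomial_ring n) {1..n} var (power_quotient n t) p (cech_cochain n t p h)
        = \<one>\<^bsub>cech_grp n t (Suc p)\<^esub> \<longleftrightarrow> graded_diff n t p h = (\<lambda>_ _. 0)"
    if "h \<in> graded_cochains n t p" for h :: "_ \<Rightarrow> _ \<Rightarrow> 'k"
    unfolding cech_diff_cochain[OF that] one_cech_grp
    by (rule iffI, erule cech_cochain_inj[OF graded_diff_cochains[OF that] graded_cochains_zero]) simp
  have "cocycles n t p = {c \<in> cech_cochain n t p ` (graded_cochains n t p :: (_ \<Rightarrow> _ \<Rightarrow> 'k) set).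
      cech_diff (polynomial_ring n) {1..n} var (power_quotient n t) p c = \<one>\<^bsub>cech_grp n t (Suc p)\<^esub>}"
    unfolding cech_cocycles_def kernel_def carrier_cech_grp ..
  then show ?thesis using iff by auto
qed

lemma coboundaries_0: "coboundaries n t 0 = {cech_cochain n t 0 (\<lambda>_ _. 0 :: 'k::field)}"
  unfolding cech_coboundaries_def by (simp only: nat.case one_cech_grp)

lemma coboundaries_Suc:
  "coboundaries n t (Suc p) = (\<lambda>h. cech_cochain n t (Suc p) (graded_diff n t p h)) `
     (graded_cochains n t p :: (_ \<Rightarrow> _ \<Rightarrow> 'k::field) set)"
  unfolding cech_coboundaries_def nat.case carrier_cech_grp image_image
  by (rule image_cong[OF refl]) (rule cech_diff_cochain)

lemma local_cohomology_eq:
  "local_cohomology (polynomial_ring n) {1..n} var (power_quotient n t) p =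
    (cech_grp n t p)\<lparr>carrier := cocycles n t p\<rparr> Mod coboundaries n t p"
  by (simp add: local_cohomology_def)

lemma trivial_group_Mod_self:
  assumes "group G"
  shows "trivial_group (G Mod carrier G)"
proof -
  interpret group G by fact
  have "carrier G \<lhd> G"
  proof (rule normalI[OF subgroup_self], rule ballI)
    fix x assume x: "x \<in> carrier G"
    show "carrier G #>\<^bsub>G\<^esub> x = x <#\<^bsub>G\<^esub> carrier G"
      unfolding coset_join2[OF x subgroup_self x] coset_join3[OF x subgroup_self x] ..
  qed
  then have "group (G Mod carrier G)" by (rule normal.factorgroup_is_group)
  moreover have "carrier (G Mod carrier G) = {carrier G}"
    unfolding carrier_FactGroup using coset_join2[OF _ subgroup_self] by auto
  ultimately show ?thesis by (simp add: trivial_group_def)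
qed

lemma trivial_local_cohomology:
  assumes "coboundaries n t p = (cocycles n t p :: (nat set \<Rightarrow> ('k::field mpoly set \<times> nat) set) set)"
  shows "trivial_group (local_cohomology (polynomial_ring n) {1..n} var (power_quotient n t :: ('k mpoly, 'k mpoly set) module) p)"
proof -
  let ?G = "(cech_grp n t p)\<lparr>carrier := cocycles n t p\<rparr> :: (nat set \<Rightarrow> ('k mpoly set \<times> nat) set) monoid"
  have "group ?G" by (rule subgroup.subgroup_is_group[OF subgroup_cocycles group_cech_grp])
  then have "trivial_group (?G Mod carrier ?G)" by (rule trivial_group_Mod_self)
  then show ?thesis unfolding local_cohomology_eq assms by simp
qed

text \<open>The coset of \<open>c\<close> contains \<open>c\<close>, because the unit is a
  coboundary. In a trivial quotient that coset would be the set of coboundaries itself.\<close>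

lemma nontrivial_local_cohomology:
  fixes c :: "nat set \<Rightarrow> ('k::field mpoly set \<times> nat) set"
  assumes one: "\<one>\<^bsub>cech_grp n t p\<^esub> \<in> (coboundaries n t p :: (nat set \<Rightarrow> ('k mpoly set \<times> nat) set) set)"
    and c: "c \<in> cocycles n t p" "c \<notin> coboundaries n t p"
  shows "\<not> trivial_group (local_cohomology (polynomial_ring n) {1..n} var (power_quotient n t :: ('k mpoly, 'k mpoly set) module) p)"
proof
  let ?G = "(cech_grp n t p)\<lparr>carrier := cocycles n t p\<rparr> :: (nat set \<Rightarrow> ('k mpoly set \<times> nat) set) monoid"
  interpret group "cech_grp n t p :: (nat set \<Rightarrow> ('k mpoly set \<times> nat) set) monoid" by (rule group_cech_grp)
  assume "trivial_group (local_cohomology (polynomial_ring n) {1..n} var (power_quotient n t :: ('k mpoly, 'k mpoly set) module) p)"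
  then have "carrier (?G Mod coboundaries n t p) = {coboundaries n t p}"
    unfolding local_cohomology_eq trivial_group_def by simp
  moreover have "r_coset ?G (coboundaries n t p) c \<in> carrier (?G Mod coboundaries n t p)"
    unfolding carrier_FactGroup using c(1) by simp
  ultimately have eq: "r_coset ?G (coboundaries n t p) c = coboundaries n t p" by simp
  have "\<one>\<^bsub>cech_grp n t p\<^esub> \<otimes>\<^bsub>cech_grp n t p\<^esub> c \<in> r_coset ?G (coboundaries n t p) c"
    using one by (auto simp: r_coset_def)
  then show False
    unfolding eq l_one[OF subgroup.mem_carrier[OF subgroup_cocycles c(1)]] using c(2) by contradiction
qed

section \<open>Local cohomology from the multigraded pieces\<close>

abbreviation degree_complex :: "nat \<Rightarrow> nat \<Rightarrow> (nat \<Rightarrow> int) \<Rightarrow> nat set set" where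
  "degree_complex n t a \<equiv> path_misses n (neg_set a) (light_edges n t a)"

text \<open>The roles of face and degree are exchanged here: the degrees allowed at a face turn into
  the faces present in a degree, which splits the complex into one set family per degree.\<close>

lemma allowed_iff:
  assumes "F \<subseteq> {1..n}" "a \<in> exp_range n"
  shows "a \<in> allowed n t F \<longleftrightarrow> F \<in> degree_complex n t a"
proof -
  have "neg_set a \<subseteq> {1..n}" using assms(2) by (force simp: neg_set_def exp_range_def)
  then have "neg_set a \<inter> {1..n} = neg_set a" by blast
  then show ?thesis using assms by (simp add: allowed_def path_misses_def)
qed

lemma degree_complex_convex: "convex_family (degree_complex n t a)"
  unfolding convex_family_def path_misses_def by (auto intro: finite_subset)

lemma degree_complex_face: "F \<in> degree_complex n t a \<Longrightarrow> F \<in> face_set n (card F)"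
  by (auto simp: path_misses_def faces_def intro: finite_subset)

lemma graded_cochains_degree:
  assumes h: "h \<in> graded_cochains n t p"
  shows "h F a \<noteq> 0 \<Longrightarrow> a \<in> exp_range n" "(\<lambda>F. h F a) \<in> cochains (degree_complex n t a) p"
proof -
  have *: "F \<in> face_set n p \<and> a \<in> allowed n t F" if "h F a \<noteq> 0" for F a
    using h that by (cases "F \<in> face_set n p") (auto simp: graded_cochains_def frac_space_def)
  show "h F a \<noteq> 0 \<Longrightarrow> a \<in> exp_range n" using *[of F a] by (simp add: allowed_def)
  show "(\<lambda>F. h F a) \<in> cochains (degree_complex n t a) p"
    unfolding cochains_def
  proof (intro CollectI allI impI)
    fix F assume "h F a \<noteq> 0"
    then have F: "F \<in> face_set n p" "a \<in> allowed n t F" using * by auto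
    then have "a \<in> exp_range n" by (simp add: allowed_def)
    then show "F \<in> degree_complex n t a \<and> card F = p"
      using F allowed_iff[OF face_setD[OF F(1)]] by (simp add: faces_def)
  qed
qed

text \<open>\<open>graded_diff\<close> looks only at faces with \<open>p + 1\<close> elements,
  \<open>cobd_on\<close> at all members. They agree because the coboundary of a cochain supported on
  \<open>p\<close>-element sets is nonzero only on sets with one more element.\<close>

lemma graded_diff_degree:
  assumes h: "\<And>F. h F a \<noteq> 0 \<Longrightarrow> F \<in> degree_complex n t a \<and> card F = p" and a: "a \<in> exp_range n"
  shows "graded_diff n t p h F a = cobd_on (degree_complex n t a) (\<lambda>G. h G a) F"
proof (cases "F \<in> degree_complex n t a")
  case True
  have Fn: "F \<subseteq> {1..n}" using True by (simp add: path_misses_def)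
  show ?thesis
  proof (cases "card F = Suc p")
    case card: True
    then show ?thesis using degree_complex_face[OF True] allowed_iff[OF Fn a] True
      by (simp add: graded_diff_def cobd_on_def)
  next
    case card: False
    have "cobd_on (degree_complex n t a) (\<lambda>G. h G a) F = 0"
    proof (rule ccontr)
      assume "cobd_on (degree_complex n t a) (\<lambda>G. h G a) F \<noteq> 0"
      from cobd_on_nonzeroD(2)[OF this degree_complex_convex]
      obtain i where "h (F - {i}) a \<noteq> 0" "card F = Suc (card (F - {i}))" by blast
      then show False using h[of "F - {i}"] card by simp
    qed
    then show ?thesis using card by (simp add: graded_diff_def faces_def)
  qed
next
  case False
  then have "\<not> (F \<in> face_set n (Suc p) \<and> a \<in> allowed n t F)"
    using allowed_iff[OF face_setD a] by blast
  then show ?thesis using False by (auto simp: graded_diff_def cobd_on_def)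
qed

lemma graded_diff_diff:
  assumes h: "h \<in> graded_cochains n t p"
  shows "graded_diff n t (Suc p) (graded_diff n t p h) = (\<lambda>_ _. 0 :: 'k::field)"
proof (intro ext)
  fix F a
  have dh: "graded_diff n t p h \<in> graded_cochains n t (Suc p)" by (rule graded_diff_cochains[OF h])
  have ddh: "graded_diff n t (Suc p) (graded_diff n t p h) \<in> graded_cochains n t (Suc (Suc p))"
    by (rule graded_diff_cochains[OF dh])
  show "graded_diff n t (Suc p) (graded_diff n t p h) F a = 0"
  proof (cases "a \<in> exp_range n")
    case True
    have "graded_diff n t (Suc p) (graded_diff n t p h) F a
        = cobd_on (degree_complex n t a) (\<lambda>G. graded_diff n t p h G a) F"
      by (rule graded_diff_degree[OF _ True]) (use graded_cochains_degree(2)[OF dh, of a] in \<open>rule cochainsD\<close>)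
    also have "(\<lambda>G. graded_diff n t p h G a) = cobd_on (degree_complex n t a) (\<lambda>G. h G a)"
      by (rule ext, rule graded_diff_degree[OF _ True])
        (use graded_cochains_degree(2)[OF h, of a] in \<open>rule cochainsD\<close>)
    also have "cobd_on (degree_complex n t a) (cobd_on (degree_complex n t a) (\<lambda>G. h G a)) = (\<lambda>_. 0)"
      by (rule cobd_on_cobd_on[OF degree_complex_convex])
        (use cochainsD[OF graded_cochains_degree(2)[OF h, of a]] in blast)
    finally show ?thesis .
  qed (use graded_cochains_degree(1)[OF ddh, of F a] in blast)
qed

lemma coboundaries_subset: "coboundaries n t p \<subseteq> (cocycles n t p :: (nat set \<Rightarrow> ('k::field mpoly set \<times> nat) set) set)"
proof (cases p)
  case 0
  have "graded_diff n t 0 (\<lambda>_ _. 0) = (\<lambda>_ _. 0 :: 'k)" by (auto simp: graded_diff_def cobd_def fun_eq_iff)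
  then show ?thesis unfolding 0 coboundaries_0 cocycles_eq using graded_cochains_zero by blast
next
  case (Suc q)
  show ?thesis
    unfolding Suc coboundaries_Suc cocycles_eq using graded_diff_cochains graded_diff_diff by blast
qed

lemma cocycles_subset:
  assumes exact: "\<And>a. a \<in> exp_range n \<Longrightarrow> exact_at TYPE('k::field) (degree_complex n t a) p"
  shows "cocycles n t p \<subseteq> (coboundaries n t p :: (nat set \<Rightarrow> ('k mpoly set \<times> nat) set) set)"
proof
  fix c :: "nat set \<Rightarrow> ('k mpoly set \<times> nat) set" assume "c \<in> cocycles n t p"
  then obtain h where h: "h \<in> graded_cochains n t p" "graded_diff n t p h = (\<lambda>_ _. 0)" "c = cech_cochain n t p h"
    unfolding cocycles_eq by blast
  have "\<exists>b. (\<forall>F. b F \<noteq> 0 \<longrightarrow> F \<in> degree_complex n t a \<and> Suc (card F) = p) \<and>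
      cobd_on (degree_complex n t a) b = (\<lambda>F. h F a)" if a: "a \<in> exp_range n" for a
  proof -
    have hc: "(\<lambda>F. h F a) \<in> cochains (degree_complex n t a) p" by (rule graded_cochains_degree(2)[OF h(1)])
    have "cobd_on (degree_complex n t a) (\<lambda>F. h F a) F = 0" for F
      using graded_diff_degree[of h a n t p F, OF cochainsD[OF hc] a] h(2) by simp
    then have "cobd_on (degree_complex n t a) (\<lambda>F. h F a) = (\<lambda>_. 0)" by (rule ext)
    from exact_atE[OF exact[OF a] hc this] show ?thesis by (metis (no_types))
  qed
  then obtain b where b: "\<And>a. a \<in> exp_range n \<Longrightarrow>
      (\<forall>F. b a F \<noteq> 0 \<longrightarrow> F \<in> degree_complex n t a \<and> Suc (card F) = p) \<and>
      cobd_on (degree_complex n t a) (b a) = (\<lambda>F. h F a)"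
    by metis
  show "c \<in> coboundaries n t p"
  proof (cases p)
    case 0
    have "h F a = 0" for F a
    proof (cases "a \<in> exp_range n")
      case True
      then have "b a = (\<lambda>_. 0)" using b[OF True] 0 by (intro ext) auto
      then have "(\<lambda>F. h F a) = (\<lambda>_. 0)" using b[OF True] by simp
      then show ?thesis by (rule fun_cong)
    qed (use graded_cochains_degree(1)[OF h(1)] in blast)
    then have "h = (\<lambda>_ _. 0)" by (intro ext)
    then show ?thesis unfolding h(3) 0 coboundaries_0 by simp
  next
    case (Suc q)
    \<comment> \<open>Taking zero instead of \<open>b a\<close> in the degrees where
      \<open>h\<close> vanishes keeps the support finite, so that the primitives chosen degree by
      degree form a genuine cochain.\<close>
    define g where "g F a = (if a \<in> exp_range n \<and> (\<exists>G. h G a \<noteq> 0) then b a F else 0)" for F a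
    have gD: "a \<in> exp_range n \<and> F \<in> degree_complex n t a \<and> card F = q" if "g F a \<noteq> 0" for F a
      using that b[of a] Suc by (auto simp: g_def split: if_splits)
    have fin: "finite {a. \<exists>G. h G a \<noteq> 0}"
    proof (rule finite_subset)
      show "{a. \<exists>G. h G a \<noteq> 0} \<subseteq> (\<Union>G\<in>face_set n p. {a. h G a \<noteq> 0})"
        using h(1) by (auto simp: graded_cochains_def)
      show "finite (\<Union>G\<in>face_set n p. {a. h G a \<noteq> 0})"
        using h(1) finite_face_set by (auto simp: graded_cochains_def frac_space_def)
    qed
    have "g F \<in> frac_space n t F" if F: "F \<in> face_set n q" for F
    proof -
      have "finite {a. g F a \<noteq> 0}"
        by (rule finite_subset[OF _ fin]) (auto simp: g_def)
      moreover have "a \<in> allowed n t F" if "g F a \<noteq> 0" for a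
        using gD[OF that] allowed_iff[OF face_setD[OF F]] by blast
      ultimately show ?thesis by (simp add: frac_space_def)
    qed
    moreover have "g F = (\<lambda>_. 0)" if F: "F \<notin> face_set n q" for F
    proof
      fix a show "g F a = 0" using gD[of F a] degree_complex_face F by blast
    qed
    ultimately have g: "g \<in> graded_cochains n t q" by (simp add: graded_cochains_def)
    have "graded_diff n t q g F a = h F a" for F a
    proof (cases "a \<in> exp_range n")
      case True
      have eq: "graded_diff n t q g F a = cobd_on (degree_complex n t a) (\<lambda>G. g G a) F"
        by (rule graded_diff_degree[OF _ True]) (use gD in blast)
      show ?thesis
      proof (cases "\<exists>G. h G a \<noteq> 0")
        case ex: True
        then have "(\<lambda>G. g G a) = b a" using True by (simp add: g_def)
        then show ?thesis using eq b[OF True] by (simp add: fun_eq_iff)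
      next
        case nex: False
        then have "(\<lambda>G. g G a) = (\<lambda>_. 0)" by (simp add: g_def)
        then show ?thesis using eq nex by simp
      qed
    next
      case False
      then show ?thesis
        using graded_cochains_degree(1)[OF h(1)] graded_cochains_degree(1)[OF graded_diff_cochains[OF g]] by metis
    qed
    then have "graded_diff n t q g = h" by (intro ext)
    then show ?thesis unfolding h(3) Suc coboundaries_Suc using g by blast
  qed
qed

text \<open>A cocycle \<open>z\<close> of the degree \<open>a\<close> piece that does not bound is
  placed in degree \<open>a\<close> alone. A primitive of the resulting Cech cocycle, read in degree
  \<open>a\<close>, would be a primitive of \<open>z\<close>.\<close>

lemma cocycle_not_coboundary:
  assumes a: "a \<in> exp_range n" and ne: "\<not> exact_at TYPE('k::field) (degree_complex n t a) p"
  obtains c :: "nat set \<Rightarrow> ('k::field mpoly set \<times> nat) set" where "c \<in> cocycles n t p" "c \<notin> coboundaries n t p"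
proof -
  let ?D = "degree_complex n t a"
  obtain z :: "nat set \<Rightarrow> 'k" where z: "z \<in> cochains ?D p" "cobd_on ?D z = (\<lambda>_. 0)"
    and nob: "\<And>b. (\<forall>F. b F \<noteq> 0 \<longrightarrow> F \<in> ?D \<and> Suc (card F) = p) \<Longrightarrow> cobd_on ?D b \<noteq> z"
    using ne unfolding exact_at_def by metis
  define h where "h F a' = (if a' = a then z F else 0)" for F a'
  have hz: "(\<lambda>G. h G a) = z" by (simp add: h_def)
  have hD: "a' = a \<and> F \<in> ?D \<and> card F = p" if "h F a' \<noteq> 0" for F a'
    using that cochainsD[OF z(1), of F] by (auto simp: h_def split: if_splits)
  have "h F \<in> frac_space n t F" if F: "F \<in> face_set n p" for F
  proof -
    have "finite {a'. h F a' \<noteq> 0}" by (rule finite_subset[of _ "{a}"]) (use hD in auto)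
    moreover have "a' \<in> allowed n t F" if "h F a' \<noteq> 0" for a'
      using hD[OF that] allowed_iff[OF face_setD[OF F] a] by blast
    ultimately show ?thesis by (simp add: frac_space_def)
  qed
  moreover have "h F = (\<lambda>_. 0)" if F: "F \<notin> face_set n p" for F
  proof
    fix a' show "h F a' = 0" using hD[of F a'] degree_complex_face F by blast
  qed
  ultimately have h: "h \<in> graded_cochains n t p" by (simp add: graded_cochains_def)
  have "graded_diff n t p h F a' = 0" for F a'
  proof (cases "a' = a")
    case True
    have "graded_diff n t p h F a = cobd_on ?D (\<lambda>G. h G a) F"
      by (rule graded_diff_degree[OF _ a]) (use hD in blast)
    then show ?thesis using z(2) True by (simp add: hz)
  next
    case False
    then show ?thesis by (simp add: graded_diff_def cobd_def h_def)
  qed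
  then have dh: "graded_diff n t p h = (\<lambda>_ _. 0)" by (intro ext)
  have "cech_cochain n t p h \<in> cocycles n t p" unfolding cocycles_eq using h dh by blast
  moreover have "cech_cochain n t p h \<notin> coboundaries n t p"
  proof
    assume cob: "cech_cochain n t p h \<in> coboundaries n t p"
    show False
    proof (cases p)
      case 0
      then have "h = (\<lambda>_ _. 0)"
        using cech_cochain_inj[OF h graded_cochains_zero] cob unfolding 0 coboundaries_0 by simp
      then have "z = (\<lambda>_. 0)" using hz by metis
      then show False using nob[of "\<lambda>_. 0"] by simp
    next
      case (Suc q)
      obtain g :: "nat set \<Rightarrow> (nat \<Rightarrow> int) \<Rightarrow> 'k" where g: "g \<in> graded_cochains n t q"
          "cech_cochain n t p h = cech_cochain n t p (graded_diff n t q g)"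
        using cob unfolding Suc coboundaries_Suc by blast
      have hg: "h = graded_diff n t q g"
        by (rule cech_cochain_inj[OF h _ g(2)]) (use graded_diff_cochains[OF g(1)] Suc in simp)
      have gc: "(\<lambda>F. g F a) \<in> cochains ?D q" by (rule graded_cochains_degree(2)[OF g(1)])
      have "cobd_on ?D (\<lambda>G. g G a) F = z F" for F
        using graded_diff_degree[of g a n t q F, OF cochainsD[OF gc] a] hg hz by (metis (no_types))
      then have dg: "cobd_on ?D (\<lambda>G. g G a) = z" by (rule ext)
      have "\<forall>F. g F a \<noteq> 0 \<longrightarrow> F \<in> ?D \<and> Suc (card F) = p"
        using cochainsD[OF gc] Suc by simp
      from nob[OF this] show False using dg by contradiction
    qed
  qed
  ultimately show ?thesis by (rule that)
qed

lemma trivial_local_cohomology_iff: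
  "trivial_group (local_cohomology (polynomial_ring n) {1..n} var (power_quotient n t :: ('k::field mpoly, 'k mpoly set) module) p)
    \<longleftrightarrow> (\<forall>a\<in>exp_range n. exact_at TYPE('k) (degree_complex n t a) p)" (is "?L \<longleftrightarrow> ?R")
proof
  assume ?R
  then have "coboundaries n t p = (cocycles n t p :: (nat set \<Rightarrow> ('k mpoly set \<times> nat) set) set)"
    using coboundaries_subset cocycles_subset by blast
  then show ?L by (rule trivial_local_cohomology)
next
  assume L: ?L
  show ?R
  proof (rule ccontr)
    assume "\<not> ?R"
    then obtain a where a: "a \<in> exp_range n" "\<not> exact_at TYPE('k) (degree_complex n t a) p" by blast
    obtain c :: "nat set \<Rightarrow> ('k mpoly set \<times> nat) set" where c: "c \<in> cocycles n t p" "c \<notin> coboundaries n t p"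
      by (rule cocycle_not_coboundary[OF a])
    have "\<one>\<^bsub>cech_grp n t p\<^esub> \<in> (coboundaries n t p :: (nat set \<Rightarrow> ('k mpoly set \<times> nat) set) set)"
    proof (cases p)
      case 0
      then show ?thesis unfolding 0 coboundaries_0 one_cech_grp by simp
    next
      case (Suc q)
      have "graded_diff n t q (\<lambda>_ _. 0) = (\<lambda>_ _. 0 :: 'k)" by (auto simp: graded_diff_def cobd_def fun_eq_iff)
      then show ?thesis unfolding Suc coboundaries_Suc one_cech_grp using graded_cochains_zero by (metis imageI)
    qed
    from nontrivial_local_cohomology[OF this c] show False using L by contradiction
  qed
qed

section \<open>The depth\<close>

lemma depth_path_power:
  assumes "1 \<le> t" "1 \<le> m" "n = 2 * m + 1"
  shows "depth n (power_quotient n t :: ('k::field mpoly, 'k mpoly set) module) = enat (m + m div (2 * t + 1))"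
proof -
  let ?d = "m + m div (2 * t + 1)"
  let ?S = "{enat i | i. \<not> trivial_group (local_cohomology (polynomial_ring n) {1..n} var
      (power_quotient n t :: ('k mpoly, 'k mpoly set) module) i)}"
  obtain a where a: "\<And>i. i \<notin> {1..n} \<Longrightarrow> a i = 0" "n \<notin> neg_set a"
      "\<not> exact_at TYPE('k) (path_covers n (neg_set a) (light_edges n t a) 1) (Suc ?d)"
    by (rule extremal_exponents[OF assms(1,3,2)]) blast
  have "a \<in> exp_range n" using a(1) by (simp add: exp_range_def)
  \<comment> \<open>The vertex \<open>n\<close> is not negative in the extremal degree, so the class
    of the cover family in degree \<open>?d + 1\<close> yields one in degree
    \<open>?d\<close>.\<close>
  moreover have "\<not> exact_at TYPE('k) (degree_complex n t a) ?d"
    using path_misses_exact[OF light_edges_avoid, of n n a t] a assms by auto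
  ultimately have "enat ?d \<in> ?S" unfolding trivial_local_cohomology_iff by blast
  moreover have "enat ?d \<le> x" if x: "x \<in> ?S" for x
  proof -
    obtain i b where i: "x = enat i" "b \<in> exp_range n" "\<not> exact_at TYPE('k) (degree_complex n t b) i"
      using x unfolding trivial_local_cohomology_iff by blast
    \<comment> \<open>If all entries were negative there would be no light edge, and the empty
      family is exact in every degree.\<close>
    have "\<exists>v\<in>{1..n}. v \<notin> neg_set b"
    proof (rule ccontr)
      assume neg: "\<not> ?thesis"
      have "light_edges n t b = {}"
      proof (rule equals0I)
        fix j assume "j \<in> light_edges n t b"
        then have "j \<in> {1..n}" "0 \<le> b j" by (auto simp: light_edges_def)
        then show False using neg by (force simp: neg_set_def)
      qed
      then have "degree_complex n t b = {}" by (simp add: path_misses_def)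
      moreover have "convex_family {}" by (simp add: convex_family_def)
      then have "exact_at TYPE('k) ({} :: nat set set) i" by (rule exact_cone) simp
      ultimately show False using i(3) by simp
    qed
    then obtain v where "v \<in> {1..n}" "v \<notin> neg_set b" by blast
    from path_misses_exact[OF light_edges_avoid this]
    have "\<not> exact_at TYPE('k) (path_covers n (neg_set b) (light_edges n t b) 1) (Suc i)"
      using i(3) by blast
    from path_covers_degree_bound[OF this assms(1,3)] show ?thesis using i(1) by simp
  qed
  ultimately have "Inf ?S = enat ?d" by (intro cInf_eq_minimum)
  then show ?thesis by (simp add: depth_def)
qed

theorem theorem3p4:
  fixes n :: nat and R :: "'k::field mpoly ring" and J :: "'k mpoly set"
  assumes "n \<ge> 3" and "odd n"
    and "R = polynomial_ring n"
    and "J = cover_ideal n (path_edges n)"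
  shows "(\<forall>k. n = 4 * k + 3 \<longrightarrow>
            (\<forall>t\<ge>1. depth n (quotient_module R (J [^]\<^bsub>ideals_set R\<^esub> (t::nat))) =
               enat (if t \<le> k then (2 * k + 1) + (2 * k + 1) div (2 * t + 1) else 2 * k + 1)))
       \<and> (\<forall>k. n = 4 * k + 1 \<longrightarrow>
            (\<forall>t\<ge>1. depth n (quotient_module R (J [^]\<^bsub>ideals_set R\<^esub> (t::nat))) =
               enat (if t \<le> k - 1 then 2 * k + (2 * k) div (2 * t + 1) else 2 * k)))"
proof -
  have depth: "depth n (quotient_module R (J [^]\<^bsub>ideals_set R\<^esub> t)) = enat (m + m div (2 * t + 1))"
    if "n = 2 * m + 1" "1 \<le> t" for m t :: nat
    unfolding assms(3,4) cover_ideal_power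
    by (rule depth_path_power) (use that \<open>n \<ge> 3\<close> in auto)
  show ?thesis
  proof (intro conjI allI impI)
    fix k t :: nat
    assume n: "n = 4 * k + 3" and t: "1 \<le> t"
    \<comment> \<open>Here \<open>m = 2 k + 1\<close>. For \<open>t > k\<close> the divisor
      \<open>2 t + 1\<close> exceeds \<open>2 k + 1\<close> and the quotient is zero, so both
      branches are instances of one formula.\<close>
    show "depth n (quotient_module R (J [^]\<^bsub>ideals_set R\<^esub> t)) =
        enat (if t \<le> k then (2 * k + 1) + (2 * k + 1) div (2 * t + 1) else 2 * k + 1)"
      using depth[of "2 * k + 1" t] n t by simp
  next
    fix k t :: nat
    assume n: "n = 4 * k + 1" and t: "1 \<le> t"
    \<comment> \<open>Here \<open>m = 2 k\<close>, and \<open>k \<ge> 1\<close> because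
      \<open>n \<ge> 3\<close>; for \<open>t \<ge> k\<close> the divisor \<open>2 t + 1\<close>
      exceeds \<open>2 k\<close>.\<close>
    show "depth n (quotient_module R (J [^]\<^bsub>ideals_set R\<^esub> t)) =
        enat (if t \<le> k - 1 then 2 * k + (2 * k) div (2 * t + 1) else 2 * k)"
      using depth[of "2 * k" t] n t by simp
  qed
qed

end
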